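(* Let $\Gamma$ be a nontrivial additive subgroup of $\mathbb{R}$ and let $N$ be a lattice (finitely generated free abelian group). For any $\Gamma$-admissible fan $\Sigma$ in $N_{\mathbb{R}}\times\mathbb{R}_{\geq0}$ there is a complete $\Gamma$-admissible fan $\overline{\Sigma}$ in $N_{\mathbb{R}}\times\mathbb{R}_{\geq0}$ containing $\Sigma$ as a subfan.
   Context: Let $M=\operatorname{Hom}(N,\mathbb{Z})$, $N_{\mathbb{R}}=N\otimes_{\mathbb{Z}}\mathbb{R}$, and let $\langle\cdot,\cdot\rangle$ be the natural pairing. A polyhedral complex is a finite collection of polyhedra, closed under taking faces, such that any two members intersect either in the empty set or in a common face of both. A fan is a nonempty polyhedral complex consisting of strongly convex cones (cones containing no line). A fan in $N_{\mathbb{R}}\times\mathbb{R}_{\ge0}$ is a fan in $N_{\mathbb{R}}\times\mathbb{R}$ all of whose cones lie in the half-space $N_{\mathbb{R}}\times\mathbb{R}_{\geq0}$; it is complete if the union of its cones is all of $N_{\mathbb{R}}\times\mathbb{R}_{\geq0}$. A cone $\sigma\subset N_{\mathbb{R}}\times\mathbb{R}_{\ge0}$ is $\Gamma$-admissible if it is strongly convex and can be written as $$\sigma=\{(w,t)\in N_{\mathbb{R}}\times\mathbb{R}_{\geq0}\mid \langle u_i,w\rangle+\gamma_i t\geq0\text{ for }i=1,\ldots,\ell\}$$ for some $u_1,\ldots,u_\ell\in M$ and $\gamma_1,\ldots,\gamma_\ell\in\Gamma$. A fan in $N_{\mathbb{R}}\times\mathbb{R}_{\ge0}$ is $\Gamma$-admissible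 if all of its cones are. *)

theory Defs
  imports "HOL-Analysis.Analysis"
begin

text \<open>
  A lattice \<open>N\<close> is realised inside a Euclidean space as the integer span of a finite linearly
  independent set, so that \<open>N\<^sub>\<real>\<close> is \<open>span N\<close>.  The lattice need not have full rank: since
  every Euclidean space has positive dimension, this is what admits rank 0.
\<close>

definition is_lattice :: "'a::euclidean_space set \<Rightarrow> bool" where
  "is_lattice N \<longleftrightarrow> (\<exists>B. finite B \<and> independent B \<and>
      N = {\<Sum>b\<in>B. of_int (c b) *\<^sub>R b | c :: 'a \<Rightarrow> int. True})"

text \<open>
  \<open>M = Hom(N, \<int>)\<close>, each homomorphism being represented by a real linear functional extending it;
  the pairing \<open>\<langle>u, w\<rangle>\<close> is then \<open>u w\<close>.  If \<open>N\<close> does not have full rank, several functionals represent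
  the same homomorphism, but they agree on \<open>span N\<close>.  The two lemmas below justify the encoding.
\<close>

definition dual_lattice :: "'a::euclidean_space set \<Rightarrow> ('a \<Rightarrow> real) set" where
  "dual_lattice N = {u. linear u \<and> (\<forall>x\<in>N. u x \<in> \<int>)}"

lemma dual_lattice_extends_hom:
  fixes f :: "'a::euclidean_space \<Rightarrow> int"
  assumes "is_lattice N" and add: "\<And>x y. x \<in> N \<Longrightarrow> y \<in> N \<Longrightarrow> f (x + y) = f x + f y"
  shows "\<exists>u\<in>dual_lattice N. \<forall>x\<in>N. u x = of_int (f x)"
proof -
  obtain B where B: "finite B" "independent B"
    and N: "N = {\<Sum>b\<in>B. of_int (c b) *\<^sub>R b | c :: 'a \<Rightarrow> int. True}"
    using assms(1) unfolding is_lattice_def by blast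
  obtain u :: "'a \<Rightarrow> real" where u: "linear u" "\<And>b. b \<in> B \<Longrightarrow> u b = of_int (f b)"
    using linear_independent_extend[OF B(2), of "\<lambda>b. of_int (f b)"] by blast
  have inN: "(\<Sum>b\<in>B. of_int (c b) *\<^sub>R b) \<in> N" for c :: "'a \<Rightarrow> int"
    using N by blast
  have N0: "0 \<in> N" using inN[of "\<lambda>_. 0"] by simp
  have NB: "b \<in> N" if "b \<in> B" for b
  proof -
    have "(\<Sum>x\<in>B. of_int (if x = b then 1 else 0) *\<^sub>R x) = (\<Sum>x\<in>B. if x = b then b else 0)"
      by (rule sum.cong) auto
    also have "\<dots> = b" using that B(1) by simp
    finally show ?thesis using inN[of "\<lambda>x. if x = b then 1 else 0"] by simp
  qed
  have Nadd: "x + y \<in> N" if xy: "x \<in> N" "y \<in> N" for x y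
  proof -
    obtain c d :: "'a \<Rightarrow> int" where "x = (\<Sum>b\<in>B. of_int (c b) *\<^sub>R b)"
      "y = (\<Sum>b\<in>B. of_int (d b) *\<^sub>R b)" using xy N by blast
    then have "x + y = (\<Sum>b\<in>B. of_int (c b + d b) *\<^sub>R b)"
      by (simp add: sum.distrib scaleR_add_left)
    then show ?thesis using inN[of "\<lambda>b. c b + d b"] by simp
  qed
  have Nscale: "of_int k *\<^sub>R x \<in> N" if xN: "x \<in> N" for x k
  proof -
    obtain c :: "'a \<Rightarrow> int" where "x = (\<Sum>b\<in>B. of_int (c b) *\<^sub>R b)" using xN N by blast
    then have "of_int k *\<^sub>R x = (\<Sum>b\<in>B. of_int (k * c b) *\<^sub>R b)"
      by (simp add: scaleR_sum_right)
    then show ?thesis using inN[of "\<lambda>b. k * c b"] by simp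
  qed
  have f0: "f 0 = 0" using add[OF N0 N0] by simp
  have fnat: "f (of_nat n *\<^sub>R x) = of_nat n * f x" if "x \<in> N" for x n
  proof (induction n)
    case (Suc n)
    have "of_nat n *\<^sub>R x \<in> N" using Nscale[OF that, of "int n"] by simp
    then show ?case using add[OF that, of "of_nat n *\<^sub>R x"] Suc
      by (simp add: scaleR_add_left algebra_simps)
  qed (simp add: f0)
  have fint: "f (of_int k *\<^sub>R x) = k * f x" if "x \<in> N" for x k
  proof (cases "k \<ge> 0")
    case True
    then show ?thesis using fnat[OF that, of "nat k"] by simp
  next
    case False
    have "f (of_int k *\<^sub>R x + of_int (-k) *\<^sub>R x) = f (of_int k *\<^sub>R x) + f (of_int (-k) *\<^sub>R x)"
      by (rule add[OF Nscale[OF that] Nscale[OF that]])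
    then have "f (of_int k *\<^sub>R x) + f (of_int (-k) *\<^sub>R x) = 0"
      by (simp add: f0)
    moreover have "f (of_int (-k) *\<^sub>R x) = (-k) * f x"
      using fnat[OF that, of "nat (-k)"] False by simp
    ultimately show ?thesis by simp
  qed
  have fsum: "(\<Sum>b\<in>A. of_int (c b) *\<^sub>R b) \<in> N \<and>
      f (\<Sum>b\<in>A. of_int (c b) *\<^sub>R b) = (\<Sum>b\<in>A. c b * f b)" if "finite A" "A \<subseteq> B" for A c
    using that
  proof (induction A rule: finite_induct)
    case (insert a A)
    then have "a \<in> N" using NB by auto
    then show ?case using insert Nadd[OF Nscale] add[OF Nscale] fint by simp
  qed (simp add: f0 N0)
  have eq: "u x = of_int (f x)" if xN: "x \<in> N" for x
  proof -
    obtain c :: "'a \<Rightarrow> int" where x: "x = (\<Sum>b\<in>B. of_int (c b) *\<^sub>R b)" using xN N by blast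
    have "u x = (\<Sum>b\<in>B. of_int (c b) * of_int (f b))"
      unfolding x using u by (simp add: linear_sum linear_scale)
    also have "\<dots> = of_int (f x)"
      using fsum[OF B(1) order_refl, of c] unfolding x by simp
    finally show ?thesis .
  qed
  then have "u \<in> dual_lattice N" using u(1) by (auto simp: dual_lattice_def)
  then show ?thesis using eq by blast
qed

lemma dual_lattice_eq_on_span:
  assumes "u \<in> dual_lattice N" "v \<in> dual_lattice N" "\<And>x. x \<in> N \<Longrightarrow> u x = v x" "w \<in> span N"
  shows "u w = v w"
  using assms linear_eq_on[of u v w N] by (auto simp: dual_lattice_def)

definition strongly_convex :: "'b::real_vector set \<Rightarrow> bool" where
  "strongly_convex \<sigma> \<longleftrightarrow> convex_cone \<sigma> \<and> \<not> (\<exists>x v. v \<noteq> 0 \<and> (\<forall>c. x + c *\<^sub>R v \<in> \<sigma>))"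

text \<open>
  The empty set satisfies \<^const>\<open>face_of\<close> but is not counted as a face here; otherwise no
  nonempty complex could consist of cones.
\<close>

definition polyhedral_complex :: "'b::euclidean_space set set \<Rightarrow> bool" where
  "polyhedral_complex K \<longleftrightarrow>
     finite K \<and>
     (\<forall>P\<in>K. polyhedron P) \<and>
     (\<forall>P\<in>K. \<forall>F. F face_of P \<and> F \<noteq> {} \<longrightarrow> F \<in> K) \<and>
     (\<forall>P\<in>K. \<forall>Q\<in>K. P \<inter> Q = {} \<or> (P \<inter> Q face_of P \<and> P \<inter> Q face_of Q))"

definition fan :: "'b::euclidean_space set set \<Rightarrow> bool" where
  "fan \<Sigma> \<longleftrightarrow> \<Sigma> \<noteq> {} \<and> polyhedral_complex \<Sigma> \<and> (\<forall>\<sigma>\<in>\<Sigma>. strongly_convex \<sigma>)"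

definition half_space :: "'a::euclidean_space set \<Rightarrow> ('a \<times> real) set" where
  "half_space N = span N \<times> {0..}"

definition fan_in_half_space :: "'a::euclidean_space set \<Rightarrow> ('a \<times> real) set set \<Rightarrow> bool" where
  "fan_in_half_space N \<Sigma> \<longleftrightarrow> fan \<Sigma> \<and> (\<forall>\<sigma>\<in>\<Sigma>. \<sigma> \<subseteq> half_space N)"

definition complete_fan :: "'a::euclidean_space set \<Rightarrow> ('a \<times> real) set set \<Rightarrow> bool" where
  "complete_fan N \<Sigma> \<longleftrightarrow> fan_in_half_space N \<Sigma> \<and> \<Union>\<Sigma> = half_space N"

definition admissible_cone ::
    "real set \<Rightarrow> 'a::euclidean_space set \<Rightarrow> ('a \<times> real) set \<Rightarrow> bool" where
  "admissible_cone \<Gamma> N \<sigma> \<longleftrightarrow>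
     strongly_convex \<sigma> \<and>
     (\<exists>(l::nat) u \<gamma>.
        (\<forall>i\<in>{1..l}. u i \<in> dual_lattice N \<and> \<gamma> i \<in> \<Gamma>) \<and>
        \<sigma> = {(w, t). (w, t) \<in> half_space N \<and> (\<forall>i\<in>{1..l}. u i w + \<gamma> i * t \<ge> 0)})"

definition admissible_fan ::
    "real set \<Rightarrow> 'a::euclidean_space set \<Rightarrow> ('a \<times> real) set set \<Rightarrow> bool" where
  "admissible_fan \<Gamma> N \<Sigma> \<longleftrightarrow> fan_in_half_space N \<Sigma> \<and> (\<forall>\<sigma>\<in>\<Sigma>. admissible_cone \<Gamma> N \<sigma>)"

definition subfan :: "'b::euclidean_space set set \<Rightarrow> 'b set set \<Rightarrow> bool" where
  "subfan \<Sigma> \<Sigma>' \<longleftrightarrow> fan \<Sigma> \<and> fan \<Sigma>' \<and> \<Sigma> \<subseteq> \<Sigma>'"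

definition real_add_subgroup :: "real set \<Rightarrow> bool" where
  "real_add_subgroup \<Gamma> \<longleftrightarrow> 0 \<in> \<Gamma> \<and> (\<forall>a\<in>\<Gamma>. \<forall>b\<in>\<Gamma>. a + b \<in> \<Gamma>) \<and> (\<forall>a\<in>\<Gamma>. - a \<in> \<Gamma>)"

end

theory Submission
  imports Defs
begin

text \<open>
  Fix an additive group \<open>W\<close> of functionals and consider fans whose cones are cut out by finitely
  many members of \<open>W\<close>; a common lineality space is allowed.  Such cones are not closed under
  Minkowski sums, so nothing can be built from generators (star subdivisions, joins).  All
  constructions instead use functions which on every cone of a fan are a minimum of finitely many
  members of \<open>W\<close>.  There are many of them: a subfan is always the zero set of a nonnegative one,
  extended one cone at a time by adding large multiples of functionals exposing the faces.  Cutting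
  along the linearity domains of such a function refines a fan without touching the cones on which
  it is linear.

  By induction on the codimension of the lineality space, the star of a nonminimal cone \<open>\<rho>\<close> of
  \<open>\<Sigma>\<close> can be completed.  Intersecting that completion with \<open>\<theta> \<ge> 0\<close>, where \<open>\<theta>\<close> is conewise concave
  and drops steeply away from the star, leaves narrow cones that can be added to \<open>\<Sigma>\<close> and cover a
  neighbourhood of the relative interior of \<open>\<rho>\<close>.  Doing this for all \<open>\<rho>\<close> gives a fan \<open>N\<close>
  containing \<open>\<Sigma>\<close> and covering a neighbourhood of it, up to the lineality space.  Finally \<open>N\<close> is
  restricted to a thin neighbourhood \<open>\<theta> \<ge> 0\<close> of \<open>\<Sigma>\<close> and glued to a hyperplane arrangement outside;
  the two agree on \<open>\<theta> = 0\<close> because \<open>N\<close> is refined by the functions \<open>min 0 (m \<theta> - a)\<close> for the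
  functionals \<open>a\<close> of the arrangement, which vanish on \<open>\<Sigma>\<close> when \<open>m\<close> is large.
\<close>

section \<open>Cones cut out by finitely many functionals\<close>

text \<open>Sums already fail for \<open>\<Gamma>\<close> = Z + sqrt(2) Z and the lattice Z^2: the
  rays over (0, 0) and (1, sqrt(2)) at height 1 are admissible, but the cone they span is not, since
  no nonzero integral functional is constant on the joining segment. \<open>W\<close> is only a
  group, so a multiplier has to be a natural number. All large constants come from one estimate: if
  g is nonnegative wherever a nonnegative h vanishes on a polyhedral cone, both piecewise linear,
  then g + k h \<ge> 0 for all large k. Finitely many such demands are met by a single k. Lineality
  spaces are allowed because localisation creates them: every tangent cone at v contains the line
  through v, and this is what lowers the codimension in the induction. The half-space enters only at
  the end. It is itself cut out by functionals of \<open>W\<close>, so a completion of the whole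
  space can be cut down to it.\<close>

definition hcone :: "'b::euclidean_space set \<Rightarrow> 'b set" where
  "hcone A = {x. \<forall>a\<in>A. 0 \<le> a \<bullet> x}"

definition wcone :: "'b::euclidean_space set \<Rightarrow> 'b set \<Rightarrow> bool" where
  "wcone W \<kappa> \<longleftrightarrow> (\<exists>A. finite A \<and> A \<subseteq> W \<and> \<kappa> = hcone A)"

text \<open>
  Unlike in \<^const>\<open>fan\<close>, cones may contain lines; the cones of a complex then all have the same
  lineality space.
\<close>

definition wfan :: "'b::euclidean_space set \<Rightarrow> 'b set set \<Rightarrow> bool" where
  "wfan W K \<longleftrightarrow> K \<noteq> {} \<and> (\<forall>\<kappa>\<in>K. wcone W \<kappa>) \<and> polyhedral_complex K"

lemma hcone_Un: "hcone (A \<union> B) = hcone A \<inter> hcone B"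
  by (auto simp: hcone_def)

lemma convex_cone_hcone: "convex_cone (hcone A)"
  by (auto simp: convex_cone_iff hcone_def inner_simps)

lemma convex_hcone: "convex (hcone A)"
  using convex_cone_hcone by (auto simp: convex_cone_def)

lemma hcone_Inter: "hcone A = (\<Inter>a\<in>A. {x. a \<bullet> x \<ge> 0})"
  by (auto simp: hcone_def)

lemma polyhedron_hcone: "finite A \<Longrightarrow> polyhedron (hcone A)"
  unfolding hcone_Inter by (rule polyhedron_Inter) (auto simp: polyhedron_halfspace_ge)

lemma wcone_convex_cone: "wcone W \<kappa> \<Longrightarrow> convex_cone \<kappa>"
  by (auto simp: wcone_def convex_cone_hcone)

lemma wcone_polyhedron: "wcone W \<kappa> \<Longrightarrow> polyhedron \<kappa>"
  by (auto simp: wcone_def polyhedron_hcone)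

lemma wcone_convex: "wcone W \<kappa> \<Longrightarrow> convex \<kappa>"
  and wcone_closed: "wcone W \<kappa> \<Longrightarrow> closed \<kappa>"
  and wcone_0: "wcone W \<kappa> \<Longrightarrow> 0 \<in> \<kappa>"
  by (auto dest: wcone_polyhedron wcone_convex_cone simp: polyhedron_imp_closed polyhedron_imp_convex
      convex_cone_contains_0)

lemma wcone_Int: "wcone W \<kappa> \<Longrightarrow> wcone W \<kappa>' \<Longrightarrow> wcone W (\<kappa> \<inter> \<kappa>')"
  unfolding wcone_def by (metis hcone_Un finite_Un Un_subset_iff)

lemma wcone_restrict: "wcone W \<kappa> \<Longrightarrow> finite B \<Longrightarrow> B \<subseteq> W \<Longrightarrow> wcone W (\<kappa> \<inter> hcone B)"
  by (rule wcone_Int) (auto simp: wcone_def)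

lemma wcone_scaleR: "wcone W \<kappa> \<Longrightarrow> x \<in> \<kappa> \<Longrightarrow> 0 \<le> c \<Longrightarrow> c *\<^sub>R x \<in> \<kappa>"
  by (meson convex_cone_scaleR wcone_convex_cone)

lemma wcone_add: "wcone W \<kappa> \<Longrightarrow> x \<in> \<kappa> \<Longrightarrow> y \<in> \<kappa> \<Longrightarrow> x + y \<in> \<kappa>"
  by (meson convex_cone_add wcone_convex_cone)

section \<open>Relative interiors and faces of cones\<close>

lemma rel_interior_prolong:
  fixes S :: "'b::euclidean_space set"
  assumes "convex S" "x \<in> rel_interior S" "y \<in> S"
  obtains e where "e > 0" "x - e *\<^sub>R (y - x) \<in> S"
proof -
  have "S \<noteq> {}" using assms by auto
  then obtain e where e: "e > 1" "(1 - e) *\<^sub>R y + e *\<^sub>R x \<in> S"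
    using convex_rel_interior_iff[OF assms(1), of x] assms(2,3) by auto
  show ?thesis
    by (rule that[of "e - 1"]) (use e in \<open>auto simp: algebra_simps\<close>)
qed

text \<open>The segment from \<open>y\<close> to \<open>x\<close> can be prolonged beyond
  \<open>x\<close> inside \<open>S\<close>; a functional nonnegative at both ends and zero in
  between vanishes. Applied to differences, it spreads equality at one relative interior point over
  \<open>S\<close> when one side dominates.\<close>

lemma linear_zero_on_rel_interior:
  fixes S :: "'b::euclidean_space set"
  assumes "convex S" "x \<in> rel_interior S" "\<And>y. y \<in> S \<Longrightarrow> 0 \<le> a \<bullet> y" "a \<bullet> x = 0" "y \<in> S"
  shows "a \<bullet> y = 0"
proof -
  obtain e where e: "e > 0" "x - e *\<^sub>R (y - x) \<in> S"
    using rel_interior_prolong assms(1,2,5) by blast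
  have "0 \<le> a \<bullet> (x - e *\<^sub>R (y - x))" using assms(3) e by blast
  then have "e * (a \<bullet> y) \<le> 0" using assms(4) by (simp add: inner_simps)
  then have "a \<bullet> y \<le> 0" using e(1) by (simp add: mult_le_0_iff)
  then show ?thesis using assms(3)[OF assms(5)] by simp
qed

lemma face_of_zeros:
  assumes "convex S" "\<And>x a. x \<in> S \<Longrightarrow> a \<in> A \<Longrightarrow> 0 \<le> a \<bullet> x"
  shows "{x \<in> S. \<forall>a\<in>A. a \<bullet> x = 0} face_of S"
proof (cases "A = {}")
  case True
  then show ?thesis using assms face_of_refl by auto
next
  case False
  have "(\<Inter>a\<in>A. S \<inter> {x. a \<bullet> x = 0}) face_of S"
    by (rule face_of_Inter) (use False assms in \<open>auto intro!: face_of_Int_supporting_hyperplane_ge\<close>)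
  moreover have "(\<Inter>a\<in>A. S \<inter> {x. a \<bullet> x = 0}) = {x \<in> S. \<forall>a\<in>A. a \<bullet> x = 0}"
    using False by auto
  ultimately show ?thesis by simp
qed

text \<open>The point c x is inside the segment from 0 to (c + 1) x, so the face contains both ends,
  and \<open>x\<close> lies between them too.\<close>

lemma face_of_cone_scaleR:
  assumes "convex_cone S" "F face_of S" "x \<in> S" "c > 0" "c *\<^sub>R x \<in> F"
  shows "x \<in> F"
proof (cases "x = 0 \<or> c = 1")
  case True
  then show ?thesis using assms by auto
next
  case False
  have "c *\<^sub>R x \<in> open_segment 0 ((c + 1) *\<^sub>R x)"
  proof -
    have "(c + 1) *\<^sub>R x \<noteq> 0" using False assms(4) by simp
    moreover have "c *\<^sub>R x = (1 - c / (c+1)) *\<^sub>R 0 + (c / (c + 1)) *\<^sub>R ((c + 1) *\<^sub>R x)"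
      using assms(4) by simp
    moreover have "0 < c / (c + 1)" "c / (c + 1) < 1" using assms(4) by auto
    ultimately show ?thesis unfolding in_segment by metis
  qed
  moreover have "0 \<in> S" "(c + 1) *\<^sub>R x \<in> S"
    using assms convex_cone_contains_0 convex_cone_scaleR[OF assms(1)] by auto
  ultimately have 0: "0 \<in> F" "(c + 1) *\<^sub>R x \<in> F" using face_ofD[OF assms(2)] assms(5) by blast+
  have "convex F" using assms(2) face_of_imp_convex by blast
  then have "(1 - 1 / (c+1)) *\<^sub>R 0 + (1 / (c+1)) *\<^sub>R ((c + 1) *\<^sub>R x) \<in> F"
    by (rule convexD_alt[OF _ 0]) (use assms(4) in \<open>auto simp: field_simps\<close>)
  then show ?thesis using assms(4) by simp
qed

lemma face_of_cone_convex_cone: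
  assumes "convex_cone S" "F face_of S" "F \<noteq> {}"
  shows "convex_cone F"
proof -
  have "c *\<^sub>R x \<in> F" if x: "x \<in> F" "c > 0" for x c
  proof -
    have "x \<in> S" using x assms(2) face_of_imp_subset by blast
    then have "c *\<^sub>R x \<in> S" using x(2) convex_cone_scaleR[OF assms(1)] by simp
    moreover have "(1/c) *\<^sub>R (c *\<^sub>R x) \<in> F" using x by simp
    ultimately show ?thesis using face_of_cone_scaleR[OF assms(1,2), of "c *\<^sub>R x" "1/c"] x by simp
  qed
  note sc = this
  obtain x where x: "x \<in> F" using assms by blast
  have "0 \<in> F"
  proof (cases "x = 0")
    case False
    have "x \<in> open_segment 0 (2 *\<^sub>R x)"
      using False unfolding in_segment by (auto intro!: exI[of _ "1/2"])
    moreover have "0 \<in> S" "2 *\<^sub>R x \<in> S"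
      using x assms convex_cone_contains_0 sc[OF x, of 2] face_of_imp_subset[OF assms(2)] by auto
    ultimately show ?thesis using face_ofD[OF assms(2)] x by blast
  qed (use x in simp)
  then have "conic F" using sc unfolding conic_def
    by (metis order.order_iff_strict scaleR_zero_left)
  then show ?thesis using assms face_of_imp_convex by (auto simp: convex_cone_def)
qed

text \<open>Half of \<open>x + y\<close> is the midpoint of \<open>x\<close> and \<open>y\<close>;
  the case \<open>x = y\<close> is separate because the open segment is then empty. Most face
  arguments below reduce to this property.\<close>

lemma face_of_cone_summand:
  assumes "convex_cone S" "F face_of S" "x \<in> S" "y \<in> S" "x + y \<in> F"
  shows "x \<in> F"
proof (cases "x = y")
  case True
  then have "2 *\<^sub>R x \<in> F" using assms by (simp add: scaleR_2)
  then show ?thesis by (intro face_of_cone_scaleR[OF assms(1,2,3), of 2]) auto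
next
  case False
  have "F \<noteq> {}" using assms by blast
  then have "(1/2) *\<^sub>R (x + y) \<in> F"
    using convex_cone_scaleR[OF face_of_cone_convex_cone[OF assms(1,2)]] assms(5) by simp
  moreover have "(1/2) *\<^sub>R (x + y) \<in> open_segment x y"
    using False unfolding in_segment
    by (intro conjI exI[of _ "1/2"]) (auto simp: scaleR_add_right)
  ultimately show ?thesis using face_ofD[OF assms(2)] assms(3,4) by blast
qed

text \<open>Inequalities strict at \<open>x\<close> survive a small step by continuity, tight ones
  by hypothesis, and there are finitely many.\<close>

lemma hcone_feasible_direction:
  assumes "finite A" "x \<in> hcone A" "\<And>a. a \<in> A \<Longrightarrow> a \<bullet> x = 0 \<Longrightarrow> 0 \<le> a \<bullet> d"
  shows "\<forall>\<^sub>F e in at_right 0. x + e *\<^sub>R d \<in> hcone A"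
proof -
  have "\<forall>\<^sub>F e in at_right 0. 0 \<le> a \<bullet> (x + e *\<^sub>R d)" if a: "a \<in> A" for a
  proof (cases "a \<bullet> x = 0")
    case True
    then show ?thesis using assms(3)[OF a] eventually_at_right_less[of "0::real"]
      by (auto simp: inner_simps elim!: eventually_mono)
  next
    case False
    then have "a \<bullet> x > 0" using a assms(2) by (force simp: hcone_def)
    moreover have "((\<lambda>e. a \<bullet> (x + e *\<^sub>R d)) \<longlongrightarrow> a \<bullet> (x + 0 *\<^sub>R d)) (at_right (0::real))"
      by (intro tendsto_intros)
    ultimately have "\<forall>\<^sub>F e in at_right (0::real). 0 < a \<bullet> (x + e *\<^sub>R d)"
      by (intro order_tendstoD(1)) auto
    then show ?thesis by (rule eventually_mono) simp
  qed
  then have "\<forall>\<^sub>F e in at_right 0. \<forall>a\<in>A. 0 \<le> a \<bullet> (x + e *\<^sub>R d)"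
    using assms(1) by (simp add: eventually_ball_finite)
  then show ?thesis by (simp add: hcone_def)
qed

lemma eventually_at_right_0_obtain:
  assumes "\<forall>\<^sub>F e in at_right (0::real). P e"
  obtains e where "e > 0" "P e"
proof -
  have "\<forall>\<^sub>F e in at_right (0::real). e > 0 \<and> P e"
    using assms eventually_at_right_less[of "0::real"] by eventually_elim auto
  then show ?thesis using that eventually_happens trivial_limit_at_right_real by blast
qed

text \<open>\<open>B\<close> collects the inequalities tight at a relative interior point
  \<open>x\<close> of \<open>F\<close>. Points of the face they cut out are, after scaling, summands
  of \<open>x\<close>, hence lie in \<open>F\<close>.\<close>

lemma hcone_face:
  assumes "finite A" "F face_of hcone A" "F \<noteq> {}"
  obtains B where "B \<subseteq> A" "F = {x \<in> hcone A. \<forall>a\<in>B. a \<bullet> x = 0}"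
proof -
  have cF: "convex F" and sub: "F \<subseteq> hcone A"
    using face_of_imp_convex[OF assms(2)] face_of_imp_subset[OF assms(2)] by auto
  obtain x where x: "x \<in> rel_interior F"
    using rel_interior_eq_empty[OF cF] assms(3) by auto
  then have xF: "x \<in> F" using rel_interior_subset by blast
  define B where "B = {a\<in>A. a \<bullet> x = 0}"
  let ?G = "{y \<in> hcone A. \<forall>a\<in>B. a \<bullet> y = 0}"
  have "F \<subseteq> ?G"
  proof
    fix y assume y: "y \<in> F"
    have "a \<bullet> y = 0" if "a \<in> B" for a
      by (rule linear_zero_on_rel_interior[OF cF x _ _ y])
        (use that sub in \<open>auto simp: B_def hcone_def\<close>)
    then show "y \<in> ?G" using y sub by auto
  qed
  moreover have "?G \<subseteq> F"
  proof
    fix y assume y: "y \<in> ?G"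
    have "\<forall>\<^sub>F e in at_right 0. x + e *\<^sub>R (- y) \<in> hcone A"
      by (rule hcone_feasible_direction[OF assms(1)]) (use y xF sub in \<open>auto simp: B_def\<close>)
    then obtain e where e: "e > 0" "x - e *\<^sub>R y \<in> hcone A"
      by (rule eventually_at_right_0_obtain) auto
    have "e *\<^sub>R y \<in> hcone A" using y e(1) by (auto intro: convex_cone_scaleR[OF convex_cone_hcone])
    then have "e *\<^sub>R y \<in> F"
      using face_of_cone_summand[OF convex_cone_hcone assms(2), of "e *\<^sub>R y" "x - e *\<^sub>R y"] e xF by simp
    then show "y \<in> F" using face_of_cone_scaleR[OF convex_cone_hcone assms(2)] y e by auto
  qed
  ultimately show ?thesis using that[of B] by (auto simp: B_def)
qed

text \<open>The inequalities tight at \<open>x\<close> vanish on the face they cut out and the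
  others are strict at \<open>x\<close>, so segments from points of this face to \<open>x\<close>
  can be prolonged.\<close>

lemma hcone_point_face:
  assumes "finite A" "x \<in> hcone A"
  obtains F where "F face_of hcone A" "x \<in> rel_interior F"
proof -
  let ?F = "{y \<in> hcone A. \<forall>a\<in>{a\<in>A. a \<bullet> x = 0}. a \<bullet> y = 0}"
  have F: "?F face_of hcone A"
    by (rule face_of_zeros[OF convex_hcone]) (auto simp: hcone_def)
  have "x \<in> rel_interior ?F"
  proof (subst convex_rel_interior_iff)
    show "convex ?F" using F face_of_imp_convex by blast
    show "?F \<noteq> {}" using assms by auto
    show "\<forall>z\<in>?F. \<exists>e>1. (1 - e) *\<^sub>R z + e *\<^sub>R x \<in> ?F"
    proof
      fix z assume z: "z \<in> ?F"
      have "\<forall>\<^sub>F e in at_right 0. x + e *\<^sub>R (x - z) \<in> hcone A"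
        by (rule hcone_feasible_direction[OF assms]) (use z in \<open>auto simp: inner_simps\<close>)
      then obtain e where e: "e > 0" "x + e *\<^sub>R (x - z) \<in> hcone A"
        by (rule eventually_at_right_0_obtain)
      then have "(1 - (1 + e)) *\<^sub>R z + (1 + e) *\<^sub>R x \<in> ?F"
        using z by (auto simp: algebra_simps inner_simps)
      then show "\<exists>e>1. (1 - e) *\<^sub>R z + e *\<^sub>R x \<in> ?F" using e(1) by (intro exI[of _ "1 + e"]) auto
    qed
  qed
  then show ?thesis using that F by blast
qed

section \<open>Fans of cones with functionals in a subgroup\<close>

locale functional_group =
  fixes W :: "'b::euclidean_space set"
  assumes zero_W: "0 \<in> W" and add_W: "a \<in> W \<Longrightarrow> b \<in> W \<Longrightarrow> a + b \<in> W"
    and uminus_W: "a \<in> W \<Longrightarrow> - a \<in> W"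
begin

lemma diff_W: "a \<in> W \<Longrightarrow> b \<in> W \<Longrightarrow> a - b \<in> W"
  using add_W[of a "- b"] uminus_W by simp

lemma sum_W: "(\<And>i. i \<in> I \<Longrightarrow> f i \<in> W) \<Longrightarrow> sum f I \<in> W"
  by (induction I rule: infinite_finite_induct) (auto simp: zero_W add_W)

lemma scale_W: "a \<in> W \<Longrightarrow> real n *\<^sub>R a \<in> W"
  by (induction n) (auto simp: zero_W add_W scaleR_add_left)

lemma wcone_zeros:
  assumes "wcone W \<kappa>" "finite B" "B \<subseteq> W"
  shows "wcone W {x \<in> \<kappa>. \<forall>a\<in>B. a \<bullet> x = 0}"
proof -
  have "{x \<in> \<kappa>. \<forall>a\<in>B. a \<bullet> x = 0} = \<kappa> \<inter> hcone (B \<union> uminus ` B)"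
    by (auto simp: hcone_def ball_Un intro!: antisym)
  then show ?thesis using wcone_restrict[OF assms(1), of "B \<union> uminus ` B"] assms uminus_W by auto
qed

text \<open>The sum of the inequalities that cut out \<open>F\<close> vanishes on the cone exactly
  where each of them does, and it stays in \<open>W\<close>.\<close>

lemma wcone_face_functional:
  assumes "wcone W \<kappa>" "F face_of \<kappa>" "F \<noteq> {}"
  obtains \<phi> where "\<phi> \<in> W" "\<And>x. x \<in> \<kappa> \<Longrightarrow> 0 \<le> \<phi> \<bullet> x" "F = {x \<in> \<kappa>. \<phi> \<bullet> x = 0}"
proof -
  obtain A where A: "finite A" "A \<subseteq> W" "\<kappa> = hcone A" using assms(1) by (auto simp: wcone_def)
  obtain B where B: "B \<subseteq> A" "F = {x \<in> hcone A. \<forall>a\<in>B. a \<bullet> x = 0}"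
    by (rule hcone_face[OF A(1), of F]) (use assms(2,3) A(3) in auto)
  have fB: "finite B" using A(1) B(1) finite_subset by blast
  have nn: "0 \<le> a \<bullet> x" if "a \<in> B" "x \<in> \<kappa>" for a x using that A(3) B(1) by (auto simp: hcone_def)
  show ?thesis
  proof (rule that[of "\<Sum>B"])
    show "\<Sum>B \<in> W" using A(2) B(1) by (intro sum_W) auto
    show "0 \<le> \<Sum>B \<bullet> x" if "x \<in> \<kappa>" for x using nn that by (auto simp: inner_sum_left intro!: sum_nonneg)
    show "F = {x \<in> \<kappa>. \<Sum>B \<bullet> x = 0}"
      unfolding B(2) A(3)[symmetric] using nn
      by (simp add: inner_sum_left sum_nonneg_eq_0_iff[OF fB] cong: conj_cong)
  qed
qed

lemma wcone_face:
  assumes "wcone W \<kappa>" "F face_of \<kappa>" "F \<noteq> {}"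
  shows "wcone W F"
proof -
  obtain \<phi> where "\<phi> \<in> W" "F = {x \<in> \<kappa>. \<phi> \<bullet> x = 0}" by (rule wcone_face_functional[OF assms])
  then show ?thesis using wcone_zeros[OF assms(1), of "{\<phi>}"] by auto
qed

end

lemma wcone_finite_faces: "wcone W \<kappa> \<Longrightarrow> finite {F. F face_of \<kappa>}"
  by (simp add: finite_polyhedron_faces wcone_polyhedron)

lemma wcone_point_face:
  assumes "wcone W \<kappa>" "x \<in> \<kappa>"
  obtains F where "F face_of \<kappa>" "x \<in> rel_interior F"
  using assms hcone_point_face unfolding wcone_def by metis

section \<open>Complexes of cones and their relative interiors\<close>

lemma wfanD:
  assumes "wfan W K"
  shows "finite K" "K \<noteq> {}" "\<kappa> \<in> K \<Longrightarrow> wcone W \<kappa>"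
    "\<kappa> \<in> K \<Longrightarrow> F face_of \<kappa> \<Longrightarrow> F \<noteq> {} \<Longrightarrow> F \<in> K"
    "\<kappa> \<in> K \<Longrightarrow> \<mu> \<in> K \<Longrightarrow> \<kappa> \<inter> \<mu> face_of \<kappa>"
    "\<kappa> \<in> K \<Longrightarrow> \<mu> \<in> K \<Longrightarrow> \<kappa> \<inter> \<mu> face_of \<mu>"
    "\<kappa> \<in> K \<Longrightarrow> \<mu> \<in> K \<Longrightarrow> \<kappa> \<inter> \<mu> \<in> K"
proof -
  show 0: "finite K" "K \<noteq> {}" and w: "\<And>\<kappa>. \<kappa> \<in> K \<Longrightarrow> wcone W \<kappa>"
    and f: "\<And>\<kappa> F. \<kappa> \<in> K \<Longrightarrow> F face_of \<kappa> \<Longrightarrow> F \<noteq> {} \<Longrightarrow> F \<in> K"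
    using assms by (auto simp: wfan_def polyhedral_complex_def)
  have ne: "\<kappa> \<inter> \<mu> \<noteq> {}" if "\<kappa> \<in> K" "\<mu> \<in> K" for \<kappa> \<mu> using wcone_0 w that by blast
  have "\<forall>P\<in>K. \<forall>Q\<in>K. P \<inter> Q = {} \<or> (P \<inter> Q face_of P \<and> P \<inter> Q face_of Q)"
    using assms by (simp add: wfan_def polyhedral_complex_def)
  then have i: "\<kappa> \<inter> \<mu> face_of \<kappa> \<and> \<kappa> \<inter> \<mu> face_of \<mu>" if "\<kappa> \<in> K" "\<mu> \<in> K" for \<kappa> \<mu>
    using ne that by blast
  then show "\<kappa> \<in> K \<Longrightarrow> \<mu> \<in> K \<Longrightarrow> \<kappa> \<inter> \<mu> face_of \<kappa>" "\<kappa> \<in> K \<Longrightarrow> \<mu> \<in> K \<Longrightarrow> \<kappa> \<inter> \<mu> face_of \<mu>"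
    by auto
  show "\<kappa> \<in> K \<Longrightarrow> \<mu> \<in> K \<Longrightarrow> \<kappa> \<inter> \<mu> \<in> K" using i ne f by meson
qed

text \<open>
  Disjoint relative interiors already force intersections to be common faces, as one sees at a
  relative interior point of the intersection.
\<close>

lemma wfanI:
  assumes "finite K" "K \<noteq> {}" "\<And>\<kappa>. \<kappa> \<in> K \<Longrightarrow> wcone W \<kappa>"
    and faces: "\<And>\<kappa> F. \<kappa> \<in> K \<Longrightarrow> F face_of \<kappa> \<Longrightarrow> F \<noteq> {} \<Longrightarrow> F \<in> K"
    and disj: "\<And>\<kappa> \<mu> x. \<kappa> \<in> K \<Longrightarrow> \<mu> \<in> K \<Longrightarrow> x \<in> rel_interior \<kappa> \<Longrightarrow> x \<in> rel_interior \<mu> \<Longrightarrow> \<kappa> = \<mu>"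
  shows "wfan W K"
proof -
  have "P \<inter> Q face_of P \<and> P \<inter> Q face_of Q" if PQ: "P \<in> K" "Q \<in> K" for P Q
  proof -
    have w: "wcone W P" "wcone W Q" using assms(3) PQ by auto
    then have "wcone W (P \<inter> Q)" by (rule wcone_Int)
    then obtain x where x: "x \<in> rel_interior (P \<inter> Q)"
      using rel_interior_eq_empty[OF wcone_convex] wcone_0 by blast
    then have "x \<in> P" "x \<in> Q" using rel_interior_subset by blast+
    then obtain F G where FG: "F face_of P" "x \<in> rel_interior F" "G face_of Q" "x \<in> rel_interior G"
      using wcone_point_face w by metis
    then have "F \<in> K" "G \<in> K" using faces PQ rel_interior_subset by blast+
    then have "F = G" using disj FG by blast
    moreover have "P \<inter> Q \<subseteq> F"
      using subset_of_face_of[OF FG(1), of "P \<inter> Q"] x FG(2) rel_interior_subset by blast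
    moreover have "F \<subseteq> P" "G \<subseteq> Q" using FG face_of_imp_subset by blast+
    ultimately have "P \<inter> Q = F" "P \<inter> Q = G" by auto
    then show ?thesis using FG by auto
  qed
  then show ?thesis
    using assms(1,2,3) faces wcone_polyhedron[OF assms(3)] by (simp add: wfan_def polyhedral_complex_def)
qed

lemma wfan_relint_ne: "wfan W K \<Longrightarrow> \<kappa> \<in> K \<Longrightarrow> \<exists>x. x \<in> rel_interior \<kappa>"
  using rel_interior_eq_empty[OF wcone_convex] wcone_0 wfanD(3) by blast

text \<open>The face \<open>\<kappa> \<inter> \<mu>\<close> of \<open>\<kappa>\<close> meets the
  relative interior of \<open>\<kappa>\<close>, hence is all of \<open>\<kappa>\<close>.\<close>

lemma wfan_face_of:
  assumes "wfan W K" "\<kappa> \<in> K" "\<mu> \<in> K" "x \<in> rel_interior \<kappa>" "x \<in> \<mu>"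
  shows "\<kappa> face_of \<mu>"
proof -
  have "x \<in> \<kappa> \<inter> \<mu>" using assms rel_interior_subset by blast
  then have "\<kappa> \<subseteq> \<kappa> \<inter> \<mu>"
    using subset_of_face_of[OF wfanD(5)[OF assms(1-3)] order_refl] assms(4) by blast
  then show ?thesis using wfanD(6)[OF assms(1-3)] by (simp add: Int_absorb2)
qed

lemma wfan_subset_face_of:
  assumes "wfan W K" "\<kappa> \<in> K" "\<mu> \<in> K" "\<kappa> \<subseteq> \<mu>"
  shows "\<kappa> face_of \<mu>"
  using wfanD(6)[OF assms(1-3)] assms(4) by (simp add: Int_absorb2)

lemma wfan_relint_unique:
  assumes "wfan W K" "\<kappa> \<in> K" "\<mu> \<in> K" "x \<in> rel_interior \<kappa>" "x \<in> rel_interior \<mu>"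
  shows "\<kappa> = \<mu>"
proof -
  have "x \<in> \<kappa>" "x \<in> \<mu>" using assms rel_interior_subset by blast+
  then have "\<kappa> face_of \<mu>" "\<mu> face_of \<kappa>" using wfan_face_of assms by blast+
  then show ?thesis using face_of_imp_subset by blast
qed

lemma wfan_point:
  assumes "wfan W K" "x \<in> \<Union>K"
  obtains \<kappa> where "\<kappa> \<in> K" "x \<in> rel_interior \<kappa>"
proof -
  obtain \<mu> where \<mu>: "\<mu> \<in> K" "x \<in> \<mu>" using assms(2) by blast
  obtain F where F: "F face_of \<mu>" "x \<in> rel_interior F"
    using wcone_point_face wfanD(3)[OF assms(1) \<mu>(1)] \<mu>(2) by metis
  then have "F \<in> K" using wfanD(4)[OF assms(1) \<mu>(1)] rel_interior_subset by blast
  then show ?thesis using that F by blast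
qed

section \<open>Farkas' lemma and penalty estimates\<close>

lemma Farkas:
  assumes "finite A" "\<And>x. x \<in> hcone A \<Longrightarrow> 0 \<le> l \<bullet> x"
  shows "l \<in> convex_cone hull A"
proof (rule ccontr)
  let ?C = "convex_cone hull A"
  assume "l \<notin> ?C"
  then obtain z b where zb: "z \<bullet> l < b" "\<And>x. x \<in> ?C \<Longrightarrow> b < z \<bullet> x"
    using separating_hyperplane_closed_point[OF convex_convex_cone_hull closed_convex_cone_hull[OF assms(1)]] by metis
  have "b < 0" using zb(2)[OF convex_cone_hull_contains_0] by simp
  have "0 \<le> a \<bullet> z" if "a \<in> A" for a
  proof (rule ccontr)
    assume neg: "\<not> 0 \<le> a \<bullet> z"
    \<comment> \<open>Both numbers are negative, so the factor is nonnegative; it is chosen to give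
      \<open>z\<close> exactly the value \<open>b\<close>, against strict separation.\<close>
    have "(b / (a \<bullet> z)) *\<^sub>R a \<in> ?C"
      using neg \<open>b < 0\<close> that by (intro convex_cone_hull_mul hull_inc) (auto simp: divide_nonpos_nonpos)
    from zb(2)[OF this] neg show False by (simp add: inner_commute)
  qed
  then have "z \<in> hcone A" by (simp add: hcone_def)
  then show False using assms(2) zb(1) \<open>b < 0\<close> by (force simp: inner_commute)
qed

text \<open>Adding \<open>- \<phi>\<close> to the inequalities forces \<open>\<phi>\<close> to
  vanish, so \<open>l\<close> is nonnegative there, and Farkas writes \<open>l\<close> as v - c
  \<phi> with v nonnegative on the cone; every k \<ge> c works. The eventual form lets one natural
  number serve finitely many instances.\<close>

lemma linear_penalty:
  assumes "finite A" "\<And>x. x \<in> hcone A \<Longrightarrow> 0 \<le> \<phi> \<bullet> x"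
    and "\<And>x. x \<in> hcone A \<Longrightarrow> \<phi> \<bullet> x = 0 \<Longrightarrow> 0 \<le> l \<bullet> x"
  shows "\<forall>\<^sub>F k in sequentially. \<forall>x\<in>hcone A. 0 \<le> l \<bullet> x + real k * (\<phi> \<bullet> x)"
proof -
  have "l \<in> convex_cone hull (insert (- \<phi>) A)"
    by (rule Farkas) (use assms in \<open>force simp: hcone_def\<close>)+
  then have "l \<in> convex_cone hull {- \<phi>} + convex_cone hull A"
    using convex_cone_hull_Un[of "{- \<phi>}" A] by (auto simp: set_plus_def)
  then obtain u v where uv: "l = u + v" "u \<in> convex_cone hull {- \<phi>}" "v \<in> convex_cone hull A"
    by (auto simp: set_plus_def)
  have "convex_cone {c *\<^sub>R (- \<phi>) | c. c \<ge> 0}"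
    unfolding convex_cone_iff
  proof (intro conjI ballI allI impI)
    show "0 \<in> {c *\<^sub>R (- \<phi>) | c. c \<ge> 0}" by force
  next
    fix x y assume "x \<in> {c *\<^sub>R (- \<phi>) | c. c \<ge> 0}" "y \<in> {c *\<^sub>R (- \<phi>) | c. c \<ge> 0}"
    then obtain c d where "c \<ge> 0" "d \<ge> 0" "x = c *\<^sub>R (- \<phi>)" "y = d *\<^sub>R (- \<phi>)" by blast
    then show "x + y \<in> {c *\<^sub>R (- \<phi>) | c. c \<ge> 0}" 
      by (intro CollectI exI[of _ "c + d"]) (auto simp: scaleR_add_left)
  next
    fix x and d::real assume "x \<in> {c *\<^sub>R (- \<phi>) | c. c \<ge> 0}" "0 \<le> d"
    then obtain c where "c \<ge> 0" "x = c *\<^sub>R (- \<phi>)" by blast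
    then show "d *\<^sub>R x \<in> {c *\<^sub>R (- \<phi>) | c. c \<ge> 0}"
      using \<open>0 \<le> d\<close> by (intro CollectI exI[of _ "d * c"]) auto
  qed
  moreover have "- \<phi> \<in> {c *\<^sub>R (- \<phi>) | c. c \<ge> 0}" by (intro CollectI exI[of _ 1]) auto
  ultimately have "convex_cone hull {- \<phi>} \<subseteq> {c *\<^sub>R (- \<phi>) | c. c \<ge> 0}"
    by (intro hull_minimal) auto
  then obtain c where c: "c \<ge> 0" "u = c *\<^sub>R (- \<phi>)" using uv(2) by blast
  have v: "0 \<le> v \<bullet> x" if x: "x \<in> hcone A" for x
  proof -
    have "convex_cone hull A \<subseteq> {y. x \<bullet> y \<ge> 0}"
      using x by (intro hull_minimal convex_cone_halfspace_ge) (auto simp: hcone_def inner_commute)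
    then show ?thesis using uv(3) by (auto simp: inner_commute)
  qed
  have "0 \<le> l \<bullet> x + real k * (\<phi> \<bullet> x)" if "c \<le> real k" "x \<in> hcone A" for k x
  proof -
    have "l \<bullet> x + real k * (\<phi> \<bullet> x) = v \<bullet> x + (real k - c) * (\<phi> \<bullet> x)"
      unfolding uv(1) c(2) by (simp add: inner_simps algebra_simps)
    then show ?thesis using v[OF that(2)] assms(2)[OF that(2)] that(1) by simp
  qed
  moreover have "\<forall>\<^sub>F k in sequentially. c \<le> real k"
    using filterlim_real_sequentially by (auto simp: filterlim_at_top)
  ultimately show ?thesis by (auto elim!: eventually_mono)
qed

text \<open>A piece pairs a set of inequalities with a functional, all over the reals rather than
  over \<open>W\<close>: the notion feeds estimates and continuity only. Unlike minima of
  functionals it is stable under negation, as the penalties for \<open>- \<xi> x\<close> and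
  \<open>- \<eta> x\<close> below require.\<close>

definition piecewise_linear_on :: "'b::euclidean_space set \<Rightarrow> ('b \<Rightarrow> real) \<Rightarrow> bool" where
  "piecewise_linear_on c h \<longleftrightarrow> (\<exists>P. finite P \<and>
     (\<forall>p\<in>P. finite (fst p) \<and> (\<forall>x\<in>hcone (fst p). h x = snd p \<bullet> x)) \<and> c \<subseteq> (\<Union>p\<in>P. hcone (fst p)))"

lemma piecewise_linear_on_subset:
  "piecewise_linear_on c h \<Longrightarrow> d \<subseteq> c \<Longrightarrow> piecewise_linear_on d h"
  unfolding piecewise_linear_on_def by (meson order_trans)

lemma piecewise_linear_on_linear: "piecewise_linear_on c (\<lambda>x. a \<bullet> x)"
  unfolding piecewise_linear_on_def by (rule exI[of _ "{({}, a)}"]) (auto simp: hcone_def)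

lemma piecewise_linear_on_uminus:
  assumes "piecewise_linear_on c h"
  shows "piecewise_linear_on c (\<lambda>x. - h x)"
proof -
  obtain P where "finite P" "\<forall>p\<in>P. finite (fst p) \<and> (\<forall>x\<in>hcone (fst p). h x = snd p \<bullet> x)"
    "c \<subseteq> (\<Union>p\<in>P. hcone (fst p))"
    using assms unfolding piecewise_linear_on_def by blast
  then show ?thesis unfolding piecewise_linear_on_def
    by (intro exI[of _ "(\<lambda>p. (fst p, - snd p)) ` P"]) simp
qed

text \<open>Where a piece of \<open>g\<close> meets a piece of \<open>h\<close>, both are linear and
  \<open>linear_penalty\<close> applies; there are finitely many such pairs.\<close>

lemma piecewise_linear_penalty:
  assumes g: "piecewise_linear_on (hcone C) g" and h: "piecewise_linear_on (hcone C) h" and "finite C"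
    and nn: "\<And>x. x \<in> hcone C \<Longrightarrow> 0 \<le> h x" and z: "\<And>x. x \<in> hcone C \<Longrightarrow> h x = 0 \<Longrightarrow> 0 \<le> g x"
  shows "\<forall>\<^sub>F k in sequentially. \<forall>x\<in>hcone C. 0 \<le> g x + real k * h x"
proof -
  obtain P where P: "finite P" "\<And>p. p \<in> P \<Longrightarrow> finite (fst p)"
    "\<And>p x. p \<in> P \<Longrightarrow> x \<in> hcone (fst p) \<Longrightarrow> g x = snd p \<bullet> x" "hcone C \<subseteq> (\<Union>p\<in>P. hcone (fst p))"
    using g unfolding piecewise_linear_on_def by blast
  obtain Q where Q: "finite Q" "\<And>p. p \<in> Q \<Longrightarrow> finite (fst p)"
    "\<And>p x. p \<in> Q \<Longrightarrow> x \<in> hcone (fst p) \<Longrightarrow> h x = snd p \<bullet> x" "hcone C \<subseteq> (\<Union>p\<in>Q. hcone (fst p))"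
    using h unfolding piecewise_linear_on_def by blast
  have "\<forall>\<^sub>F k in sequentially. \<forall>x\<in>hcone (C \<union> fst p \<union> fst q). 0 \<le> snd p \<bullet> x + real k * (snd q \<bullet> x)"
    if p: "p \<in> P" and q: "q \<in> Q" for p q
  proof (rule linear_penalty)
    note * = P(2)[OF p] Q(2)[OF q] P(3)[OF p] Q(3)[OF q]
    show "finite (C \<union> fst p \<union> fst q)" using * assms(3) by auto
    show "0 \<le> snd q \<bullet> x" if "x \<in> hcone (C \<union> fst p \<union> fst q)" for x
      using that * nn[of x] by (auto simp: hcone_Un)
    show "0 \<le> snd p \<bullet> x" if "x \<in> hcone (C \<union> fst p \<union> fst q)" "snd q \<bullet> x = 0" for x
      using that * z[of x] by (auto simp: hcone_Un)
  qed
  then have "\<forall>\<^sub>F k in sequentially. \<forall>p\<in>P. \<forall>q\<in>Q. \<forall>x\<in>hcone (C \<union> fst p \<union> fst q).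
      0 \<le> snd p \<bullet> x + real k * (snd q \<bullet> x)"
    using P(1) Q(1) by (simp add: eventually_ball_finite)
  then show ?thesis
  proof eventually_elim
    case (elim k)
    show ?case
    proof
      fix x assume x: "x \<in> hcone C"
      then obtain p q where *: "p \<in> P" "x \<in> hcone (fst p)" "q \<in> Q" "x \<in> hcone (fst q)"
        using P(4) Q(4) by blast
      then have "x \<in> hcone (C \<union> fst p \<union> fst q)" using x by (simp add: hcone_Un)
      then have "0 \<le> snd p \<bullet> x + real k * (snd q \<bullet> x)" using elim * by blast
      then show "0 \<le> g x + real k * h x" using P(3) Q(3) * by simp
    qed
  qed
qed

section \<open>Conewise concave functions\<close>

text \<open>Minima rather than maxima, because the set where a minimum is nonnegative, or is
  attained by a given member, is again a cone over \<open>W\<close>. Domination and attainment are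
  demanded on \<open>c\<close> only, which leaves the values elsewhere free.\<close>

definition min_functional :: "'b::euclidean_space set \<Rightarrow> 'b set \<Rightarrow> ('b \<Rightarrow> real) \<Rightarrow> bool" where
  "min_functional W c h \<longleftrightarrow> (\<exists>L. finite L \<and> L \<subseteq> W \<and>
     (\<forall>x\<in>c. (\<forall>a\<in>L. h x \<le> a \<bullet> x) \<and> (\<exists>a\<in>L. h x = a \<bullet> x)))"

definition conewise_concave :: "'b::euclidean_space set \<Rightarrow> 'b set set \<Rightarrow> ('b \<Rightarrow> real) \<Rightarrow> bool" where
  "conewise_concave W K h \<longleftrightarrow> (\<forall>\<kappa>\<in>K. min_functional W \<kappa> h)"

definition conewise_linear :: "'b::euclidean_space set \<Rightarrow> 'b set set \<Rightarrow> ('b \<Rightarrow> real) \<Rightarrow> bool" where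
  "conewise_linear W K h \<longleftrightarrow> (\<forall>\<kappa>\<in>K. \<exists>a\<in>W. \<forall>x\<in>\<kappa>. h x = a \<bullet> x)"

lemma min_functionalE:
  assumes "min_functional W c h"
  obtains L where "finite L" "L \<subseteq> W" "\<And>x a. x \<in> c \<Longrightarrow> a \<in> L \<Longrightarrow> h x \<le> a \<bullet> x"
    "\<And>x. x \<in> c \<Longrightarrow> \<exists>a\<in>L. h x = a \<bullet> x"
  using assms unfolding min_functional_def by blast

lemma min_functional_subset: "min_functional W c h \<Longrightarrow> d \<subseteq> c \<Longrightarrow> min_functional W d h"
  unfolding min_functional_def by (meson subsetD)

lemma min_functional_cong:
  "min_functional W c h \<Longrightarrow> (\<And>x. x \<in> c \<Longrightarrow> g x = h x) \<Longrightarrow> min_functional W c g"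
  unfolding min_functional_def by simp

lemma conewise_concaveE:
  assumes "conewise_concave W K h"
  obtains L where "\<And>\<kappa>. \<kappa> \<in> K \<Longrightarrow> finite (L \<kappa>)" "\<And>\<kappa>. \<kappa> \<in> K \<Longrightarrow> L \<kappa> \<subseteq> W"
    "\<And>\<kappa> x a. \<kappa> \<in> K \<Longrightarrow> x \<in> \<kappa> \<Longrightarrow> a \<in> L \<kappa> \<Longrightarrow> h x \<le> a \<bullet> x"
    "\<And>\<kappa> x. \<kappa> \<in> K \<Longrightarrow> x \<in> \<kappa> \<Longrightarrow> \<exists>a\<in>L \<kappa>. h x = a \<bullet> x"
proof -
  have "\<forall>\<kappa>\<in>K. \<exists>L. finite L \<and> L \<subseteq> W \<and> (\<forall>x\<in>\<kappa>. (\<forall>a\<in>L. h x \<le> a \<bullet> x) \<and> (\<exists>a\<in>L. h x = a \<bullet> x))"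
    using assms by (simp add: conewise_concave_def min_functional_def)
  from bchoice[OF this] obtain L where L: "\<forall>\<kappa>\<in>K. finite (L \<kappa>) \<and> L \<kappa> \<subseteq> W \<and>
      (\<forall>x\<in>\<kappa>. (\<forall>a\<in>L \<kappa>. h x \<le> a \<bullet> x) \<and> (\<exists>a\<in>L \<kappa>. h x = a \<bullet> x))" ..
  show ?thesis by (rule that[of L]) (use L in blast)+
qed

lemma conewise_concave_refine:
  "conewise_concave W K h \<Longrightarrow> (\<And>\<kappa>'. \<kappa>' \<in> K' \<Longrightarrow> \<exists>\<kappa>\<in>K. \<kappa>' \<subseteq> \<kappa>) \<Longrightarrow> conewise_concave W K' h"
  unfolding conewise_concave_def by (meson min_functional_subset)

lemma conewise_linear_refine:
  "conewise_linear W K h \<Longrightarrow> (\<And>\<kappa>'. \<kappa>' \<in> K' \<Longrightarrow> \<exists>\<kappa>\<in>K. \<kappa>' \<subseteq> \<kappa>) \<Longrightarrow> conewise_linear W K' h"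
  unfolding conewise_linear_def by (meson subsetD)

lemma min_functional_linear: "a \<in> W \<Longrightarrow> min_functional W c (\<lambda>x. a \<bullet> x)"
  unfolding min_functional_def by (rule exI[of _ "{a}"]) auto

lemma min_functional_min:
  assumes "min_functional W c g" "min_functional W c h"
  shows "min_functional W c (\<lambda>x. min (g x) (h x))"
proof -
  obtain L where L: "finite L" "L \<subseteq> W" "\<And>x a. x \<in> c \<Longrightarrow> a \<in> L \<Longrightarrow> g x \<le> a \<bullet> x"
    "\<And>x. x \<in> c \<Longrightarrow> \<exists>a\<in>L. g x = a \<bullet> x" by (rule min_functionalE[OF assms(1)]) blast
  obtain M where M: "finite M" "M \<subseteq> W" "\<And>x a. x \<in> c \<Longrightarrow> a \<in> M \<Longrightarrow> h x \<le> a \<bullet> x"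
    "\<And>x. x \<in> c \<Longrightarrow> \<exists>a\<in>M. h x = a \<bullet> x" by (rule min_functionalE[OF assms(2)]) blast
  show ?thesis unfolding min_functional_def
  proof (intro exI[of _ "L \<union> M"] conjI ballI)
    fix x assume x: "x \<in> c"
    show "\<exists>a\<in>L \<union> M. min (g x) (h x) = a \<bullet> x"
      using L(4)[OF x] M(4)[OF x] by (cases "g x \<le> h x") (auto simp del: bex_simps simp: bex_Un)
    show "min (g x) (h x) \<le> a \<bullet> x" if "a \<in> L \<union> M" for a
      using that L(3)[OF x] M(3)[OF x] by (auto simp: min_le_iff_disj)
  qed (use L(1,2) M(1,2) in auto)
qed

context functional_group
begin

lemma min_functional_zero: "min_functional W c (\<lambda>x. 0)"
  using min_functional_linear[OF zero_W] by simp

lemma min_functional_add: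
  assumes "min_functional W c g" "min_functional W c h"
  shows "min_functional W c (\<lambda>x. g x + h x)"
proof -
  obtain L where L: "finite L" "L \<subseteq> W" "\<And>x a. x \<in> c \<Longrightarrow> a \<in> L \<Longrightarrow> g x \<le> a \<bullet> x"
    "\<And>x. x \<in> c \<Longrightarrow> \<exists>a\<in>L. g x = a \<bullet> x" by (rule min_functionalE[OF assms(1)]) blast
  obtain M where M: "finite M" "M \<subseteq> W" "\<And>x a. x \<in> c \<Longrightarrow> a \<in> M \<Longrightarrow> h x \<le> a \<bullet> x"
    "\<And>x. x \<in> c \<Longrightarrow> \<exists>a\<in>M. h x = a \<bullet> x" by (rule min_functionalE[OF assms(2)]) blast
  show ?thesis unfolding min_functional_def
  proof (intro exI[of _ "(\<lambda>(a, b). a + b) ` (L \<times> M)"] conjI ballI)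
    fix x assume x: "x \<in> c"
    obtain a b where "a \<in> L" "b \<in> M" "g x = a \<bullet> x" "h x = b \<bullet> x" using L(4)[OF x] M(4)[OF x] by blast
    then show "\<exists>a\<in>(\<lambda>(a, b). a + b) ` (L \<times> M). g x + h x = a \<bullet> x"
      by (intro bexI[of _ "a + b"]) (auto simp: inner_simps)
    show "g x + h x \<le> c \<bullet> x" if "c \<in> (\<lambda>(a, b). a + b) ` (L \<times> M)" for c
      using that L(3)[OF x] M(3)[OF x] by (force simp: inner_simps intro: add_mono)
  next
    show "(\<lambda>(a, b). a + b) ` (L \<times> M) \<subseteq> W" using L(2) M(2) add_W by auto
  qed (use L(1,2) M(1,2) in auto)
qed

lemma min_functional_scale:
  assumes "min_functional W c h"
  shows "min_functional W c (\<lambda>x. real k * h x)"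
proof (induction k)
  case (Suc k)
  then show ?case using min_functional_add[OF assms Suc] by (simp add: algebra_simps)
qed (simp add: min_functional_zero)

lemma conewise_concave_add:
  "conewise_concave W K g \<Longrightarrow> conewise_concave W K h \<Longrightarrow> conewise_concave W K (\<lambda>x. g x + h x)"
  by (simp add: conewise_concave_def min_functional_add)

lemma conewise_concave_scale:
  "conewise_concave W K h \<Longrightarrow> conewise_concave W K (\<lambda>x. real k * h x)"
  by (simp add: conewise_concave_def min_functional_scale)

lemma conewise_concave_min:
  "conewise_concave W K g \<Longrightarrow> conewise_concave W K h \<Longrightarrow> conewise_concave W K (\<lambda>x. min (g x) (h x))"
  by (simp add: conewise_concave_def min_functional_min)

lemma conewise_concave_linear: "a \<in> W \<Longrightarrow> conewise_concave W K (\<lambda>x. a \<bullet> x)"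
  by (simp add: conewise_concave_def min_functional_linear)

lemma conewise_concave_zero: "conewise_concave W K (\<lambda>x. 0)"
  by (simp add: conewise_concave_def min_functional_zero)

lemma conewise_linear_imp_concave: "conewise_linear W K h \<Longrightarrow> conewise_concave W K h"
  unfolding conewise_linear_def conewise_concave_def
  by (meson min_functional_cong min_functional_linear)

lemma conewise_linear_uminus: 
  assumes "conewise_linear W K h"
  shows "conewise_linear W K (\<lambda>x. - h x)"
  unfolding conewise_linear_def
proof
  fix \<kappa> assume "\<kappa> \<in> K"
  then obtain a where "a \<in> W" "\<forall>x\<in>\<kappa>. h x = a \<bullet> x" using assms unfolding conewise_linear_def by blast
  then show "\<exists>a\<in>W. \<forall>x\<in>\<kappa>. - h x = a \<bullet> x" using uminus_W by (intro bexI[of _ "- a"]) auto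
qed

text \<open>The minimum is attained by \<open>a\<close> exactly where all differences
  \<open>b - a\<close> are nonnegative, and these lie in \<open>W\<close>.\<close>

lemma wcone_linearity_piece:
  assumes "wcone W \<kappa>" "finite L" "L \<subseteq> W" "\<And>x b. x \<in> \<kappa> \<Longrightarrow> b \<in> L \<Longrightarrow> h x \<le> b \<bullet> x"
    "\<And>x. x \<in> \<kappa> \<Longrightarrow> \<exists>b\<in>L. h x = b \<bullet> x" "a \<in> L"
  shows "wcone W {x \<in> \<kappa>. h x = a \<bullet> x}"
proof -
  have "{x \<in> \<kappa>. h x = a \<bullet> x} = \<kappa> \<inter> hcone ((\<lambda>b. b - a) ` L)"
  proof (intro subset_antisym subsetI)
    fix x assume x: "x \<in> {x \<in> \<kappa>. h x = a \<bullet> x}"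
    then show "x \<in> \<kappa> \<inter> hcone ((\<lambda>b. b - a) ` L)" using assms(4)[of x] by (auto simp: hcone_def inner_simps)
  next
    fix x assume x: "x \<in> \<kappa> \<inter> hcone ((\<lambda>b. b - a) ` L)"
    then obtain b where b: "b \<in> L" "h x = b \<bullet> x" using assms(5) by blast
    then have "a \<bullet> x \<le> b \<bullet> x" using x by (auto simp: hcone_def inner_simps)
    moreover have "h x \<le> a \<bullet> x" using assms(4,6) x by blast
    ultimately show "x \<in> {x \<in> \<kappa>. h x = a \<bullet> x}" using x b by auto
  qed
  moreover have "(\<lambda>b. b - a) ` L \<subseteq> W" using assms(3,6) diff_W by blast
  ultimately show ?thesis using wcone_restrict[OF assms(1)] assms(2) by simp
qed

lemma conewise_concave_piecewise_linear:
  assumes "finite K" "\<And>\<kappa>. \<kappa> \<in> K \<Longrightarrow> wcone W \<kappa>" "conewise_concave W K h"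
  shows "piecewise_linear_on (\<Union>K) h"
proof -
  have "\<exists>P. finite P \<and> (\<forall>p\<in>P. finite (fst p) \<and> (\<forall>x\<in>hcone (fst p). h x = snd p \<bullet> x)) \<and>
      \<kappa> \<subseteq> (\<Union>p\<in>P. hcone (fst p))" if \<kappa>: "\<kappa> \<in> K" for \<kappa>
  proof -
    obtain L where L: "finite L" "L \<subseteq> W" "\<And>x a. x \<in> \<kappa> \<Longrightarrow> a \<in> L \<Longrightarrow> h x \<le> a \<bullet> x"
      "\<And>x. x \<in> \<kappa> \<Longrightarrow> \<exists>a\<in>L. h x = a \<bullet> x"
      using min_functionalE assms(3) \<kappa> unfolding conewise_concave_def by metis
    have "\<forall>a\<in>L. \<exists>A. finite A \<and> {x \<in> \<kappa>. h x = a \<bullet> x} = hcone A"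
      using wcone_linearity_piece[OF assms(2)[OF \<kappa>] L] unfolding wcone_def by meson
    then obtain A where A: "\<And>a. a \<in> L \<Longrightarrow> finite (A a)" "\<And>a. a \<in> L \<Longrightarrow> {x \<in> \<kappa>. h x = a \<bullet> x} = hcone (A a)"
      by metis
    show ?thesis
    proof (intro exI[of _ "(\<lambda>a. (A a, a)) ` L"] conjI ballI)
      show "\<kappa> \<subseteq> (\<Union>p\<in>(\<lambda>a. (A a, a)) ` L. hcone (fst p))" using L(4) A(2) by fastforce
      show "h x = snd p \<bullet> x" if "p \<in> (\<lambda>a. (A a, a)) ` L" "x \<in> hcone (fst p)" for p x
      proof -
        obtain a where a: "a \<in> L" "p = (A a, a)" using \<open>p \<in> _\<close> by blast
        then have "x \<in> {x \<in> \<kappa>. h x = a \<bullet> x}" using A(2) \<open>x \<in> _\<close> by simp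
        then show ?thesis using a by simp
      qed
    qed (use L A in auto)
  qed
  then obtain P where P: "\<And>\<kappa>. \<kappa> \<in> K \<Longrightarrow> finite (P \<kappa>)"
    "\<And>\<kappa> p. \<kappa> \<in> K \<Longrightarrow> p \<in> P \<kappa> \<Longrightarrow> finite (fst p) \<and> (\<forall>x\<in>hcone (fst p). h x = snd p \<bullet> x)"
    "\<And>\<kappa>. \<kappa> \<in> K \<Longrightarrow> \<kappa> \<subseteq> (\<Union>p\<in>P \<kappa>. hcone (fst p))"
    by metis
  then show ?thesis unfolding piecewise_linear_on_def using assms(1)
    by (intro exI[of _ "\<Union>\<kappa>\<in>K. P \<kappa>"] conjI) (auto, blast)
qed

lemma wfan_faces:
  assumes "finite C" "C \<noteq> {}" "\<And>c. c \<in> C \<Longrightarrow> wcone W c"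
    and "\<And>c d F G x. c \<in> C \<Longrightarrow> d \<in> C \<Longrightarrow> F face_of c \<Longrightarrow> G face_of d \<Longrightarrow>
      x \<in> rel_interior F \<Longrightarrow> x \<in> rel_interior G \<Longrightarrow> F = G"
  shows "wfan W {F. F \<noteq> {} \<and> (\<exists>c\<in>C. F face_of c)}" (is "wfan W ?K")
proof (rule wfanI)
  have "?K \<subseteq> (\<Union>c\<in>C. {F. F face_of c})" by blast
  moreover have "finite (\<Union>c\<in>C. {F. F face_of c})" using assms(1,3) wcone_finite_faces by auto
  ultimately show "finite ?K" using finite_subset by blast
  obtain c where c: "c \<in> C" using assms(2) by blast
  then have "c \<in> ?K" using assms(3) wcone_convex wcone_0 face_of_refl by blast
  then show "?K \<noteq> {}" by blast
  show "wcone W \<kappa>" if "\<kappa> \<in> ?K" for \<kappa> using that wcone_face assms(3) by blast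
  show "F \<in> ?K" if "\<kappa> \<in> ?K" "F face_of \<kappa>" "F \<noteq> {}" for \<kappa> F
    using that face_of_trans by blast
  show "\<kappa> = \<mu>" if "\<kappa> \<in> ?K" "\<mu> \<in> ?K" "x \<in> rel_interior \<kappa>" "x \<in> rel_interior \<mu>" for \<kappa> \<mu> x
    using that assms(4) by blast
qed

text \<open>The new cones are the faces of the cells on which one member of the minimum is attained.
  The last clause says that a convex set on which \<open>h\<close> is already linear is not split;
  this is how given cones survive.\<close>

lemma linearity_refinement:
  assumes K: "wfan W K" and h: "conewise_concave W K h"
  obtains K' where "wfan W K'" "\<Union>K' = \<Union>K" "\<And>\<kappa>'. \<kappa>' \<in> K' \<Longrightarrow> \<exists>\<kappa>\<in>K. \<kappa>' \<subseteq> \<kappa>"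
    "conewise_linear W K' h"
    "\<And>U \<kappa> l. convex U \<Longrightarrow> U \<noteq> {} \<Longrightarrow> \<kappa> \<in> K \<Longrightarrow> U \<subseteq> \<kappa> \<Longrightarrow> (\<And>x. x \<in> U \<Longrightarrow> h x = l \<bullet> x) \<Longrightarrow>
      \<exists>\<kappa>'\<in>K'. U \<subseteq> \<kappa>'"
proof -
  obtain L where L: "\<And>\<kappa>. \<kappa> \<in> K \<Longrightarrow> finite (L \<kappa>)" "\<And>\<kappa>. \<kappa> \<in> K \<Longrightarrow> L \<kappa> \<subseteq> W"
    "\<And>\<kappa> x a. \<kappa> \<in> K \<Longrightarrow> x \<in> \<kappa> \<Longrightarrow> a \<in> L \<kappa> \<Longrightarrow> h x \<le> a \<bullet> x"
    "\<And>\<kappa> x. \<kappa> \<in> K \<Longrightarrow> x \<in> \<kappa> \<Longrightarrow> \<exists>a\<in>L \<kappa>. h x = a \<bullet> x"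
    by (rule conewise_concaveE[OF h]) blast
  define cell where "cell \<kappa> a = {x \<in> \<kappa>. h x = a \<bullet> x}" for \<kappa> a
  define C where "C = (\<Union>\<kappa>\<in>K. cell \<kappa> ` L \<kappa>)"
  have wcell: "wcone W (cell \<kappa> a)" if "\<kappa> \<in> K" "a \<in> L \<kappa>" for \<kappa> a
    unfolding cell_def
    by (rule wcone_linearity_piece[OF wfanD(3)[OF K that(1)] L(1)[OF that(1)] L(2)[OF that(1)]
          L(3)[OF that(1)] L(4)[OF that(1)] that(2)])
  have fin: "finite C" unfolding C_def using L(1) wfanD(1)[OF K] by auto
  have ne: "C \<noteq> {}"
  proof -
    obtain \<kappa> where "\<kappa> \<in> K" using wfanD(2)[OF K] by blast
    moreover from this obtain a where "a \<in> L \<kappa>" using L(4)[of \<kappa> 0] wcone_0 wfanD(3)[OF K] by blast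
    ultimately show ?thesis by (auto simp: C_def)
  qed
  have w: "wcone W c" if "c \<in> C" for c using that wcell by (auto simp: C_def)
  have disj: "F = G" if FG: "c \<in> C" "d \<in> C" "F face_of c" "G face_of d" "x \<in> rel_interior F" "x \<in> rel_interior G"
    for c d F G x
  proof -
    obtain \<kappa> a where ca: "\<kappa> \<in> K" "a \<in> L \<kappa>" "c = cell \<kappa> a" using FG(1) by (auto simp: C_def)
    obtain \<mu> b where db: "\<mu> \<in> K" "b \<in> L \<mu>" "d = cell \<mu> b" using FG(2) by (auto simp: C_def)
    have xF: "x \<in> F" and xG: "x \<in> G" using FG rel_interior_subset by blast+
    have sF: "F \<subseteq> c" and sG: "G \<subseteq> d" using FG(3,4) face_of_imp_subset by blast+
    \<comment> \<open>The minima on \<open>\<kappa>\<close> and \<open>\<mu>\<close> use unrelated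
      functionals, so they are compared on the common face, which contains \<open>F\<close> and
      \<open>G\<close> because it meets their relative interiors in \<open>x\<close>.\<close>
    define \<gamma> where "\<gamma> = \<kappa> \<inter> \<mu>"
    have \<gamma>: "\<gamma> \<in> K" "\<gamma> face_of \<kappa>" "\<gamma> face_of \<mu>"
      unfolding \<gamma>_def using wfanD(5-7)[OF K ca(1) db(1)] by auto
    have x\<gamma>: "x \<in> \<gamma>" using xF xG sF sG ca db by (auto simp: \<gamma>_def cell_def)
    have F\<gamma>: "F \<subseteq> \<gamma>" using subset_of_face_of[OF \<gamma>(2), of F] sF ca(3) FG(5) x\<gamma> by (auto simp: cell_def)
    have G\<gamma>: "G \<subseteq> \<gamma>" using subset_of_face_of[OF \<gamma>(3), of G] sG db(3) FG(6) x\<gamma> by (auto simp: cell_def)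
    have le: "h y \<le> a \<bullet> y" "h y \<le> b \<bullet> y" if "y \<in> \<gamma>" for y
      using L(3)[OF ca(1) _ ca(2)] L(3)[OF db(1) _ db(2)] that by (auto simp: \<gamma>_def)
    have hF: "h y = a \<bullet> y" if "y \<in> F" for y using that sF ca by (auto simp: cell_def)
    have hG: "h y = b \<bullet> y" if "y \<in> G" for y using that sG db by (auto simp: cell_def)
    have cF: "convex F" and cG: "convex G" using FG face_of_imp_convex by blast+
    have F2: "b \<bullet> y = a \<bullet> y" if "y \<in> F" for y
    proof -
      have "(b - a) \<bullet> y = 0"
        by (rule linear_zero_on_rel_interior[OF cF FG(5) _ _ that])
          (use le F\<gamma> hF hG xF xG in \<open>force simp: inner_simps\<close>)+
      then show ?thesis by (simp add: inner_simps)
    qed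
    have G2: "b \<bullet> y = a \<bullet> y" if "y \<in> G" for y
    proof -
      have "(a - b) \<bullet> y = 0"
        by (rule linear_zero_on_rel_interior[OF cG FG(6) _ _ that])
          (use le G\<gamma> hF hG xF xG in \<open>force simp: inner_simps\<close>)+
      then show ?thesis by (simp add: inner_simps)
    qed
    \<comment> \<open>Both \<open>a\<close> and \<open>b\<close> attain the minimum on
      \<open>F\<close> and on \<open>G\<close>, so these are faces of one cone with a common
      relative interior point.\<close>
    let ?e = "cell \<gamma> a \<inter> cell \<gamma> b"
    have "F \<subseteq> ?e" "G \<subseteq> ?e" using F\<gamma> G\<gamma> hF hG F2 G2 by (auto simp: cell_def)
    moreover have "?e \<subseteq> c" "?e \<subseteq> d" using ca db by (auto simp: cell_def \<gamma>_def)
    ultimately have "F face_of ?e" "G face_of ?e" using FG(3,4) face_of_subset by blast+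
    then show "F = G" using face_of_eq FG(5,6) by blast
  qed
  let ?K = "{F. F \<noteq> {} \<and> (\<exists>c\<in>C. F face_of c)}"
  have CK: "C \<subseteq> ?K" using w wcone_convex wcone_0 face_of_refl by blast
  have sub: "\<exists>\<kappa>\<in>K. \<kappa>' \<subseteq> \<kappa>" if "\<kappa>' \<in> ?K" for \<kappa>'
    using that face_of_imp_subset by (fastforce simp: C_def cell_def)
  have cover: "\<exists>c\<in>C. U \<subseteq> c"
    if U: "convex U" "U \<noteq> {}" "\<kappa> \<in> K" "U \<subseteq> \<kappa>" "\<And>x. x \<in> U \<Longrightarrow> h x = l \<bullet> x" for U \<kappa> l
  proof -
    obtain x where x: "x \<in> rel_interior U" using rel_interior_eq_empty[OF U(1)] U(2) by blast
    then have xU: "x \<in> U" using rel_interior_subset by blast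
    obtain a where a: "a \<in> L \<kappa>" "h x = a \<bullet> x" using L(4) U(3,4) xU by blast
    have "h y = a \<bullet> y" if y: "y \<in> U" for y
    proof -
      have "(a - l) \<bullet> y = 0"
      proof (rule linear_zero_on_rel_interior[OF U(1) x _ _ y])
        show "0 \<le> (a - l) \<bullet> z" if "z \<in> U" for z
          using L(3)[OF U(3) _ a(1), of z] U(4,5) that by (auto simp: inner_simps)
        show "(a - l) \<bullet> x = 0" using U(5)[OF xU] a(2) by (simp add: inner_simps)
      qed
      then show ?thesis using U(5)[OF y] by (simp add: inner_simps)
    qed
    then have "U \<subseteq> cell \<kappa> a" using U(4) by (auto simp: cell_def)
    then show ?thesis using a U(3) by (auto simp: C_def)
  qed
  show ?thesis
  proof (rule that[of ?K])
    show "wfan W ?K" by (rule wfan_faces[OF fin ne w disj])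
    have "\<Union>K \<subseteq> \<Union>C" using L(4) by (fastforce simp: C_def cell_def)
    also have "\<Union>C \<subseteq> \<Union>?K" by (rule Union_mono[OF CK])
    finally have "\<Union>K \<subseteq> \<Union>?K" .
    moreover have "\<Union>?K \<subseteq> \<Union>K"
    proof (rule Union_least)
      fix X assume "X \<in> ?K"
      from sub[OF this] show "X \<subseteq> \<Union>K" by blast
    qed
    ultimately show "\<Union>?K = \<Union>K" by (rule subset_antisym[rotated])
    show "\<exists>\<kappa>\<in>K. \<kappa>' \<subseteq> \<kappa>" if "\<kappa>' \<in> ?K" for \<kappa>' by (rule sub[OF that])
    show "conewise_linear W ?K h"
      unfolding conewise_linear_def
    proof
      fix F assume "F \<in> ?K"
      then obtain \<kappa> a where *: "\<kappa> \<in> K" "a \<in> L \<kappa>" "F face_of cell \<kappa> a" by (auto simp: C_def)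
      then have "\<forall>x\<in>F. h x = a \<bullet> x" using face_of_imp_subset[OF *(3)] by (auto simp: cell_def)
      then show "\<exists>a\<in>W. \<forall>x\<in>F. h x = a \<bullet> x" using L(2) * by blast
    qed
    show "\<exists>\<kappa>'\<in>?K. U \<subseteq> \<kappa>'"
      if U: "convex U" "U \<noteq> {}" "\<kappa> \<in> K" "U \<subseteq> \<kappa>" "\<And>x. x \<in> U \<Longrightarrow> h x = l \<bullet> x" for U \<kappa> l
    proof -
      obtain c where "c \<in> C" "U \<subseteq> c" using cover[OF U] by blast
      then show ?thesis using CK by (meson subsetD)
    qed
  qed
qed

end

section \<open>Refinements, and functions vanishing exactly on a subfan\<close>

definition refinement_of :: "'b set set \<Rightarrow> 'b set set \<Rightarrow> bool" where
  "refinement_of K' K \<longleftrightarrow> \<Union>K' = \<Union>K \<and> (\<forall>\<kappa>'\<in>K'. \<exists>\<kappa>\<in>K. \<kappa>' \<subseteq> \<kappa>)"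

lemma refinement_of_Union: "refinement_of K' K \<Longrightarrow> \<Union>K' = \<Union>K"
  and refinement_of_cell: "refinement_of K' K \<Longrightarrow> \<kappa>' \<in> K' \<Longrightarrow> \<exists>\<kappa>\<in>K. \<kappa>' \<subseteq> \<kappa>"
  by (auto simp: refinement_of_def)

lemma refinement_of_refl: "refinement_of K K"
  by (auto simp: refinement_of_def)

lemma refinement_of_trans: "refinement_of K'' K' \<Longrightarrow> refinement_of K' K \<Longrightarrow> refinement_of K'' K"
  unfolding refinement_of_def by (metis order_trans)

text \<open>\<open>\<sigma>\<close> is a face of the coarse cone around \<open>\<kappa>'\<close>,
  hence also of the smaller \<open>\<kappa>'\<close>.\<close>

lemma refinement_of_keeps_cell:
  assumes "wfan W K" "wfan W K'" "refinement_of K' K" "\<sigma> \<in> K" "\<kappa>' \<in> K'" "\<sigma> \<subseteq> \<kappa>'"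
  shows "\<sigma> \<in> K'"
proof -
  obtain \<kappa> where \<kappa>: "\<kappa> \<in> K" "\<kappa>' \<subseteq> \<kappa>" using refinement_of_cell[OF assms(3,5)] by blast
  then have "\<sigma> face_of \<kappa>" using wfan_subset_face_of[OF assms(1,4)] assms(6) by blast
  then have "\<sigma> face_of \<kappa>'" using face_of_subset assms(6) \<kappa>(2) by blast
  moreover have "\<sigma> \<noteq> {}" using wcone_0 wfanD(3)[OF assms(1,4)] by blast
  ultimately show ?thesis using wfanD(4)[OF assms(2,5)] by blast
qed

lemma wcone_linear_penalty:
  assumes "wcone W c" "\<And>x. x \<in> c \<Longrightarrow> 0 \<le> \<phi> \<bullet> x" "\<And>x. x \<in> c \<Longrightarrow> \<phi> \<bullet> x = 0 \<Longrightarrow> 0 \<le> l \<bullet> x"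
  shows "\<forall>\<^sub>F k in sequentially. \<forall>x\<in>c. 0 \<le> l \<bullet> x + real k * (\<phi> \<bullet> x)"
proof -
  obtain A where "finite A" "c = hcone A" using assms(1) by (auto simp: wcone_def)
  then show ?thesis using linear_penalty[of A \<phi> l] assms(2,3) by simp
qed

lemma wcone_penalty:
  assumes "wcone W c" "piecewise_linear_on c g" "piecewise_linear_on c h"
    "\<And>x. x \<in> c \<Longrightarrow> 0 \<le> h x" "\<And>x. x \<in> c \<Longrightarrow> h x = 0 \<Longrightarrow> 0 \<le> g x"
  shows "\<forall>\<^sub>F k in sequentially. \<forall>x\<in>c. 0 \<le> g x + real k * h x"
proof -
  obtain A where "finite A" "c = hcone A" using assms(1) by (auto simp: wcone_def)
  then show ?thesis using piecewise_linear_penalty[of A g h] assms(2-5) by simp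
qed

context functional_group
begin

text \<open>Induction on the number of cones outside \<open>S\<close>, with a maximal one,
  \<open>\<kappa>\<close>, added last. The values on its proper faces are then given and have to be
  reproduced by one minimum over \<open>\<kappa>\<close>. This is always possible since concavity is
  asked only within each cone, never across walls.\<close>

lemma conewise_concave_vanishing_on_subfan:
  assumes "wfan W K" "S \<subseteq> K" "S \<noteq> {}" "\<And>\<kappa> F. \<kappa> \<in> S \<Longrightarrow> F face_of \<kappa> \<Longrightarrow> F \<noteq> {} \<Longrightarrow> F \<in> S"
  shows "\<exists>h. conewise_concave W K h \<and> (\<forall>x\<in>\<Union>S. h x = 0) \<and> (\<forall>x\<in>\<Union>K. 0 \<le> h x) \<and>
    (\<forall>x\<in>\<Union>K - \<Union>S. 0 < h x)"
  using assms(1,2)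
proof (induction "card (K - S)" arbitrary: K rule: less_induct)
  case less
  note K = less.prems(1) and SK = less.prems(2)
  show ?case
  proof (cases "K = S")
    case True
    then show ?thesis using conewise_concave_zero by (intro exI[of _ "\<lambda>x. 0"]) auto
  next
    case False
    have "finite (K - S)" "K - S \<noteq> {}" using wfanD(1)[OF K] SK False by auto
    then obtain \<kappa> where \<kappa>: "\<kappa> \<in> K - S" "\<And>\<mu>. \<mu> \<in> K - S \<Longrightarrow> \<kappa> \<subseteq> \<mu> \<Longrightarrow> \<kappa> = \<mu>"
      using finite_has_maximal[of "K - S"] by blast
    then have \<kappa>K: "\<kappa> \<in> K" by blast
    define K0 where "K0 = K - {\<kappa>}"
    have K0K: "K0 \<subseteq> K" by (auto simp: K0_def)
    have SK0: "S \<subseteq> K0" using SK \<kappa> by (auto simp: K0_def)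
    have ne: "\<mu> \<noteq> {}" if "\<mu> \<in> K" for \<mu> using wcone_0 wfanD(3)[OF K that] by blast
    \<comment> \<open>A larger cone outside \<open>S\<close> would contradict maximality, and
      \<open>S\<close> is closed under faces.\<close>
    have notface: "\<not> \<kappa> face_of \<mu>" if \<mu>: "\<mu> \<in> K0" for \<mu>
    proof
      assume f: "\<kappa> face_of \<mu>"
      show False
      proof (cases "\<mu> \<in> S")
        case True
        then show False using assms(4)[OF True f ne[OF \<kappa>K]] \<kappa>(1) by blast
      next
        case False
        then show False using \<kappa>(2)[of \<mu>] face_of_imp_subset[OF f] \<mu> by (auto simp: K0_def)
      qed
    qed
    have K0: "wfan W K0"
    proof (rule wfanI)
      show "finite K0" "K0 \<noteq> {}" using wfanD(1)[OF K] assms(3) SK0 by (auto simp: K0_def)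
      show "F \<in> K0" if "\<mu> \<in> K0" "F face_of \<mu>" "F \<noteq> {}" for \<mu> F
        using wfanD(4)[OF K _ that(2,3)] notface[OF that(1)] that K0K by (auto simp: K0_def)
    qed (use wfanD(3)[OF K] wfan_relint_unique[OF K] K0K in blast)+
    have "card (K0 - S) < card (K - S)"
      using \<kappa>(1) \<open>finite (K - S)\<close> by (intro psubset_card_mono) (auto simp: K0_def)
    from less.hyps[OF this K0 SK0] obtain h0 where h0: "conewise_concave W K0 h0"
      "\<And>x. x \<in> \<Union>S \<Longrightarrow> h0 x = 0" "\<And>x. x \<in> \<Union>K0 \<Longrightarrow> 0 \<le> h0 x" "\<And>x. x \<in> \<Union>K0 - \<Union>S \<Longrightarrow> 0 < h0 x"
      by blast
    obtain L where L: "\<And>\<kappa>. \<kappa> \<in> K0 \<Longrightarrow> finite (L \<kappa>)" "\<And>\<kappa>. \<kappa> \<in> K0 \<Longrightarrow> L \<kappa> \<subseteq> W"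
      "\<And>\<kappa> x a. \<kappa> \<in> K0 \<Longrightarrow> x \<in> \<kappa> \<Longrightarrow> a \<in> L \<kappa> \<Longrightarrow> h0 x \<le> a \<bullet> x"
      "\<And>\<kappa> x. \<kappa> \<in> K0 \<Longrightarrow> x \<in> \<kappa> \<Longrightarrow> \<exists>a\<in>L \<kappa>. h0 x = a \<bullet> x"
      by (rule conewise_concaveE[OF h0(1)]) blast
    define \<G> where "\<G> = {G \<in> K0. G \<subseteq> \<kappa>}"
    have \<G>K0: "G \<in> K0" "G \<subseteq> \<kappa>" "G face_of \<kappa>" "G \<noteq> {}" if "G \<in> \<G>" for G
    proof -
      show 1: "G \<in> K0" "G \<subseteq> \<kappa>" using that by (auto simp: \<G>_def)
      show "G face_of \<kappa>" using wfan_subset_face_of[OF K _ \<kappa>K] 1 K0K by blast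
      show "G \<noteq> {}" using ne 1 K0K by blast
    qed
    have fin\<G>: "finite \<G>" using wfanD(1)[OF K0] by (auto simp: \<G>_def)
    have \<G>I: "\<mu> \<inter> \<kappa> \<in> \<G>" if "\<mu> \<in> K0" for \<mu>
    proof -
      have "\<mu> \<inter> \<kappa> \<noteq> \<kappa>" using wfan_subset_face_of[OF K \<kappa>K, of \<mu>] notface[OF that] that K0K by blast
      then show ?thesis using wfanD(7)[OF K _ \<kappa>K, of \<mu>] that K0K by (auto simp: \<G>_def K0_def)
    qed
    have \<G>ne: "\<G> \<noteq> {}" using \<G>I assms(3) SK0 by blast
    have "\<forall>G\<in>\<G>. \<exists>\<phi>. \<phi> \<in> W \<and> (\<forall>x\<in>\<kappa>. 0 \<le> \<phi> \<bullet> x) \<and> G = {x \<in> \<kappa>. \<phi> \<bullet> x = 0}"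
    proof
      fix G assume G: "G \<in> \<G>"
      show "\<exists>\<phi>. \<phi> \<in> W \<and> (\<forall>x\<in>\<kappa>. 0 \<le> \<phi> \<bullet> x) \<and> G = {x \<in> \<kappa>. \<phi> \<bullet> x = 0}"
        by (rule wcone_face_functional[OF wfanD(3)[OF K \<kappa>K] \<G>K0(3,4)[OF G]]) blast
    qed
    from bchoice[OF this] obtain \<phi> where
      "\<forall>G\<in>\<G>. \<phi> G \<in> W \<and> (\<forall>x\<in>\<kappa>. 0 \<le> \<phi> G \<bullet> x) \<and> G = {x \<in> \<kappa>. \<phi> G \<bullet> x = 0}" ..
    then have \<phi>: "\<And>G. G \<in> \<G> \<Longrightarrow> \<phi> G \<in> W" "\<And>G x. G \<in> \<G> \<Longrightarrow> x \<in> \<kappa> \<Longrightarrow> 0 \<le> \<phi> G \<bullet> x"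
      "\<And>G x. G \<in> \<G> \<Longrightarrow> x \<in> \<kappa> \<Longrightarrow> \<phi> G \<bullet> x = 0 \<longleftrightarrow> x \<in> G" by blast+
    \<comment> \<open>The functionals contributed by \<open>G'\<close> must not undercut
      \<open>h0\<close> on \<open>G\<close>. Where \<open>\<phi> G'\<close> vanishes the point lies
      in \<open>G'\<close>, so \<open>a'\<close> is at least \<open>h0\<close> there; a large
      multiple of \<open>\<phi> G'\<close> takes care of the rest.\<close>
    have "\<forall>\<^sub>F k in sequentially. \<forall>x\<in>{x \<in> G. h0 x = a \<bullet> x}. 0 \<le> (a' - a) \<bullet> x + real k * (\<phi> G' \<bullet> x)"
      if *: "G \<in> \<G>" "G' \<in> \<G>" "a \<in> L G" "a' \<in> L G'" for G G' a a'
    proof (rule wcone_linear_penalty)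
      note G = \<G>K0[OF *(1)] and G' = \<G>K0[OF *(2)]
      show "wcone W {x \<in> G. h0 x = a \<bullet> x}"
        by (rule wcone_linearity_piece[OF wfanD(3)[OF K0 G(1)] L(1)[OF G(1)] L(2)[OF G(1)]
              L(3)[OF G(1)] L(4)[OF G(1)] *(3)])
      show "0 \<le> \<phi> G' \<bullet> x" if "x \<in> {x \<in> G. h0 x = a \<bullet> x}" for x
        using \<phi>(2)[OF *(2)] G(2) that by blast
      show "0 \<le> (a' - a) \<bullet> x" if "x \<in> {x \<in> G. h0 x = a \<bullet> x}" "\<phi> G' \<bullet> x = 0" for x
        using \<phi>(3)[OF *(2), of x] G(2) that L(3)[OF G'(1) _ *(4), of x] by (auto simp: inner_simps)
    qed
    then have ev1: "\<forall>\<^sub>F k in sequentially. \<forall>G\<in>\<G>. \<forall>G'\<in>\<G>. \<forall>a\<in>L G. \<forall>a'\<in>L G'.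
        \<forall>x\<in>{x \<in> G. h0 x = a \<bullet> x}. 0 \<le> (a' - a) \<bullet> x + real k * (\<phi> G' \<bullet> x)"
      using fin\<G> L(1) \<G>K0(1) by (simp add: eventually_ball_finite)
    \<comment> \<open>Subtracting \<open>\<phi> G\<close> beforehand leaves a spare copy of it,
      which makes the new functionals strictly positive off the old cones.\<close>
    have "\<forall>\<^sub>F k in sequentially. \<forall>x\<in>\<kappa>. 0 \<le> (a - \<phi> G) \<bullet> x + real k * (\<phi> G \<bullet> x)"
      if *: "G \<in> \<G>" "a \<in> L G" for G a
    proof (rule wcone_linear_penalty[OF wfanD(3)[OF K \<kappa>K] \<phi>(2)[OF *(1)]])
      note G = \<G>K0[OF *(1)]
      show "0 \<le> (a - \<phi> G) \<bullet> x" if "x \<in> \<kappa>" "\<phi> G \<bullet> x = 0" for x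
      proof -
        have "x \<in> G" using \<phi>(3)[OF *(1)] that by blast
        then have "0 \<le> h0 x" "h0 x \<le> a \<bullet> x" using h0(3) G(1) L(3)[OF G(1) _ *(2)] by blast+
        then show ?thesis using that(2) by (simp add: inner_simps)
      qed
    qed
    then have ev2: "\<forall>\<^sub>F k in sequentially. \<forall>G\<in>\<G>. \<forall>a\<in>L G. \<forall>x\<in>\<kappa>.
        0 \<le> (a - \<phi> G) \<bullet> x + real k * (\<phi> G \<bullet> x)"
      using fin\<G> L(1) \<G>K0(1) by (simp add: eventually_ball_finite)
    obtain k where k:
      "\<forall>G\<in>\<G>. \<forall>G'\<in>\<G>. \<forall>a\<in>L G. \<forall>a'\<in>L G'.
        \<forall>x\<in>{x \<in> G. h0 x = a \<bullet> x}. 0 \<le> (a' - a) \<bullet> x + real k * (\<phi> G' \<bullet> x)"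
      "\<forall>G\<in>\<G>. \<forall>a\<in>L G. \<forall>x\<in>\<kappa>. 0 \<le> (a - \<phi> G) \<bullet> x + real k * (\<phi> G \<bullet> x)"
      using eventually_happens[OF eventually_conj[OF ev1 ev2]] by (elim exE disjE conjE) simp_all
    then have k1: "\<And>G G' a a' x. G \<in> \<G> \<Longrightarrow> G' \<in> \<G> \<Longrightarrow> a \<in> L G \<Longrightarrow> a' \<in> L G' \<Longrightarrow> x \<in> G \<Longrightarrow>
        h0 x = a \<bullet> x \<Longrightarrow> 0 \<le> (a' - a) \<bullet> x + real k * (\<phi> G' \<bullet> x)"
      and k2: "\<And>G a x. G \<in> \<G> \<Longrightarrow> a \<in> L G \<Longrightarrow> x \<in> \<kappa> \<Longrightarrow> 0 \<le> (a - \<phi> G) \<bullet> x + real k * (\<phi> G \<bullet> x)"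
      by blast+
    \<comment> \<open>On a face \<open>G'\<close> the term \<open>k \<phi> G\<close> is so large off \<open>G\<close> that the minimum over \<open>M\<close> restricts to \<open>h0\<close>.\<close>
    define M where "M = (\<Union>G\<in>\<G>. (\<lambda>a. a + real k *\<^sub>R \<phi> G) ` L G)"
    have finM: "finite M" using fin\<G> L(1) \<G>K0(1) by (auto simp: M_def)
    have MW: "M \<subseteq> W"
    proof
      fix b assume "b \<in> M"
      then obtain G a where "G \<in> \<G>" "a \<in> L G" "b = a + real k *\<^sub>R \<phi> G" by (auto simp: M_def)
      then show "b \<in> W" using L(2) \<G>K0(1) \<phi>(1) by (blast intro: add_W scale_W)
    qed
    have Mne: "M \<noteq> {}"
    proof -
      obtain G where G: "G \<in> \<G>" using \<G>ne by blast
      then obtain x where "x \<in> G" using \<G>K0(4) by blast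
      then obtain a where "a \<in> L G" using L(4)[OF \<G>K0(1)[OF G]] by blast
      then show ?thesis using G by (auto simp: M_def)
    qed
    have old: "(\<forall>b\<in>M. h0 x \<le> b \<bullet> x) \<and> (\<exists>b\<in>M. h0 x = b \<bullet> x)" if x: "x \<in> \<kappa>" "x \<in> \<Union>K0" for x
    proof -
      obtain \<mu> where \<mu>: "\<mu> \<in> K0" "x \<in> \<mu>" using x(2) by blast
      then have G: "\<mu> \<inter> \<kappa> \<in> \<G>" "x \<in> \<mu> \<inter> \<kappa>" using \<G>I x(1) by auto
      obtain a where a: "a \<in> L (\<mu> \<inter> \<kappa>)" "h0 x = a \<bullet> x" using L(4)[OF \<G>K0(1)[OF G(1)] G(2)] by blast
      have "\<exists>b\<in>M. h0 x = b \<bullet> x"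
      proof (rule bexI[of _ "a + real k *\<^sub>R \<phi> (\<mu> \<inter> \<kappa>)"])
        show "h0 x = (a + real k *\<^sub>R \<phi> (\<mu> \<inter> \<kappa>)) \<bullet> x"
          using a(2) \<phi>(3)[OF G(1) x(1)] G(2) by (simp add: inner_simps)
      qed (use a G in \<open>auto simp: M_def\<close>)
      moreover have "h0 x \<le> b \<bullet> x" if b: "b \<in> M" for b
      proof -
        obtain G' a' where *: "G' \<in> \<G>" "a' \<in> L G'" "b = a' + real k *\<^sub>R \<phi> G'" using b by (auto simp: M_def)
        show ?thesis using k1[OF G(1) *(1) a(1) *(2) G(2) a(2)] a(2) *(3) by (simp add: inner_simps)
      qed
      ultimately show ?thesis by blast
    qed
    have new: "0 < b \<bullet> x" if x: "x \<in> \<kappa>" "x \<notin> \<Union>K0" and b: "b \<in> M" for x b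
    proof -
      obtain G a where *: "G \<in> \<G>" "a \<in> L G" "b = a + real k *\<^sub>R \<phi> G" using b by (auto simp: M_def)
      have "x \<notin> G" using x(2) \<G>K0(1)[OF *(1)] by blast
      then have "0 < \<phi> G \<bullet> x" using \<phi>(2,3)[OF *(1) x(1)] by (simp add: order_less_le)
      then show ?thesis using k2[OF *(1,2) x(1)] *(3) by (simp add: inner_simps)
    qed
    define h where "h x = (if x \<in> \<Union>K0 then h0 x else Min ((\<lambda>b. b \<bullet> x) ` M))" for x
    have hK0: "h x = h0 x" if "x \<in> \<Union>K0" for x unfolding h_def using that by (rule if_P)
    have hnew: "h x = Min ((\<lambda>b. b \<bullet> x) ` M)" if "x \<notin> \<Union>K0" for x unfolding h_def using that by (rule if_not_P)
    have Min_in: "\<exists>b\<in>M. Min ((\<lambda>b. b \<bullet> x) ` M) = b \<bullet> x" for x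
      using Min_in[of "(\<lambda>b. b \<bullet> x) ` M"] finM Mne by blast
    have Min_le: "Min ((\<lambda>b. b \<bullet> x) ` M) \<le> b \<bullet> x" if "b \<in> M" for x b
      using finM that by simp
    have min\<kappa>: "min_functional W \<kappa> h"
      unfolding min_functional_def
    proof (rule exI[of _ M], intro conjI finM MW ballI)
      fix x assume x: "x \<in> \<kappa>"
      show "\<exists>b\<in>M. h x = b \<bullet> x"
        using old[OF x] Min_in[of x] hK0[of x] hnew[of x] by metis
      show "h x \<le> b \<bullet> x" if "b \<in> M" for b
        using old[OF x] Min_le[OF that, of x] hK0[of x] hnew[of x] that by metis
    qed
    have "conewise_concave W K h"
      unfolding conewise_concave_def
    proof
      fix \<mu> assume \<mu>: "\<mu> \<in> K"
      show "min_functional W \<mu> h"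
      proof (cases "\<mu> = \<kappa>")
        case False
        then have "\<mu> \<in> K0" using \<mu> by (simp add: K0_def)
        then have "min_functional W \<mu> h0" using h0(1) by (simp add: conewise_concave_def)
        then show ?thesis by (rule min_functional_cong) (use \<open>\<mu> \<in> K0\<close> hK0 in blast)
      qed (use min\<kappa> in simp)
    qed
    moreover have "h x = 0" if "x \<in> \<Union>S" for x
    proof -
      have "x \<in> \<Union>K0" using that SK0 by blast
      then show ?thesis using hK0 h0(2)[OF that] by simp
    qed
    moreover have "0 \<le> h x \<and> (x \<notin> \<Union>S \<longrightarrow> 0 < h x)" if x: "x \<in> \<Union>K" for x
    proof (cases "x \<in> \<Union>K0")
      case True
      then show ?thesis using hK0 h0(3,4) by simp
    next
      case False
      then have "x \<in> \<kappa>" using x unfolding K0_def by blast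
      obtain b where b: "b \<in> M" "h x = b \<bullet> x" using Min_in[of x] hnew[OF False] by metis
      then show ?thesis using new[OF \<open>x \<in> \<kappa>\<close> False b(1)] by simp
    qed
    ultimately show ?thesis by (intro exI[of _ h]) blast
  qed
qed

text \<open>The functions are treated one by one: conewise concavity passes to refinements, and a
  convex set on which all of them are linear survives every cut.\<close>

lemma linearity_refinement_finite:
  assumes "wfan W K" "finite H" "\<forall>h\<in>H. conewise_concave W K h"
  shows "\<exists>K'. wfan W K' \<and> refinement_of K' K \<and> (\<forall>h\<in>H. conewise_linear W K' h) \<and>
    (\<forall>U \<kappa>. convex U \<longrightarrow> U \<noteq> {} \<longrightarrow> \<kappa> \<in> K \<longrightarrow> U \<subseteq> \<kappa> \<longrightarrow> (\<forall>h\<in>H. \<exists>l. \<forall>x\<in>U. h x = l \<bullet> x) \<longrightarrow>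
      (\<exists>\<kappa>'\<in>K'. U \<subseteq> \<kappa>'))"
  using assms(2,3)
proof (induction H rule: finite_induct)
  case empty
  show ?case
  proof (rule exI[of _ K], intro conjI allI impI)
    show "\<exists>\<kappa>'\<in>K. U \<subseteq> \<kappa>'" if "\<kappa> \<in> K" "U \<subseteq> \<kappa>" for U \<kappa> using that by blast
  qed (use assms(1) refinement_of_refl in auto)
next
  case (insert g H)
  have "\<forall>h\<in>H. conewise_concave W K h" using insert.prems by blast
  from insert.IH[OF this] obtain K1 where K1: "wfan W K1" "refinement_of K1 K" "\<forall>h\<in>H. conewise_linear W K1 h"
    "\<forall>U \<kappa>. convex U \<longrightarrow> U \<noteq> {} \<longrightarrow> \<kappa> \<in> K \<longrightarrow> U \<subseteq> \<kappa> \<longrightarrow> (\<forall>h\<in>H. \<exists>l. \<forall>x\<in>U. h x = l \<bullet> x) \<longrightarrow>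
      (\<exists>\<kappa>'\<in>K1. U \<subseteq> \<kappa>')"
    by auto
  have "conewise_concave W K g" using insert.prems by blast
  then have "conewise_concave W K1 g" by (rule conewise_concave_refine) (rule refinement_of_cell[OF K1(2)])
  then obtain K2 where K2: "wfan W K2" "\<Union>K2 = \<Union>K1" "\<And>\<kappa>'. \<kappa>' \<in> K2 \<Longrightarrow> \<exists>\<kappa>\<in>K1. \<kappa>' \<subseteq> \<kappa>"
    "conewise_linear W K2 g"
    "\<And>U \<kappa> l. convex U \<Longrightarrow> U \<noteq> {} \<Longrightarrow> \<kappa> \<in> K1 \<Longrightarrow> U \<subseteq> \<kappa> \<Longrightarrow> (\<And>x. x \<in> U \<Longrightarrow> g x = l \<bullet> x) \<Longrightarrow>
      \<exists>\<kappa>'\<in>K2. U \<subseteq> \<kappa>'"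
    by (rule linearity_refinement[OF K1(1)]) blast
  have r: "refinement_of K2 K1" using K2(2,3) by (simp add: refinement_of_def)
  show ?case
  proof (rule exI[of _ K2], intro conjI ballI allI impI)
    show "refinement_of K2 K" by (rule refinement_of_trans[OF r K1(2)])
    show "conewise_linear W K2 h" if "h \<in> insert g H" for h
    proof (cases "h = g")
      case False
      then have "conewise_linear W K1 h" using that K1(3) by blast
      then show ?thesis by (rule conewise_linear_refine) (rule K2(3))
    qed (use K2(4) in simp)
    show "\<exists>\<kappa>'\<in>K2. U \<subseteq> \<kappa>'" if U: "convex U" "U \<noteq> {}" "\<kappa> \<in> K" "U \<subseteq> \<kappa>" "\<forall>h\<in>insert g H. \<exists>l. \<forall>x\<in>U. h x = l \<bullet> x"
      for U \<kappa>
    proof -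
      obtain \<kappa>1 where 1: "\<kappa>1 \<in> K1" "U \<subseteq> \<kappa>1" using K1(4) U by (meson insertI2)
      obtain l where "\<forall>x\<in>U. g x = l \<bullet> x" using U(5) by blast
      then show ?thesis using K2(5)[OF U(1,2) 1, of l] by blast
    qed
  qed (rule K2(1))
qed

text \<open>The gain is that \<open>\<Psi>\<close> becomes linear on each cone: its negative is then
  conewise concave too, so large multiples of \<open>\<Psi>\<close> can be subtracted from a
  conewise concave function.\<close>

lemma full_refinement:
  assumes K: "wfan W K" and \<Sigma>: "wfan W \<Sigma>" "\<Sigma> \<subseteq> K"
  obtains K' \<Psi> where "wfan W K'" "refinement_of K' K" "\<Sigma> \<subseteq> K'" "conewise_linear W K' \<Psi>"
    "\<And>x. x \<in> \<Union>K' \<Longrightarrow> 0 \<le> \<Psi> x" "\<And>x. x \<in> \<Union>K' \<Longrightarrow> \<Psi> x = 0 \<longleftrightarrow> x \<in> \<Union>\<Sigma>"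
proof -
  have "\<exists>h. conewise_concave W K h \<and> (\<forall>x\<in>\<Union>\<Sigma>. h x = 0) \<and> (\<forall>x\<in>\<Union>K. 0 \<le> h x) \<and>
      (\<forall>x\<in>\<Union>K - \<Union>\<Sigma>. 0 < h x)"
    by (rule conewise_concave_vanishing_on_subfan[OF K \<Sigma>(2) wfanD(2)[OF \<Sigma>(1)]])
      (rule wfanD(4)[OF \<Sigma>(1)])
  then obtain \<Psi> where \<Psi>: "conewise_concave W K \<Psi>" "\<forall>x\<in>\<Union>\<Sigma>. \<Psi> x = 0" "\<forall>x\<in>\<Union>K. 0 \<le> \<Psi> x"
    "\<forall>x\<in>\<Union>K - \<Union>\<Sigma>. 0 < \<Psi> x"
    by (elim exE conjE)
  obtain K' where K': "wfan W K'" "\<Union>K' = \<Union>K" "\<And>\<kappa>'. \<kappa>' \<in> K' \<Longrightarrow> \<exists>\<kappa>\<in>K. \<kappa>' \<subseteq> \<kappa>"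
    "conewise_linear W K' \<Psi>"
    "\<And>U \<kappa> l. convex U \<Longrightarrow> U \<noteq> {} \<Longrightarrow> \<kappa> \<in> K \<Longrightarrow> U \<subseteq> \<kappa> \<Longrightarrow> (\<And>x. x \<in> U \<Longrightarrow> \<Psi> x = l \<bullet> x) \<Longrightarrow>
      \<exists>\<kappa>'\<in>K'. U \<subseteq> \<kappa>'"
    by (rule linearity_refinement[OF K \<Psi>(1)]) blast
  have r: "refinement_of K' K" using K'(2,3) by (simp add: refinement_of_def)
  have "\<sigma> \<in> K'" if \<sigma>: "\<sigma> \<in> \<Sigma>" for \<sigma>
  proof -
    have "\<sigma> \<in> K" "convex \<sigma>" "\<sigma> \<noteq> {}" using \<sigma> \<Sigma> wcone_convex wcone_0 wfanD(3)[OF \<Sigma>(1) \<sigma>] by blast+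
    moreover have "\<Psi> x = 0 \<bullet> x" if "x \<in> \<sigma>" for x using \<Psi>(2) \<sigma> that by auto
    ultimately obtain \<kappa>' where "\<kappa>' \<in> K'" "\<sigma> \<subseteq> \<kappa>'" using K'(5)[of \<sigma> \<sigma> 0] by blast
    then show ?thesis using refinement_of_keeps_cell[OF K K'(1) r \<open>\<sigma> \<in> K\<close>] by blast
  qed
  then have "\<Sigma> \<subseteq> K'" by blast
  moreover have "\<Psi> x = 0 \<longleftrightarrow> x \<in> \<Union>\<Sigma>" if "x \<in> \<Union>K'" for x
    using \<Psi>(2,4) that K'(2) by (metis DiffI less_irrefl)
  ultimately show ?thesis using that[OF K'(1) r _ K'(4)] \<Psi>(3) K'(2) by metis
qed

text \<open>Asking only for the traces of \<open>Q\<close> on the cones to be cones allows sets like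
  the later \<open>{x. 0 \<le> \<theta> x}\<close>, which may fail to be convex. Two faces of traces
  with a common relative interior point are both faces of
  \<open>\<kappa> \<inter> \<mu> \<inter> Q\<close>, hence equal.\<close>

lemma wfan_cut:
  assumes K: "wfan W K" and w: "\<And>\<kappa>. \<kappa> \<in> K \<Longrightarrow> wcone W (\<kappa> \<inter> Q)"
  shows "wfan W {F. F \<noteq> {} \<and> (\<exists>\<kappa>\<in>K. F face_of \<kappa> \<inter> Q)}"
proof -
  have "wfan W {F. F \<noteq> {} \<and> (\<exists>c\<in>(\<lambda>\<kappa>. \<kappa> \<inter> Q) ` K. F face_of c)}"
  proof (rule wfan_faces)
    fix c d F G x assume *: "c \<in> (\<lambda>\<kappa>. \<kappa> \<inter> Q) ` K" "d \<in> (\<lambda>\<kappa>. \<kappa> \<inter> Q) ` K" "F face_of c" "G face_of d"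
      "x \<in> rel_interior F" "x \<in> rel_interior G"
    obtain \<kappa> where \<kappa>: "\<kappa> \<in> K" "c = \<kappa> \<inter> Q" using *(1) by blast
    obtain \<mu> where \<mu>: "\<mu> \<in> K" "d = \<mu> \<inter> Q" using *(2) by blast
    have x: "x \<in> F" "x \<in> G" using * rel_interior_subset by blast+
    have FG: "F \<subseteq> c" "G \<subseteq> d" using * face_of_imp_subset by blast+
    note g = wfanD(5,6)[OF K \<kappa>(1) \<mu>(1)]
    have "F \<subseteq> \<kappa> \<inter> \<mu>" using subset_of_face_of[OF g(1), of F] *(5) x FG \<kappa> \<mu> by blast
    moreover have "G \<subseteq> \<kappa> \<inter> \<mu>" using subset_of_face_of[OF g(2), of G] *(6) x FG \<kappa> \<mu> by blast
    ultimately have s: "F \<subseteq> \<kappa> \<inter> \<mu> \<inter> Q" "G \<subseteq> \<kappa> \<inter> \<mu> \<inter> Q" using FG \<kappa> \<mu> by blast+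
    have "F face_of \<kappa> \<inter> \<mu> \<inter> Q" by (rule face_of_subset[OF *(3) s(1)]) (use \<kappa> in blast)
    moreover have "G face_of \<kappa> \<inter> \<mu> \<inter> Q" by (rule face_of_subset[OF *(4) s(2)]) (use \<mu> in blast)
    ultimately show "F = G" using face_of_eq *(5,6) by blast
  qed (use wfanD(1,2)[OF K] w in auto)
  then show ?thesis by simp
qed

end

section \<open>Stars\<close>

text \<open>The cone of feasible directions at \<open>v\<close>. For a convex cone containing
  \<open>v\<close> it is the sum of \<open>\<tau>\<close> and the line through
  \<open>v\<close>.\<close>

definition tangent :: "'b::euclidean_space \<Rightarrow> 'b set \<Rightarrow> 'b set" where
  "tangent v \<tau> = {x. \<exists>e>0. v + e *\<^sub>R x \<in> \<tau>}"

text \<open>Tangent cones replace the cones themselves, so that the lineality space acquires the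
  line through \<open>v\<close>.\<close>

definition star :: "'b::euclidean_space set set \<Rightarrow> 'b \<Rightarrow> 'b set set" where
  "star K v = tangent v ` {\<tau>\<in>K. v \<in> \<tau>}"

text \<open>Adding the line through \<open>v\<close> is a Minkowski sum that does stay among the
  cones over \<open>W\<close>: it merely discards the inequalities strict at
  \<open>v\<close>.\<close>

lemma tangent_hcone:
  assumes "finite A" "v \<in> hcone A"
  shows "tangent v (hcone A) = hcone {a\<in>A. a \<bullet> v = 0}"
proof (intro subset_antisym subsetI)
  fix x assume "x \<in> tangent v (hcone A)"
  then obtain e where e: "e > 0" "v + e *\<^sub>R x \<in> hcone A" by (auto simp: tangent_def)
  have "0 \<le> a \<bullet> x" if a: "a \<in> A" "a \<bullet> v = 0" for a
  proof -
    have "0 \<le> a \<bullet> (v + e *\<^sub>R x)" using e(2) a(1) by (auto simp: hcone_def)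
    then show ?thesis using a(2) e(1) by (simp add: inner_simps zero_le_mult_iff)
  qed
  then show "x \<in> hcone {a\<in>A. a \<bullet> v = 0}" by (simp add: hcone_def)
next
  fix x assume x: "x \<in> hcone {a\<in>A. a \<bullet> v = 0}"
  have "\<forall>\<^sub>F e in at_right 0. v + e *\<^sub>R x \<in> hcone A"
    by (rule hcone_feasible_direction[OF assms]) (use x in \<open>auto simp: hcone_def\<close>)
  then obtain e where "e > 0" "v + e *\<^sub>R x \<in> hcone A" by (rule eventually_at_right_0_obtain)
  then show "x \<in> tangent v (hcone A)" by (auto simp: tangent_def)
qed

lemma wcone_tangent:
  assumes "wcone W \<tau>" "v \<in> \<tau>"
  shows "wcone W (tangent v \<tau>)"
proof -
  obtain A where A: "finite A" "A \<subseteq> W" "\<tau> = hcone A" using assms(1) by (auto simp: wcone_def)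
  then show ?thesis using tangent_hcone[of A v] assms(2) unfolding wcone_def
    by (intro exI[of _ "{a\<in>A. a \<bullet> v = 0}"]) auto
qed

lemma tangentE:
  assumes "convex \<tau>" "v \<in> \<tau>" "x \<in> tangent v \<tau>"
  obtains e where "e > 0" "\<And>d. 0 < d \<Longrightarrow> d \<le> e \<Longrightarrow> v + d *\<^sub>R x \<in> \<tau>"
proof -
  obtain e where e: "e > 0" "v + e *\<^sub>R x \<in> \<tau>" using assms(3) by (auto simp: tangent_def)
  have "v + d *\<^sub>R x \<in> \<tau>" if "0 < d" "d \<le> e" for d
  proof -
    have "(1 - d / e) *\<^sub>R v + (d / e) *\<^sub>R (v + e *\<^sub>R x) \<in> \<tau>"
      by (rule convexD_alt[OF assms(1,2) e(2)]) (use that e(1) in auto)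
    then show ?thesis using e(1) by (simp add: algebra_simps)
  qed
  then show ?thesis using that e(1) by blast
qed

lemma tangentI: "v + d *\<^sub>R x \<in> \<tau> \<Longrightarrow> d > 0 \<Longrightarrow> x \<in> tangent v \<tau>"
  by (auto simp: tangent_def)

lemma tangent_Int:
  assumes "convex \<tau>" "v \<in> \<tau>" "convex \<mu>" "v \<in> \<mu>"
  shows "tangent v \<tau> \<inter> tangent v \<mu> = tangent v (\<tau> \<inter> \<mu>)"
proof (intro subset_antisym subsetI)
  fix x assume x: "x \<in> tangent v \<tau> \<inter> tangent v \<mu>"
  obtain d where d: "d > 0" "\<And>t. 0 < t \<Longrightarrow> t \<le> d \<Longrightarrow> v + t *\<^sub>R x \<in> \<tau>"
    by (rule tangentE[OF assms(1,2)]) (use x in auto)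
  obtain e where e: "e > 0" "\<And>t. 0 < t \<Longrightarrow> t \<le> e \<Longrightarrow> v + t *\<^sub>R x \<in> \<mu>"
    by (rule tangentE[OF assms(3,4)]) (use x in auto)
  have "v + min d e *\<^sub>R x \<in> \<tau> \<inter> \<mu>" using d e by simp
  then show "x \<in> tangent v (\<tau> \<inter> \<mu>)" by (rule tangentI) (use d e in simp)
qed (auto simp: tangent_def)

lemma tangent_convex:
  assumes "convex \<tau>" "v \<in> \<tau>"
  shows "convex (tangent v \<tau>)"
  unfolding convex_alt
proof (intro ballI allI impI)
  fix x y u assume x: "x \<in> tangent v \<tau>" and y: "y \<in> tangent v \<tau>" and u: "0 \<le> u \<and> u \<le> (1::real)"
  obtain d where d: "d > 0" "\<And>t. 0 < t \<Longrightarrow> t \<le> d \<Longrightarrow> v + t *\<^sub>R x \<in> \<tau>" by (rule tangentE[OF assms x]) blast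
  obtain e where e: "e > 0" "\<And>t. 0 < t \<Longrightarrow> t \<le> e \<Longrightarrow> v + t *\<^sub>R y \<in> \<tau>" by (rule tangentE[OF assms y]) blast
  have "(1 - u) *\<^sub>R (v + min d e *\<^sub>R x) + u *\<^sub>R (v + min d e *\<^sub>R y) \<in> \<tau>"
    by (rule convexD_alt[OF assms(1)]) (use d e u in auto)
  then have "v + min d e *\<^sub>R ((1 - u) *\<^sub>R x + u *\<^sub>R y) \<in> \<tau>" by (simp add: algebra_simps)
  then show "(1 - u) *\<^sub>R x + u *\<^sub>R y \<in> tangent v \<tau>" by (rule tangentI) (use d e in simp)
qed

lemma tangent_face_of:
  assumes "convex \<tau>" "G face_of \<tau>" "v \<in> G"
  shows "tangent v G face_of tangent v \<tau>"
  unfolding face_of_def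
proof (intro conjI ballI impI)
  have G: "G \<subseteq> \<tau>" "convex G" using assms(2) face_of_imp_subset face_of_imp_convex by blast+
  then have v: "v \<in> \<tau>" using assms(3) by blast
  show "tangent v G \<subseteq> tangent v \<tau>" using G(1) by (auto simp: tangent_def)
  show "convex (tangent v G)" by (rule tangent_convex[OF G(2) assms(3)])
  have "a \<in> tangent v G \<and> b \<in> tangent v G"
    if a: "a \<in> tangent v \<tau>" and b: "b \<in> tangent v \<tau>" and x: "x \<in> tangent v G" and o: "x \<in> open_segment a b"
    for a b x
  proof -
    obtain d where d: "d > 0" "\<And>t. 0 < t \<Longrightarrow> t \<le> d \<Longrightarrow> v + t *\<^sub>R a \<in> \<tau>" by (rule tangentE[OF assms(1) v a]) blast
    obtain e where e: "e > 0" "\<And>t. 0 < t \<Longrightarrow> t \<le> e \<Longrightarrow> v + t *\<^sub>R b \<in> \<tau>" by (rule tangentE[OF assms(1) v b]) blast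
    obtain f where f: "f > 0" "\<And>t. 0 < t \<Longrightarrow> t \<le> f \<Longrightarrow> v + t *\<^sub>R x \<in> G" by (rule tangentE[OF G(2) assms(3) x]) blast
    define t where "t = min d (min e f)"
    have t: "t > 0" "t \<le> d" "t \<le> e" "t \<le> f" using d e f by (auto simp: t_def)
    obtain u where u: "0 < u" "u < 1" "x = (1 - u) *\<^sub>R a + u *\<^sub>R b" "a \<noteq> b"
      using o by (auto simp: in_segment)
    have "v + t *\<^sub>R x = (1 - u) *\<^sub>R (v + t *\<^sub>R a) + u *\<^sub>R (v + t *\<^sub>R b)"
      by (simp add: u(3) algebra_simps)
    moreover have "v + t *\<^sub>R a \<noteq> v + t *\<^sub>R b" using u(4) t(1) by simp
    ultimately have "v + t *\<^sub>R x \<in> open_segment (v + t *\<^sub>R a) (v + t *\<^sub>R b)"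
      using u(1,2) unfolding in_segment by blast
    then have "v + t *\<^sub>R a \<in> G \<and> v + t *\<^sub>R b \<in> G"
      using face_ofD[OF assms(2)] d(2) e(2) f(2) t by blast
    then show ?thesis using t(1) tangentI by blast
  qed
  then show "a \<in> tangent v G" "b \<in> tangent v G"
    if "a \<in> tangent v \<tau>" "b \<in> tangent v \<tau>" "x \<in> tangent v G" "x \<in> open_segment a b" for a b x
    using that by blast+
qed

lemma subset_tangent: "convex_cone \<tau> \<Longrightarrow> v \<in> \<tau> \<Longrightarrow> \<tau> \<subseteq> tangent v \<tau>"
  by (auto simp: convex_cone_add intro!: tangentI[of v 1])

lemma uminus_in_tangent: "convex_cone \<tau> \<Longrightarrow> v \<in> \<tau> \<Longrightarrow> - v \<in> tangent v \<tau>"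
proof (rule tangentI[of v "1/2"])
  assume *: "convex_cone \<tau>" "v \<in> \<tau>"
  have "v + (1/2) *\<^sub>R (- v) = (1 - 1/2) *\<^sub>R v" by (simp only: scaleR_left_diff_distrib scaleR_one) simp
  then show "v + (1/2) *\<^sub>R (- v) \<in> \<tau>" using convex_cone_scaleR[OF *(1) _ *(2), of "1/2"] by simp
qed simp

lemma face_of_tangent:
  assumes "wcone W \<tau>" "v \<in> \<tau>" "F face_of tangent v \<tau>" "F \<noteq> {}"
  obtains G where "G face_of \<tau>" "v \<in> G" "F = tangent v G"
proof
  \<comment> \<open>The corresponding face of \<open>\<tau>\<close> is the part of
    \<open>\<tau>\<close> inside the translate of \<open>F\<close> by \<open>v\<close>.\<close>
  let ?G = "{y \<in> \<tau>. y - v \<in> F}"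
  have cF: "convex_cone F"
    by (rule face_of_cone_convex_cone[OF wcone_convex_cone[OF wcone_tangent[OF assms(1,2)]] assms(3,4)])
  show "v \<in> ?G" using assms(2) convex_cone_contains_0[OF cF] by simp
  show "?G face_of \<tau>"
    unfolding face_of_def
  proof (intro conjI ballI impI)
    show "convex ?G" unfolding convex_alt
    proof (intro ballI allI impI)
      fix x y u assume x: "x \<in> ?G" and y: "y \<in> ?G" and u: "0 \<le> u \<and> u \<le> (1::real)"
      have "(1 - u) *\<^sub>R x + u *\<^sub>R y \<in> \<tau>"
        by (rule convexD_alt[OF wcone_convex[OF assms(1)]]) (use x y u in auto)
      moreover have "(1 - u) *\<^sub>R (x - v) + u *\<^sub>R (y - v) \<in> F"
        by (rule convexD_alt) (use cF x y u in \<open>auto simp: convex_cone_def\<close>)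
      ultimately show "(1 - u) *\<^sub>R x + u *\<^sub>R y \<in> ?G" by (simp add: algebra_simps)
    qed
    have "a - v \<in> F \<and> b - v \<in> F"
      if ab: "a \<in> \<tau>" "b \<in> \<tau>" "x \<in> ?G" "x \<in> open_segment a b" for a b x
    proof -
      have "a - v \<in> tangent v \<tau>" "b - v \<in> tangent v \<tau>"
        using ab(1,2) by (auto intro!: tangentI[of v 1])
      moreover have "x - v \<in> open_segment (a - v) (b - v)"
      proof -
        obtain u where u: "0 < u" "u < 1" "x = (1 - u) *\<^sub>R a + u *\<^sub>R b" "a \<noteq> b"
          using ab(4) by (auto simp: in_segment)
        then have "x - v = (1 - u) *\<^sub>R (a - v) + u *\<^sub>R (b - v)" by (simp add: algebra_simps)
        moreover have "a - v \<noteq> b - v" using u(4) by simp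
        ultimately show ?thesis using u(1,2) unfolding in_segment by blast
      qed
      ultimately show ?thesis using face_ofD[OF assms(3)] ab(3) by blast
    qed
    then show "a \<in> ?G" "b \<in> ?G" if "a \<in> \<tau>" "b \<in> \<tau>" "x \<in> ?G" "x \<in> open_segment a b" for a b x
      using that by blast+
  qed auto
  show "F = tangent v ?G"
  proof (intro subset_antisym subsetI)
    fix x assume x: "x \<in> F"
    then have "x \<in> tangent v \<tau>" using assms(3) face_of_imp_subset by blast
    then obtain e where e: "e > 0" "v + e *\<^sub>R x \<in> \<tau>" by (auto simp: tangent_def)
    then have "v + e *\<^sub>R x \<in> ?G" using convex_cone_scaleR[OF cF _ x, of e] by simp
    then show "x \<in> tangent v ?G" by (rule tangentI[OF _ e(1)])
  next
    fix x assume "x \<in> tangent v ?G"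
    then obtain e where e: "e > 0" "e *\<^sub>R x \<in> F" by (auto simp: tangent_def)
    have "(1/e) *\<^sub>R (e *\<^sub>R x) \<in> F" by (rule convex_cone_scaleR[OF cF _ e(2)]) (use e(1) in simp)
    moreover have "(1/e) *\<^sub>R (e *\<^sub>R x) = x" using e(1) by simp
    ultimately show "x \<in> F" by metis
  qed
qed

lemma wfan_star:
  assumes K: "wfan W K" and v: "v \<in> \<Union>K"
  shows "wfan W (star K v)"
proof -
  have w: "wcone W \<kappa>" if "\<kappa> \<in> star K v" for \<kappa>
    using that wcone_tangent wfanD(3)[OF K] by (auto simp: star_def)
  have "F \<in> star K v" if F: "\<kappa> \<in> star K v" "F face_of \<kappa>" "F \<noteq> {}" for \<kappa> F
  proof -
    obtain \<tau> where \<tau>: "\<tau> \<in> K" "v \<in> \<tau>" "\<kappa> = tangent v \<tau>" using F(1) by (auto simp: star_def)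
    obtain G where "G face_of \<tau>" "v \<in> G" "F = tangent v G"
      by (rule face_of_tangent[OF wfanD(3)[OF K \<tau>(1)] \<tau>(2)]) (use F \<tau>(3) in auto)
    moreover from this have "G \<in> K" using wfanD(4)[OF K \<tau>(1)] by blast
    ultimately show ?thesis by (auto simp: star_def)
  qed
  moreover have "\<kappa> \<inter> \<mu> face_of \<kappa> \<and> \<kappa> \<inter> \<mu> face_of \<mu>" if F: "\<kappa> \<in> star K v" "\<mu> \<in> star K v" for \<kappa> \<mu>
  proof -
    obtain \<tau> where \<tau>: "\<tau> \<in> K" "v \<in> \<tau>" "\<kappa> = tangent v \<tau>" using F(1) by (auto simp: star_def)
    obtain \<sigma> where \<sigma>: "\<sigma> \<in> K" "v \<in> \<sigma>" "\<mu> = tangent v \<sigma>" using F(2) by (auto simp: star_def)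
    have c: "convex \<tau>" "convex \<sigma>" using wcone_convex wfanD(3)[OF K] \<tau> \<sigma> by blast+
    have "\<kappa> \<inter> \<mu> = tangent v (\<tau> \<inter> \<sigma>)" using tangent_Int[OF c(1) \<tau>(2) c(2) \<sigma>(2)] \<tau>(3) \<sigma>(3) by simp
    then show ?thesis
      using tangent_face_of[OF c(1) wfanD(5)[OF K \<tau>(1) \<sigma>(1)]] tangent_face_of[OF c(2) wfanD(6)[OF K \<tau>(1) \<sigma>(1)]]
        \<tau> \<sigma> by simp
  qed
  moreover have "finite (star K v)" using wfanD(1)[OF K] by (simp add: star_def)
  moreover have "star K v \<noteq> {}" using v by (auto simp: star_def)
  ultimately show ?thesis using w wcone_polyhedron[OF w] by (simp add: wfan_def polyhedral_complex_def)
qed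

lemma piecewise_linear_on_continuous:
  assumes "piecewise_linear_on c h"
  shows "continuous_on c h"
proof -
  obtain P where P: "finite P" "\<forall>p\<in>P. finite (fst p) \<and> (\<forall>x\<in>hcone (fst p). h x = snd p \<bullet> x)"
    "c \<subseteq> (\<Union>p\<in>P. hcone (fst p))"
    using assms unfolding piecewise_linear_on_def by blast
  have "continuous_on (\<Union>p\<in>P. hcone (fst p)) h"
  proof (rule continuous_on_closed_Union[OF P(1)])
    fix p assume p: "p \<in> P"
    show "closed (hcone (fst p))" using P(2) p polyhedron_hcone polyhedron_imp_closed by blast
    have "continuous_on (hcone (fst p)) (\<lambda>x. snd p \<bullet> x)" by (intro continuous_intros)
    moreover have "h x = snd p \<bullet> x" if "x \<in> hcone (fst p)" for x using P(2) p that by blast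
    ultimately show "continuous_on (hcone (fst p)) h" using continuous_on_cong by metis
  qed
  then show ?thesis using P(3) continuous_on_subset by blast
qed

context functional_group
begin

lemma wcone_superlevel:
  assumes "wcone W \<kappa>" "min_functional W \<kappa> h"
  shows "wcone W (\<kappa> \<inter> {x. 0 \<le> h x})"
proof -
  obtain L where L: "finite L" "L \<subseteq> W" "\<And>x a. x \<in> \<kappa> \<Longrightarrow> a \<in> L \<Longrightarrow> h x \<le> a \<bullet> x"
    "\<And>x. x \<in> \<kappa> \<Longrightarrow> \<exists>a\<in>L. h x = a \<bullet> x" by (rule min_functionalE[OF assms(2)]) blast
  have "\<kappa> \<inter> {x. 0 \<le> h x} = \<kappa> \<inter> hcone L"
  proof (intro subset_antisym subsetI)
    fix x assume x: "x \<in> \<kappa> \<inter> {x. 0 \<le> h x}"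
    then have "0 \<le> a \<bullet> x" if "a \<in> L" for a using L(3)[OF _ that, of x] by simp
    then show "x \<in> \<kappa> \<inter> hcone L" using x by (simp add: hcone_def)
  next
    fix x assume x: "x \<in> \<kappa> \<inter> hcone L"
    then show "x \<in> \<kappa> \<inter> {x. 0 \<le> h x}" using L(4)[of x] by (auto simp: hcone_def)
  qed
  then show ?thesis using wcone_restrict[OF assms(1) L(1,2)] by simp
qed

lemma conewise_concave_Min:
  assumes "finite I" "I \<noteq> {}" "\<And>i. i \<in> I \<Longrightarrow> conewise_concave W K (f i)"
  shows "conewise_concave W K (\<lambda>x. Min ((\<lambda>i. f i x) ` I))"
  using assms
proof (induction I rule: finite_ne_induct)
  case (insert i I)
  then have "conewise_concave W K (\<lambda>x. min (f i x) (Min ((\<lambda>i. f i x) ` I)))"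
    by (intro conewise_concave_min) auto
  then show ?case using insert.hyps by simp
qed simp

end

section \<open>Thickening a cone of a fan\<close>

context functional_group
begin

text \<open>The condition \<open>- v \<notin> \<rho>\<close> supplies an inequality of
  \<open>\<rho>\<close> strict at \<open>v\<close>, so the minimum that defines \<open>\<xi>\<close>
  runs over a nonempty set.\<close>

lemma wfan_thicken:
  assumes \<Sigma>: "wfan W \<Sigma>" and \<rho>: "\<rho> \<in> \<Sigma>" "v \<in> rel_interior \<rho>" "- v \<notin> \<rho>"
    and \<Delta>0: "wfan W \<Delta>0" "star \<Sigma> v \<subseteq> \<Delta>0" "\<Union>\<Delta>0 = UNIV"
  shows "\<exists>N. wfan W N \<and> \<Sigma> \<subseteq> N \<and> rel_interior \<rho> \<subseteq> interior (\<Union>N)"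
proof -
  have v\<rho>: "v \<in> \<rho>" using \<rho>(2) rel_interior_subset by blast
  have S: "wfan W (star \<Sigma> v)" by (rule wfan_star[OF \<Sigma>]) (use \<rho> v\<rho> in blast)
  obtain \<Delta> \<Psi> where \<Delta>: "wfan W \<Delta>" "refinement_of \<Delta> \<Delta>0" "star \<Sigma> v \<subseteq> \<Delta>" "conewise_linear W \<Delta> \<Psi>"
    and \<Psi>: "\<And>x. x \<in> \<Union>\<Delta> \<Longrightarrow> 0 \<le> \<Psi> x" "\<And>x. x \<in> \<Union>\<Delta> \<Longrightarrow> \<Psi> x = 0 \<longleftrightarrow> x \<in> \<Union>(star \<Sigma> v)"
    by (rule full_refinement[OF \<Delta>0(1) S \<Delta>0(2)]) blast
  have U: "\<Union>\<Delta> = UNIV" using refinement_of_Union[OF \<Delta>(2)] \<Delta>0(3) by simp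
  note \<Psi> = \<Psi>[unfolded U, OF UNIV_I]
  have pl: "piecewise_linear_on c h" if "conewise_concave W \<Delta> h" for c h
    using conewise_concave_piecewise_linear[OF wfanD(1)[OF \<Delta>(1)] wfanD(3)[OF \<Delta>(1)] that] U
      piecewise_linear_on_subset by blast
  define R where "R = {\<sigma> \<in> \<Sigma>. v \<in> \<sigma>}"
  have R: "\<sigma> \<in> \<Sigma>" "v \<in> \<sigma>" "tangent v \<sigma> \<in> \<Delta>" "wcone W \<sigma>" "\<sigma> \<subseteq> tangent v \<sigma>" if "\<sigma> \<in> R" for \<sigma>
  proof -
    show 1: "\<sigma> \<in> \<Sigma>" "v \<in> \<sigma>" using that by (auto simp: R_def)
    then show "tangent v \<sigma> \<in> \<Delta>" using \<Delta>(3) by (auto simp: star_def)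
    show 2: "wcone W \<sigma>" using wfanD(3)[OF \<Sigma> 1(1)] .
    show "\<sigma> \<subseteq> tangent v \<sigma>" by (rule subset_tangent[OF wcone_convex_cone[OF 2] 1(2)])
  qed
  have finR: "finite R" using wfanD(1)[OF \<Sigma>] by (simp add: R_def)
  have \<rho>R: "\<rho> \<in> R" using \<rho>(1) v\<rho> by (simp add: R_def)
  have star_eq: "\<Union>(star \<Sigma> v) = (\<Union>\<sigma>\<in>R. tangent v \<sigma>)" by (simp add: star_def R_def)
  have "\<forall>\<sigma>\<in>R. \<exists>A. finite A \<and> A \<subseteq> W \<and> \<sigma> = hcone A" using R(4) by (simp add: wcone_def)
  from bchoice[OF this] obtain A where "\<forall>\<sigma>\<in>R. finite (A \<sigma>) \<and> A \<sigma> \<subseteq> W \<and> \<sigma> = hcone (A \<sigma>)" ..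
  then have A: "\<And>\<sigma>. \<sigma> \<in> R \<Longrightarrow> finite (A \<sigma>)" "\<And>\<sigma>. \<sigma> \<in> R \<Longrightarrow> A \<sigma> \<subseteq> W" "\<And>\<sigma>. \<sigma> \<in> R \<Longrightarrow> \<sigma> = hcone (A \<sigma>)"
    by blast+
  have Av: "0 \<le> a \<bullet> x" if "\<sigma> \<in> R" "a \<in> A \<sigma>" "x \<in> \<sigma>" for \<sigma> a x
    using A(3)[OF that(1)] that(2,3) unfolding hcone_def by blast
  have T: "tangent v \<sigma> = hcone {a \<in> A \<sigma>. a \<bullet> v = 0}" if "\<sigma> \<in> R" for \<sigma>
    using tangent_hcone[OF A(1)[OF that], of v] R(2)[OF that] A(3)[OF that] by simp
  \<comment> \<open>A penalty vanishing exactly on one tangent cone, obtained by regarding the faces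
    of that cone as a subfan of \<open>\<Delta>\<close>.\<close>
  have "\<exists>d. conewise_concave W \<Delta> d \<and> (\<forall>x\<in>tangent v \<sigma>. d x = 0) \<and> (\<forall>x. 0 \<le> d x) \<and>
      (\<forall>x. d x = 0 \<longrightarrow> x \<in> tangent v \<sigma>)" if \<sigma>: "\<sigma> \<in> R" for \<sigma>
  proof -
    let ?T = "tangent v \<sigma>"
    let ?F = "{F. F face_of ?T \<and> F \<noteq> {}}"
    have wT: "wcone W ?T" using wfanD(3)[OF \<Delta>(1) R(3)[OF \<sigma>]] .
    have TF: "?T \<in> ?F" using face_of_refl[OF wcone_convex[OF wT]] wcone_0[OF wT] by blast
    have UF: "\<Union>?F = ?T" using TF face_of_imp_subset by blast
    have "\<exists>h. conewise_concave W \<Delta> h \<and> (\<forall>x\<in>\<Union>?F. h x = 0) \<and> (\<forall>x\<in>\<Union>\<Delta>. 0 \<le> h x) \<and>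
        (\<forall>x\<in>\<Union>\<Delta> - \<Union>?F. 0 < h x)"
    proof (rule conewise_concave_vanishing_on_subfan[OF \<Delta>(1)])
      show "?F \<subseteq> \<Delta>" using wfanD(4)[OF \<Delta>(1) R(3)[OF \<sigma>]] by blast
      show "?F \<noteq> {}" using TF by blast
      show "G \<in> ?F" if "F \<in> ?F" "G face_of F" "G \<noteq> {}" for F G using that face_of_trans by blast
    qed
    then obtain h where h: "conewise_concave W \<Delta> h" "\<forall>x\<in>?T. h x = 0" "\<forall>x. 0 \<le> h x" "\<forall>x\<in>UNIV - ?T. 0 < h x"
      unfolding UF U by blast
    then have "\<forall>x. h x = 0 \<longrightarrow> x \<in> ?T" by (metis DiffI UNIV_I less_irrefl)
    then show ?thesis using h by blast
  qed
  then have "\<forall>\<sigma>\<in>R. \<exists>d. conewise_concave W \<Delta> d \<and> (\<forall>x\<in>tangent v \<sigma>. d x = 0) \<and> (\<forall>x. 0 \<le> d x) \<and>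
      (\<forall>x. d x = 0 \<longrightarrow> x \<in> tangent v \<sigma>)" by blast
  from bchoice[OF this] obtain d where "\<forall>\<sigma>\<in>R. conewise_concave W \<Delta> (d \<sigma>) \<and>
      (\<forall>x\<in>tangent v \<sigma>. d \<sigma> x = 0) \<and> (\<forall>x. 0 \<le> d \<sigma> x) \<and> (\<forall>x. d \<sigma> x = 0 \<longrightarrow> x \<in> tangent v \<sigma>)" ..
  then have d: "\<And>\<sigma>. \<sigma> \<in> R \<Longrightarrow> conewise_concave W \<Delta> (d \<sigma>)"
    "\<And>\<sigma> x. \<sigma> \<in> R \<Longrightarrow> x \<in> tangent v \<sigma> \<Longrightarrow> d \<sigma> x = 0" "\<And>\<sigma> x. \<sigma> \<in> R \<Longrightarrow> 0 \<le> d \<sigma> x"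
    "\<And>\<sigma> x. \<sigma> \<in> R \<Longrightarrow> d \<sigma> x = 0 \<Longrightarrow> x \<in> tangent v \<sigma>" by blast+
  \<comment> \<open>For small \<open>e\<close> the point \<open>e *\<^sub>R x + v\<close> lies in
    both cones, and the face \<open>\<sigma> \<inter> \<sigma>0\<close> of \<open>\<sigma>0\<close>
    contains its summands.\<close>
  have meet: "x \<in> \<sigma>" if mt: "\<sigma> \<in> R" "\<sigma>0 \<in> R" "x \<in> \<sigma>0" "x \<in> tangent v \<sigma>" for \<sigma> \<sigma>0 x
  proof -
    obtain e where e: "e > 0" "v + e *\<^sub>R x \<in> \<sigma>" using mt(4) by (auto simp: tangent_def)
    have ex: "e *\<^sub>R x \<in> \<sigma>0" using wcone_scaleR[OF R(4)[OF mt(2)] mt(3)] e(1) by simp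
    have "e *\<^sub>R x + v \<in> \<sigma> \<inter> \<sigma>0"
      using wcone_add[OF R(4)[OF mt(2)] ex R(2)[OF mt(2)]] e(2) by (simp add: add.commute)
    note f = wfanD(6)[OF \<Sigma> R(1)[OF mt(1)] R(1)[OF mt(2)]]
    have "e *\<^sub>R x \<in> \<sigma> \<inter> \<sigma>0"
      by (rule face_of_cone_summand[OF wcone_convex_cone[OF R(4)[OF mt(2)]] f ex R(2)[OF mt(2)]]) fact
    then have "x \<in> \<sigma> \<inter> \<sigma>0"
      by (rule face_of_cone_scaleR[OF wcone_convex_cone[OF R(4)[OF mt(2)]] f mt(3) e(1)])
    then show ?thesis by blast
  qed
  have "\<forall>\<^sub>F k in sequentially. \<forall>x\<in>\<sigma>0. 0 \<le> a \<bullet> x + real k * d \<sigma> x"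
    if *: "\<sigma> \<in> R" "a \<in> A \<sigma>" "\<sigma>0 \<in> R" for \<sigma> a \<sigma>0
  proof (rule wcone_penalty[OF R(4)[OF *(3)] piecewise_linear_on_linear pl[OF d(1)[OF *(1)]]])
    show "0 \<le> d \<sigma> x" for x by (rule d(3)[OF *(1)])
    show "0 \<le> a \<bullet> x" if "x \<in> \<sigma>0" "d \<sigma> x = 0" for x
      using Av[OF *(1,2)] meet[OF *(1,3) that(1) d(4)[OF *(1) that(2)]] by blast
  qed
  then have "\<forall>\<^sub>F k in sequentially. \<forall>\<sigma>\<in>R. \<forall>a\<in>A \<sigma>. \<forall>\<sigma>0\<in>R. \<forall>x\<in>\<sigma>0. 0 \<le> a \<bullet> x + real k * d \<sigma> x"
    using finR A(1) by (simp add: eventually_ball_finite)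
  then obtain k where k: "\<And>\<sigma> a \<sigma>0 x. \<sigma> \<in> R \<Longrightarrow> a \<in> A \<sigma> \<Longrightarrow> \<sigma>0 \<in> R \<Longrightarrow> x \<in> \<sigma>0 \<Longrightarrow> 0 \<le> a \<bullet> x + real k * d \<sigma> x"
    using eventually_happens[of _ sequentially] by fastforce
  \<comment> \<open>Only inequalities strict at \<open>v\<close> are collected; those tight at
    \<open>v\<close> already hold on the tangent cone.\<close>
  define I where "I = (SIGMA \<sigma>:R. {a \<in> A \<sigma>. 0 < a \<bullet> v})"
  have finI: "finite I" using finR A(1) by (auto simp: I_def)
  have Ine: "I \<noteq> {}"
  proof -
    obtain a where a: "a \<in> A \<rho>" "\<not> 0 \<le> a \<bullet> (- v)" using A(3)[OF \<rho>R] \<rho>(3) unfolding hcone_def by blast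
    then have "(\<rho>, a) \<in> I" using \<rho>R by (simp add: I_def)
    then show ?thesis by blast
  qed
  define f where "f i x = snd i \<bullet> x + real k * d (fst i) x" for i x
  \<comment> \<open>The penalty \<open>d \<sigma>\<close> switches off the inequalities of \<open>\<sigma>\<close> away from its tangent cone, so
    \<open>\<xi> \<ge> 0\<close> cuts every tangent cone back to the original cone.\<close>
  define \<xi> where "\<xi> x = Min ((\<lambda>i. f i x) ` I)" for x
  have \<xi>cc: "conewise_concave W \<Delta> \<xi>"
    unfolding \<xi>_def
  proof (rule conewise_concave_Min[OF finI Ine])
    fix i assume "i \<in> I"
    then have "fst i \<in> R" "snd i \<in> W" using A(2) by (fastforce simp: I_def)+
    then show "conewise_concave W \<Delta> (f i)"
      unfolding f_def by (intro conewise_concave_add conewise_concave_linear conewise_concave_scale d(1))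
  qed
  have \<xi>_le: "\<xi> x \<le> a \<bullet> x + real k * d \<sigma> x" if "\<sigma> \<in> R" "a \<in> A \<sigma>" "0 < a \<bullet> v" for \<sigma> a x
  proof -
    have "(\<sigma>, a) \<in> I" using that by (simp add: I_def)
    then have "\<xi> x \<le> f (\<sigma>, a) x" unfolding \<xi>_def using finI by (intro Min_le) auto
    then show ?thesis by (simp add: f_def)
  qed
  have \<xi>_att: "\<exists>\<sigma>\<in>R. \<exists>a\<in>A \<sigma>. 0 < a \<bullet> v \<and> \<xi> x = a \<bullet> x + real k * d \<sigma> x" for x
  proof -
    have "\<xi> x \<in> (\<lambda>i. f i x) ` I" unfolding \<xi>_def using finI Ine by (intro Min_in) auto
    then obtain i where "i \<in> I" "\<xi> x = f i x" by blast
    then show ?thesis by (intro bexI[of _ "fst i"] bexI[of _ "snd i"]) (auto simp: I_def f_def)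
  qed
  have \<xi>1: "0 \<le> \<xi> x" if x: "\<sigma>0 \<in> R" "x \<in> \<sigma>0" for \<sigma>0 x
  proof -
    obtain \<sigma> a where "\<sigma> \<in> R" "a \<in> A \<sigma>" "\<xi> x = a \<bullet> x + real k * d \<sigma> x" using \<xi>_att by blast
    then show ?thesis using k[OF _ _ x] by simp
  qed
  have \<xi>2: "x \<in> \<sigma>" if *: "\<sigma> \<in> R" "x \<in> tangent v \<sigma>" "0 \<le> \<xi> x" for \<sigma> x
  proof -
    have "0 \<le> a \<bullet> x" if a: "a \<in> A \<sigma>" for a
    proof (cases "a \<bullet> v = 0")
      case True
      then show ?thesis using T[OF *(1)] *(2) a by (simp add: hcone_def)
    next
      case False
      then have "0 < a \<bullet> v" using Av[OF *(1) a R(2)[OF *(1)]] by simp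
      then show ?thesis using \<xi>_le[OF *(1) a, of x] d(2)[OF *(1,2)] *(3) by simp
    qed
    then have "x \<in> hcone (A \<sigma>)" by (simp add: hcone_def)
    then show ?thesis using A(3)[OF *(1)] by simp
  qed
  \<comment> \<open>An inequality strict at \<open>v\<close> is strict on the whole relative
    interior of \<open>\<rho>\<close>. This strictness provides the open neighbourhood at the
    end.\<close>
  have \<xi>3: "0 < \<xi> x" if x: "x \<in> rel_interior \<rho>" for x
  proof -
    obtain \<sigma> a where *: "\<sigma> \<in> R" "a \<in> A \<sigma>" "0 < a \<bullet> v" "\<xi> x = a \<bullet> x + real k * d \<sigma> x" using \<xi>_att by blast
    have "\<rho> face_of \<sigma>" by (rule wfan_face_of[OF \<Sigma> \<rho>(1) R(1)[OF *(1)] \<rho>(2) R(2)[OF *(1)]])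
    then have sub: "\<rho> \<subseteq> \<sigma>" by (rule face_of_imp_subset)
    have "a \<bullet> x \<noteq> 0"
    proof
      assume "a \<bullet> x = 0"
      then have "a \<bullet> v = 0"
        using linear_zero_on_rel_interior[OF wcone_convex[OF R(4)[OF \<rho>R]] x _ _ v\<rho>, of a] Av[OF *(1,2)] sub by blast
      then show False using *(3) by simp
    qed
    moreover have "0 \<le> a \<bullet> x" using Av[OF *(1,2)] sub x rel_interior_subset by blast
    moreover have "0 \<le> real k * d \<sigma> x" using d(3)[OF *(1)] by simp
    ultimately show ?thesis using *(4) by linarith
  qed
  \<comment> \<open>If \<open>\<xi> x\<close> were positive, the inequalities of
    \<open>\<sigma>\<close> strict at \<open>v\<close> would be strict at \<open>x\<close>, so a
    small multiple of \<open>v\<close> could be subtracted from \<open>x\<close> inside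
    \<open>\<sigma>\<close>. Being then a summand of a point of the face
    \<open>\<sigma> \<inter> \<tau>\<close>, after scaling, \<open>v\<close> would lie in
    \<open>\<tau>\<close>.\<close>
  have \<xi>4: "\<xi> x \<le> 0" if *: "\<tau> \<in> \<Sigma>" "v \<notin> \<tau>" "x \<in> \<tau>" "\<Psi> x = 0" for \<tau> x
  proof (rule ccontr)
    assume neg: "\<not> \<xi> x \<le> 0"
    obtain \<sigma> where \<sigma>: "\<sigma> \<in> R" "x \<in> tangent v \<sigma>" using *(4) \<Psi>(2) star_eq by blast
    then have x\<sigma>: "x \<in> \<sigma>" using \<xi>2 neg by auto
    have "\<forall>\<^sub>F e in at_right 0. x + e *\<^sub>R (- v) \<in> hcone (A \<sigma>)"
    proof (rule hcone_feasible_direction[OF A(1)[OF \<sigma>(1)]])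
      show "x \<in> hcone (A \<sigma>)" using x\<sigma> A(3)[OF \<sigma>(1)] by simp
      show "0 \<le> a \<bullet> (- v)" if a: "a \<in> A \<sigma>" "a \<bullet> x = 0" for a
      proof -
        have "\<not> 0 < a \<bullet> v" using \<xi>_le[OF \<sigma>(1) a(1), of x] a(2) d(2)[OF \<sigma>] neg by auto
        then show ?thesis by simp
      qed
    qed
    then obtain e where e: "e > 0" "x + e *\<^sub>R (- v) \<in> hcone (A \<sigma>)" by (rule eventually_at_right_0_obtain)
    have w: "convex_cone \<sigma>" by (rule wcone_convex_cone[OF R(4)[OF \<sigma>(1)]])
    note fc = wfanD(5)[OF \<Sigma> R(1)[OF \<sigma>(1)] *(1)]
    have ev: "e *\<^sub>R v \<in> \<sigma>" using convex_cone_scaleR[OF w _ R(2)[OF \<sigma>(1)]] e(1) by simp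
    have "e *\<^sub>R v \<in> \<sigma> \<inter> \<tau>"
    proof (rule face_of_cone_summand[OF w fc ev])
      show "x + e *\<^sub>R (- v) \<in> \<sigma>" using e(2) A(3)[OF \<sigma>(1)] by simp
      show "e *\<^sub>R v + (x + e *\<^sub>R (- v)) \<in> \<sigma> \<inter> \<tau>" using x\<sigma> *(3) by simp
    qed
    then have "v \<in> \<sigma> \<inter> \<tau>" by (rule face_of_cone_scaleR[OF w fc R(2)[OF \<sigma>(1)] e(1)])
    then show False using *(2) by blast
  qed
  have pl\<xi>: "piecewise_linear_on c (\<lambda>x. - \<xi> x)" for c
    by (rule piecewise_linear_on_uminus[OF pl[OF \<xi>cc]])
  have "\<forall>\<^sub>F k in sequentially. \<forall>x\<in>\<tau>. 0 \<le> - \<xi> x + real k * \<Psi> x" if "\<tau> \<in> \<Sigma>" "v \<notin> \<tau>" for \<tau>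
    by (rule wcone_penalty[OF wfanD(3)[OF \<Sigma> that(1)] pl\<xi> pl[OF conewise_linear_imp_concave[OF \<Delta>(4)]] \<Psi>(1)])
      (use \<xi>4[OF that] in auto)
  then have "\<forall>\<^sub>F k in sequentially. \<forall>\<tau>\<in>{\<tau>\<in>\<Sigma>. v \<notin> \<tau>}. \<forall>x\<in>\<tau>. 0 \<le> - \<xi> x + real k * \<Psi> x"
    using wfanD(1)[OF \<Sigma>] by (intro eventually_ball_finite) auto
  then obtain m where m: "\<And>\<tau> x. \<tau> \<in> \<Sigma> \<Longrightarrow> v \<notin> \<tau> \<Longrightarrow> x \<in> \<tau> \<Longrightarrow> 0 \<le> - \<xi> x + real m * \<Psi> x"
    using eventually_happens[of _ sequentially] by fastforce
  \<comment> \<open>\<open>m\<close> is so large that \<open>\<theta> \<ge> 0\<close> meets cones of \<open>\<Sigma>\<close> only inside the star.\<close>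
  define \<theta> where "\<theta> x = \<xi> x + real (Suc m) * (- \<Psi> x)" for x
  have \<theta>cc: "conewise_concave W \<Delta> \<theta>"
    unfolding \<theta>_def by (intro conewise_concave_add conewise_concave_scale \<xi>cc
        conewise_linear_imp_concave conewise_linear_uminus \<Delta>(4))
  have \<Psi>T: "\<Psi> x = 0" if "\<sigma> \<in> R" "x \<in> tangent v \<sigma>" for \<sigma> x using that \<Psi>(2) star_eq by blast
  define Q where "Q = {x. 0 \<le> \<theta> x}"
  define D where "D = {F. F \<noteq> {} \<and> (\<exists>\<kappa>\<in>\<Delta>. F face_of \<kappa> \<inter> Q)}"
  have wQ: "wcone W (\<kappa> \<inter> Q)" if "\<kappa> \<in> \<Delta>" for \<kappa>
    unfolding Q_def using wcone_superlevel[OF wfanD(3)[OF \<Delta>(1) that]] \<theta>cc that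
    by (simp add: conewise_concave_def)
  have D: "wfan W D" unfolding D_def by (rule wfan_cut[OF \<Delta>(1) wQ])
  have QT: "tangent v \<sigma> \<inter> Q = \<sigma>" if \<sigma>: "\<sigma> \<in> R" for \<sigma>
  proof (intro subset_antisym subsetI)
    fix x assume x: "x \<in> tangent v \<sigma> \<inter> Q"
    then have "\<Psi> x = 0" using \<Psi>T[OF \<sigma>] by blast
    then have "0 \<le> \<xi> x" using x by (simp add: Q_def \<theta>_def)
    then show "x \<in> \<sigma>" using \<xi>2[OF \<sigma>] x by blast
  next
    fix x assume x: "x \<in> \<sigma>"
    then have xT: "x \<in> tangent v \<sigma>" using R(5)[OF \<sigma>] by blast
    then show "x \<in> tangent v \<sigma> \<inter> Q" using \<xi>1[OF \<sigma> x] \<Psi>T[OF \<sigma> xT] by (simp add: Q_def \<theta>_def)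
  qed
  have narrow: "\<exists>\<sigma>\<in>R. x \<in> tangent v \<sigma>" if *: "\<tau> \<in> \<Sigma>" "x \<in> \<tau>" "x \<in> Q" for \<tau> x
  proof (cases "v \<in> \<tau>")
    case True
    then have "\<tau> \<in> R" using *(1) by (simp add: R_def)
    then show ?thesis using R(5) *(2) by blast
  next
    case False
    have "0 \<le> \<theta> x" using *(3) by (simp add: Q_def)
    \<comment> \<open>The \<open>Suc\<close> in \<open>\<theta>\<close> leaves one spare copy of
      \<open>\<Psi>\<close>: adding \<open>0 \<le> \<theta> x\<close> to the bound from
      \<open>m\<close> leaves \<open>0 \<le> - \<Psi> x\<close>.\<close>
    then have "\<Psi> x \<le> 0" using m[OF *(1) False *(2)] by (simp add: \<theta>_def algebra_simps)
    then have "\<Psi> x = 0" using \<Psi>(1) by (simp add: order_antisym)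
    then show ?thesis using \<Psi>(2) star_eq by blast
  qed
  \<comment> \<open>Since \<open>tangent v \<sigma>\<close> is itself a cone of
    \<open>\<Delta>\<close>, \<open>g\<close> is a face of
    \<open>tangent v \<sigma> \<inter> Q\<close>, which is \<open>\<sigma>\<close>; so
    \<open>g\<close> already belongs to \<open>\<Sigma>\<close>.\<close>
  have mixed: "g = \<tau>" if *: "\<tau> \<in> \<Sigma>" "g \<in> D" "x \<in> rel_interior \<tau>" "x \<in> rel_interior g" for \<tau> g x
  proof -
    obtain \<kappa> where \<kappa>: "\<kappa> \<in> \<Delta>" "g face_of \<kappa> \<inter> Q" "g \<noteq> {}" using *(2) by (auto simp: D_def)
    have x: "x \<in> \<tau>" "x \<in> g" using *(3,4) rel_interior_subset by blast+
    have g: "g \<subseteq> \<kappa> \<inter> Q" by (rule face_of_imp_subset[OF \<kappa>(2)])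
    obtain \<sigma> where \<sigma>: "\<sigma> \<in> R" "x \<in> tangent v \<sigma>" using narrow[OF *(1) x(1)] g x(2) by blast
    have gs: "g \<subseteq> \<kappa> \<inter> tangent v \<sigma>"
      by (rule subset_of_face_of[OF wfanD(5)[OF \<Delta>(1) \<kappa>(1) R(3)[OF \<sigma>(1)]]]) (use g x(2) \<sigma>(2) *(4) in blast)+
    have "g face_of \<kappa> \<inter> tangent v \<sigma> \<inter> Q" by (rule face_of_subset[OF \<kappa>(2)]) (use gs g in blast)+
    moreover have "\<kappa> \<inter> tangent v \<sigma> \<inter> Q face_of tangent v \<sigma> \<inter> Q"
    proof -
      have "\<kappa> \<inter> tangent v \<sigma> \<inter> (tangent v \<sigma> \<inter> Q) face_of tangent v \<sigma> \<inter> (tangent v \<sigma> \<inter> Q)"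
        by (rule face_of_slice[OF wfanD(6)[OF \<Delta>(1) \<kappa>(1) R(3)[OF \<sigma>(1)]] wcone_convex[OF wQ[OF R(3)[OF \<sigma>(1)]]]])
      then show ?thesis by (simp add: Int_ac)
    qed
    ultimately have "g face_of \<sigma>" using face_of_trans QT[OF \<sigma>(1)] by metis
    then have "g \<in> \<Sigma>" using wfanD(4)[OF \<Sigma> R(1)[OF \<sigma>(1)]] \<kappa>(3) by blast
    then show ?thesis using wfan_relint_unique[OF \<Sigma>] *(1,3,4) by blast
  qed
  have "wfan W (\<Sigma> \<union> D)"
  proof (rule wfanI)
    show "finite (\<Sigma> \<union> D)" "\<Sigma> \<union> D \<noteq> {}" using wfanD(1,2)[OF \<Sigma>] wfanD(1)[OF D] by auto
    show "wcone W \<kappa>" if "\<kappa> \<in> \<Sigma> \<union> D" for \<kappa> using that wfanD(3)[OF \<Sigma>] wfanD(3)[OF D] by blast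
    show "F \<in> \<Sigma> \<union> D" if "\<kappa> \<in> \<Sigma> \<union> D" "F face_of \<kappa>" "F \<noteq> {}" for \<kappa> F
      using that wfanD(4)[OF \<Sigma>] wfanD(4)[OF D] by blast
    show "\<kappa> = \<mu>" if "\<kappa> \<in> \<Sigma> \<union> D" "\<mu> \<in> \<Sigma> \<union> D" "x \<in> rel_interior \<kappa>" "x \<in> rel_interior \<mu>" for \<kappa> \<mu> x
      using that wfan_relint_unique[OF \<Sigma>] wfan_relint_unique[OF D] mixed by blast
  qed
  moreover have "rel_interior \<rho> \<subseteq> interior (\<Union>(\<Sigma> \<union> D))"
  proof (rule interior_maximal[THEN subset_trans[rotated]])
    show "rel_interior \<rho> \<subseteq> {x. 0 < \<theta> x}"
    proof
      fix x assume x: "x \<in> rel_interior \<rho>"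
      then have "x \<in> tangent v \<rho>" using rel_interior_subset R(5)[OF \<rho>R] by blast
      then have "\<Psi> x = 0" by (rule \<Psi>T[OF \<rho>R])
      then show "x \<in> {x. 0 < \<theta> x}" using \<xi>3[OF x] by (simp add: \<theta>_def)
    qed
    have "continuous_on UNIV \<theta>" by (rule piecewise_linear_on_continuous[OF pl[OF \<theta>cc]])
    then show "open {x. 0 < \<theta> x}" by (intro open_Collect_less continuous_on_const)
    show "{x. 0 < \<theta> x} \<subseteq> \<Union>(\<Sigma> \<union> D)"
    proof
      fix x assume "x \<in> {x. 0 < \<theta> x}"
      then have xQ: "x \<in> Q" by (simp add: Q_def)
      obtain \<kappa> where \<kappa>: "\<kappa> \<in> \<Delta>" "x \<in> \<kappa>" using U by blast
      then have "\<kappa> \<inter> Q \<in> D" using face_of_refl[OF wcone_convex[OF wQ[OF \<kappa>(1)]]] xQ by (auto simp: D_def)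
      then show "x \<in> \<Union>(\<Sigma> \<union> D)" using \<kappa>(2) xQ by blast
    qed
  qed
  ultimately show ?thesis by blast
qed

end

section \<open>Completion of a fan that is thick off its lineality space\<close>

lemma face_of_subspace:
  fixes L :: "'b::euclidean_space set"
  assumes "subspace L" "F face_of L" "F \<noteq> {}"
  shows "F = L"
proof -
  have c: "convex_cone L" by (rule subspace_imp_convex_cone[OF assms(1)])
  have 0: "0 \<in> F" using face_of_cone_convex_cone[OF c assms(2,3)] convex_cone_contains_0 by blast
  have "x \<in> F" if "x \<in> L" for x
    by (rule face_of_cone_summand[OF c assms(2) that, of "- x"]) (use that 0 assms(1) subspace_neg in auto)
  then show ?thesis using face_of_imp_subset[OF assms(2)] by blast
qed

definition one_signed :: "'b::euclidean_space \<Rightarrow> 'b set \<Rightarrow> bool" where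
  "one_signed a c \<longleftrightarrow> (\<forall>x\<in>c. 0 \<le> a \<bullet> x) \<or> (\<forall>x\<in>c. a \<bullet> x \<le> 0)"

text \<open>If instead \<open>a\<close> is nonpositive on \<open>c\<close>, its nonnegative value at
  a relative interior point makes it vanish on \<open>c\<close>.\<close>

lemma one_signed_nonneg:
  assumes "convex c" "one_signed a c" "y \<in> rel_interior c" "0 \<le> a \<bullet> y" "x \<in> c"
  shows "0 \<le> a \<bullet> x"
proof (cases "\<forall>x\<in>c. 0 \<le> a \<bullet> x")
  case False
  then have np: "a \<bullet> x \<le> 0" if "x \<in> c" for x using assms(2) that unfolding one_signed_def by blast
  have "y \<in> c" using assms(3) rel_interior_subset by blast
  then have "a \<bullet> y = 0" using np assms(4) by (simp add: order_antisym)
  then have "(- a) \<bullet> x = 0"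
    using linear_zero_on_rel_interior[OF assms(1,3) _ _ assms(5), of "- a"] np by simp
  then show ?thesis by simp
qed (use assms in blast)

text \<open>For two points strictly on opposite sides of the hyperplane of \<open>a\<close>, the
  value of \<open>min 0 (a \<bullet> x)\<close> at their sum exceeds the sum of the values.\<close>

lemma one_signed_if_min_linear:
  assumes "convex_cone c" "\<And>x. x \<in> c \<Longrightarrow> min 0 (a \<bullet> x) = l \<bullet> x"
  shows "one_signed a c"
proof (rule ccontr)
  assume "\<not> one_signed a c"
  then obtain x y where xy: "x \<in> c" "a \<bullet> x < 0" "y \<in> c" "0 < a \<bullet> y"
    unfolding one_signed_def by (meson not_le)
  then have "x + y \<in> c" using convex_cone_add[OF assms(1)] by blast
  then have "min 0 (a \<bullet> x + a \<bullet> y) = min 0 (a \<bullet> x) + min 0 (a \<bullet> y)"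
    using assms(2)[of "x + y"] assms(2)[OF xy(1)] assms(2)[OF xy(3)] by (simp add: inner_simps)
  then show False using xy(2,4) by (auto simp: min_def split: if_splits)
qed

lemma one_signed_uminus: "one_signed (- a) c \<longleftrightarrow> one_signed a c"
  by (auto simp: one_signed_def)

context functional_group
begin

lemma wfan_UNIV: "wfan W {UNIV}"
proof (rule wfanI)
  show "wcone W \<kappa>" if "\<kappa> \<in> {UNIV}" for \<kappa>
    using that unfolding wcone_def by (intro exI[of _ "{}"]) (auto simp: hcone_def)
  show "F \<in> {UNIV}" if "\<kappa> \<in> {UNIV}" "F face_of \<kappa>" "F \<noteq> {}" for \<kappa> F :: "'b set"
    using face_of_subspace[of UNIV F] that by simp
qed auto

text \<open>The cells of a hyperplane arrangement are the linearity domains of the functions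
  \<open>min 0 (a \<bullet> x)\<close> on the fan \<open>{UNIV}\<close>.\<close>

lemma arrangement:
  assumes "finite A" "A \<subseteq> W"
  obtains B where "wfan W B" "\<Union>B = UNIV" "\<And>\<beta> a. \<beta> \<in> B \<Longrightarrow> a \<in> A \<Longrightarrow> one_signed a \<beta>"
    "\<And>U. convex U \<Longrightarrow> U \<noteq> {} \<Longrightarrow> (\<And>a. a \<in> A \<Longrightarrow> one_signed a U) \<Longrightarrow> \<exists>\<beta>\<in>B. U \<subseteq> \<beta>"
proof -
  let ?H = "(\<lambda>a x. min 0 (a \<bullet> x)) ` A"
  have H: "\<forall>h\<in>?H. conewise_concave W {UNIV} h"
    using assms(2) by (auto intro!: conewise_concave_min conewise_concave_zero conewise_concave_linear)
  from linearity_refinement_finite[OF wfan_UNIV finite_imageI[OF assms(1)] H]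
  obtain B where B: "wfan W B" "refinement_of B {UNIV}" "\<forall>h\<in>?H. conewise_linear W B h"
    "\<forall>U \<kappa>. convex U \<longrightarrow> U \<noteq> {} \<longrightarrow> \<kappa> \<in> {UNIV} \<longrightarrow> U \<subseteq> \<kappa> \<longrightarrow> (\<forall>h\<in>?H. \<exists>l. \<forall>x\<in>U. h x = l \<bullet> x) \<longrightarrow>
      (\<exists>\<kappa>'\<in>B. U \<subseteq> \<kappa>')"
    by (elim exE conjE)
  show ?thesis
  proof (rule that[OF B(1)])
    show "\<Union>B = UNIV" using refinement_of_Union[OF B(2)] by simp
    show "one_signed a \<beta>" if \<beta>: "\<beta> \<in> B" "a \<in> A" for \<beta> a
    proof -
      have "conewise_linear W B (\<lambda>x. min 0 (a \<bullet> x))" using B(3) \<beta>(2) by blast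
      then obtain l where "\<forall>x\<in>\<beta>. min 0 (a \<bullet> x) = l \<bullet> x" using \<beta>(1) unfolding conewise_linear_def by blast
      then show ?thesis
        by (intro one_signed_if_min_linear[of _ _ l] wcone_convex_cone[OF wfanD(3)[OF B(1) \<beta>(1)]]) auto
    qed
    show "\<exists>\<beta>\<in>B. U \<subseteq> \<beta>" if U: "convex U" "U \<noteq> {}" "\<And>a. a \<in> A \<Longrightarrow> one_signed a U" for U
    proof -
      have "\<exists>l. \<forall>x\<in>U. min 0 (a \<bullet> x) = l \<bullet> x" if "a \<in> A" for a
        using U(3)[OF that] unfolding one_signed_def
      proof
        assume "\<forall>x\<in>U. 0 \<le> a \<bullet> x"
        then show ?thesis by (intro exI[of _ 0]) auto
      next
        assume "\<forall>x\<in>U. a \<bullet> x \<le> 0"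
        then show ?thesis by (intro exI[of _ a]) auto
      qed
      then show ?thesis using B(4) U(1,2) by simp
    qed
  qed
qed

text \<open>\<open>\<Union>N\<close> may fail to be a neighbourhood of \<open>L\<close>, so the thin
  neighbourhood of \<open>\<Sigma>\<close> has to pinch along \<open>L\<close>. Its width is
  governed by \<open>\<eta>\<close>, which is zero on \<open>L\<close> and positive elsewhere on
  \<open>\<Union>N\<close>.\<close>

lemma wfan_fill:
  assumes N: "wfan W N" and \<Sigma>: "wfan W \<Sigma>" "\<Sigma> \<subseteq> N" and L: "L \<in> \<Sigma>" "subspace L"
    and int: "\<Union>\<Sigma> - L \<subseteq> interior (\<Union>N)"
  shows "\<exists>\<Delta>. wfan W \<Delta> \<and> \<Sigma> \<subseteq> \<Delta> \<and> \<Union>\<Delta> = UNIV"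
proof -
  obtain N1 \<Psi> where N1: "wfan W N1" "refinement_of N1 N" "\<Sigma> \<subseteq> N1" "conewise_linear W N1 \<Psi>"
    and \<Psi>: "\<And>x. x \<in> \<Union>N1 \<Longrightarrow> 0 \<le> \<Psi> x" "\<And>x. x \<in> \<Union>N1 \<Longrightarrow> \<Psi> x = 0 \<longleftrightarrow> x \<in> \<Union>\<Sigma>"
    by (rule full_refinement[OF N \<Sigma>]) blast
  define X where "X = \<Union>N1"
  have XN: "X = \<Union>N" using refinement_of_Union[OF N1(2)] by (simp add: X_def)
  note \<Psi> = \<Psi>[folded X_def]
  have LN1: "L \<in> N1" using L(1) N1(3) by blast
  have L\<nu>: "L \<subseteq> \<nu>" if "\<nu> \<in> N1" for \<nu>
  proof -
    have "L \<inter> \<nu> \<noteq> {}" using wcone_0 wfanD(3)[OF N1(1)] that LN1 by blast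
    then have "L \<inter> \<nu> = L" by (rule face_of_subspace[OF L(2) wfanD(5)[OF N1(1) LN1 that]])
    then show ?thesis by blast
  qed
  have "\<exists>h. conewise_concave W N1 h \<and> (\<forall>x\<in>\<Union>{L}. h x = 0) \<and> (\<forall>x\<in>\<Union>N1. 0 \<le> h x) \<and> (\<forall>x\<in>\<Union>N1 - \<Union>{L}. 0 < h x)"
    by (rule conewise_concave_vanishing_on_subfan[OF N1(1)]) (use LN1 face_of_subspace[OF L(2)] in auto)
  then obtain \<eta> where \<eta>0: "conewise_concave W N1 \<eta>" "\<forall>x\<in>\<Union>{L}. \<eta> x = 0" "\<forall>x\<in>\<Union>N1. 0 \<le> \<eta> x"
    "\<forall>x\<in>\<Union>N1 - \<Union>{L}. 0 < \<eta> x"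
    by (elim exE conjE)
  have \<eta>: "\<eta> x = 0" if "x \<in> L" for x using \<eta>0(2) that by simp
  have \<eta>X: "0 \<le> \<eta> x" "\<eta> x = 0 \<Longrightarrow> x \<in> L" if "x \<in> X" for x using \<eta>0(3,4) that unfolding X_def by force+
  note \<eta> = \<eta>0(1) \<eta> \<eta>X
  have pl: "piecewise_linear_on c h" if "conewise_concave W N1 h" "c \<subseteq> X" for c h
    using conewise_concave_piecewise_linear[OF wfanD(1)[OF N1(1)] wfanD(3)[OF N1(1)] that(1)]
      piecewise_linear_on_subset that(2) X_def by blast
  have "\<forall>\<nu>\<in>N1. \<exists>A. finite A \<and> A \<subseteq> W \<and> \<nu> = hcone A" using wfanD(3)[OF N1(1)] by (simp add: wcone_def)
  from bchoice[OF this] obtain A where "\<forall>\<nu>\<in>N1. finite (A \<nu>) \<and> A \<nu> \<subseteq> W \<and> \<nu> = hcone (A \<nu>)" ..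
  then have A: "\<And>\<nu>. \<nu> \<in> N1 \<Longrightarrow> finite (A \<nu>)" "\<And>\<nu>. \<nu> \<in> N1 \<Longrightarrow> A \<nu> \<subseteq> W" "\<And>\<nu>. \<nu> \<in> N1 \<Longrightarrow> \<nu> = hcone (A \<nu>)"
    by blast+
  \<comment> \<open>No inequality of \<open>\<nu>\<close> changes sign on \<open>c\<close>, and all
    of them hold at a relative interior point of \<open>c\<close>.\<close>
  have in_\<nu>: "c \<subseteq> \<nu>"
    if *: "convex c" "\<nu> \<in> N1" "\<And>a. a \<in> A \<nu> \<Longrightarrow> one_signed a c" "y \<in> rel_interior c" "y \<in> \<nu>" for c \<nu> y
  proof
    fix x assume x: "x \<in> c"
    have "0 \<le> a \<bullet> x" if a: "a \<in> A \<nu>" for a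
    proof (rule one_signed_nonneg[OF *(1) *(3)[OF a] *(4) _ x])
      show "0 \<le> a \<bullet> y" using *(5) A(3)[OF *(2)] a unfolding hcone_def by blast
    qed
    then have "x \<in> hcone (A \<nu>)" by (simp add: hcone_def)
    then show "x \<in> \<nu>" using A(3)[OF *(2)] by simp
  qed
  \<comment> \<open>The first arrangement serves to cover the complement of \<open>X\<close> by
    finitely many cones, the \<open>bad\<close> ones, to which penalty estimates apply.\<close>
  define A1 where "A1 = (\<Union>\<nu>\<in>N1. A \<nu>)"
  have A1: "finite A1" "A1 \<subseteq> W" using A wfanD(1)[OF N1(1)] by (auto simp: A1_def)
  obtain B1 where B1: "wfan W B1" "\<Union>B1 = UNIV" "\<And>\<beta> a. \<beta> \<in> B1 \<Longrightarrow> a \<in> A1 \<Longrightarrow> one_signed a \<beta>"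
    by (rule arrangement[OF A1]) blast
  define bad where "bad = {\<beta> \<in> B1. \<not> \<beta> \<subseteq> X}"
  have finbad: "finite bad" using wfanD(1)[OF B1(1)] by (simp add: bad_def)
  have meets_relint: "\<exists>z\<in>E. z \<in> rel_interior c" if "convex c" "y \<in> c" "open E" "y \<in> E" for c E :: "'b set" and y
  proof -
    have "y \<in> closure (rel_interior c)" using convex_closure_rel_interior[OF that(1)] that(2) closure_subset by blast
    then show ?thesis using open_Int_closure_eq_empty[OF that(3), of "rel_interior c"] that(4) by blast
  qed
  \<comment> \<open>Otherwise the relative interior of \<open>\<beta>\<close> would enter some cone
    \<open>\<nu>\<close> near \<open>x\<close>, and a cell of the arrangement that does so lies in
    \<open>\<nu>\<close> entirely.\<close>
  have bad\<Sigma>: "x \<in> L" if *: "\<beta> \<in> bad" "x \<in> \<beta>" "x \<in> \<Union>\<Sigma>" for \<beta> x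
  proof (rule ccontr)
    assume "x \<notin> L"
    then have xi: "x \<in> interior X" using int *(3) XN by blast
    have \<beta>: "\<beta> \<in> B1" "\<not> \<beta> \<subseteq> X" using *(1) by (auto simp: bad_def)
    have c: "convex \<beta>" by (rule wcone_convex[OF wfanD(3)[OF B1(1) \<beta>(1)]])
    obtain z where z: "z \<in> interior X" "z \<in> rel_interior \<beta>" using meets_relint[OF c *(2) open_interior xi] by blast
    then obtain \<nu> where \<nu>: "\<nu> \<in> N1" "z \<in> \<nu>" using interior_subset unfolding X_def by blast
    have "\<beta> \<subseteq> \<nu>" by (rule in_\<nu>[OF c \<nu>(1) _ z(2) \<nu>(2)]) (use B1(3)[OF \<beta>(1)] \<nu>(1) A1_def in blast)
    then show False using \<beta>(2) \<nu>(1) X_def by blast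
  qed
  have "\<forall>\<^sub>F k in sequentially. \<forall>x\<in>\<beta> \<inter> \<nu>. 0 \<le> - \<eta> x + real k * \<Psi> x" if *: "\<beta> \<in> bad" "\<nu> \<in> N1" for \<beta> \<nu>
  proof (rule wcone_penalty)
    have sub: "\<beta> \<inter> \<nu> \<subseteq> X" using *(2) X_def by blast
    show "wcone W (\<beta> \<inter> \<nu>)" using wcone_Int wfanD(3)[OF B1(1)] wfanD(3)[OF N1(1)] * bad_def by blast
    show "piecewise_linear_on (\<beta> \<inter> \<nu>) (\<lambda>x. - \<eta> x)" by (rule piecewise_linear_on_uminus[OF pl[OF \<eta>(1) sub]])
    show "piecewise_linear_on (\<beta> \<inter> \<nu>) \<Psi>" by (rule pl[OF conewise_linear_imp_concave[OF N1(4)] sub])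
    show "0 \<le> \<Psi> x" if "x \<in> \<beta> \<inter> \<nu>" for x using \<Psi>(1) sub that by blast
    show "0 \<le> - \<eta> x" if "x \<in> \<beta> \<inter> \<nu>" "\<Psi> x = 0" for x
    proof -
      have "x \<in> \<Union>\<Sigma>" using \<Psi>(2) sub that by blast
      then have "x \<in> L" using bad\<Sigma>[OF *(1)] that(1) by blast
      then show ?thesis using \<eta>(2) by simp
    qed
  qed
  then have "\<forall>\<^sub>F k in sequentially. \<forall>\<beta>\<in>bad. \<forall>\<nu>\<in>N1. \<forall>x\<in>\<beta> \<inter> \<nu>. 0 \<le> - \<eta> x + real k * \<Psi> x"
    using wfanD(1)[OF N1(1)] finbad by (simp add: eventually_ball_finite)
  then obtain k where k: "\<And>\<beta> \<nu> x. \<beta> \<in> bad \<Longrightarrow> \<nu> \<in> N1 \<Longrightarrow> x \<in> \<beta> \<Longrightarrow> x \<in> \<nu> \<Longrightarrow> 0 \<le> - \<eta> x + real k * \<Psi> x"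
    using eventually_happens[of _ sequentially] by fastforce
  \<comment> \<open>\<open>k\<close> is so large that \<open>\<theta> \<ge> 0\<close> stays away from the boundary of \<open>X\<close>, except along \<open>L\<close>.\<close>
  define \<theta> where "\<theta> x = \<eta> x + real (Suc k) * (- \<Psi> x)" for x
  have \<theta>cc: "conewise_concave W N1 \<theta>"
    unfolding \<theta>_def by (intro conewise_concave_add conewise_concave_scale \<eta>(1)
        conewise_linear_imp_concave conewise_linear_uminus N1(4))
  have \<theta>\<Sigma>: "\<theta> x = \<eta> x" if "x \<in> \<Union>\<Sigma>" for x
  proof -
    have "x \<in> X" using that N1(3) X_def by blast
    then show ?thesis using \<Psi>(2) that by (simp add: \<theta>_def)
  qed
  have \<theta>L: "\<theta> x = 0" if "x \<in> L" for x using \<theta>\<Sigma>[of x] \<eta>(2)[OF that] that L(1) by auto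
  \<comment> \<open>The bad cones form a closed set covering the complement of \<open>X\<close>, so
    it suffices to avoid them. The spare copy of \<open>\<Psi>\<close> from \<open>Suc k\<close>
    forces \<open>\<Psi> y = 0\<close> on a bad cone, hence \<open>y \<in> L\<close>.\<close>
  have interior: "y \<in> interior X" if y: "y \<in> X" "y \<notin> L" "0 \<le> \<theta> y" for y
  proof -
    have "y \<notin> \<Union>bad"
    proof
      assume "y \<in> \<Union>bad"
      then obtain \<beta> where \<beta>: "\<beta> \<in> bad" "y \<in> \<beta>" by blast
      obtain \<nu> where \<nu>: "\<nu> \<in> N1" "y \<in> \<nu>" using y(1) X_def by blast
      have "\<Psi> y \<le> 0" using k[OF \<beta>(1) \<nu>(1) \<beta>(2) \<nu>(2)] y(3) by (simp add: \<theta>_def algebra_simps)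
      then have "\<Psi> y = 0" using \<Psi>(1)[OF y(1)] by simp
      then show False using \<Psi>(2)[OF y(1)] bad\<Sigma>[OF \<beta>] y(2) by blast
    qed
    moreover have "closure (- X) \<subseteq> \<Union>bad"
    proof (rule closure_minimal)
      show "- X \<subseteq> \<Union>bad"
      proof
        fix z assume z: "z \<in> - X"
        obtain \<beta> where "\<beta> \<in> B1" "z \<in> \<beta>" using B1(2) by blast
        then show "z \<in> \<Union>bad" using z by (auto simp: bad_def)
      qed
      show "closed (\<Union>bad)"
        using wfanD(1)[OF B1(1)] wcone_closed[OF wfanD(3)[OF B1(1)]] by (intro closed_Union) (auto simp: bad_def)
    qed
    ultimately show ?thesis using interior_closure[of X] by blast
  qed
  obtain M where M: "\<And>\<nu>. \<nu> \<in> N1 \<Longrightarrow> finite (M \<nu>)" "\<And>\<nu>. \<nu> \<in> N1 \<Longrightarrow> M \<nu> \<subseteq> W"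
    "\<And>\<nu> x a. \<nu> \<in> N1 \<Longrightarrow> x \<in> \<nu> \<Longrightarrow> a \<in> M \<nu> \<Longrightarrow> \<theta> x \<le> a \<bullet> x"
    "\<And>\<nu> x. \<nu> \<in> N1 \<Longrightarrow> x \<in> \<nu> \<Longrightarrow> \<exists>a\<in>M \<nu>. \<theta> x = a \<bullet> x"
    by (rule conewise_concaveE[OF \<theta>cc]) blast
  \<comment> \<open>With the functionals of \<open>\<theta>\<close> included, nonnegativity of
    \<open>\<theta>\<close> at one relative interior point of an arrangement cone spreads to the
    whole cone.\<close>
  define A2 where "A2 = A1 \<union> (\<Union>\<nu>\<in>N1. M \<nu>)"
  have A2: "finite A2" "A2 \<subseteq> W" using A1 M(1,2) wfanD(1)[OF N1(1)] by (auto simp: A2_def)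
  \<comment> \<open>Each functional is nonnegative on the subspace \<open>L\<close>, hence zero
    there. Only for this reason can a multiple of \<open>\<eta>\<close>, which vanishes on
    \<open>L\<close>, dominate it on \<open>\<Sigma>\<close>.\<close>
  have A2L: "a \<bullet> x = 0" if "a \<in> A2" "x \<in> L" for a x
  proof -
    have "0 \<le> a \<bullet> y" if y: "y \<in> L" for y
    proof -
      consider \<nu> where "\<nu> \<in> N1" "a \<in> A \<nu>" | \<nu> where "\<nu> \<in> N1" "a \<in> M \<nu>"
        using \<open>a \<in> A2\<close> unfolding A2_def A1_def by blast
      then show ?thesis
      proof cases
        case 1
        then show ?thesis using L\<nu>[OF 1(1)] A(3)[OF 1(1)] y unfolding hcone_def by blast
      next
        case 2
        then show ?thesis using M(3)[OF 2(1) _ 2(2), of y] L\<nu>[OF 2(1)] y \<theta>L[OF y] by auto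
      qed
    qed
    from this[of x] this[of "- x"] show ?thesis using that(2) subspace_neg[OF L(2)] by simp
  qed
  have "\<forall>\<^sub>F m in sequentially. \<forall>x\<in>\<sigma>. 0 \<le> (- a) \<bullet> x + real m * \<eta> x" if *: "a \<in> A2" "\<sigma> \<in> \<Sigma>" for a \<sigma>
  proof (rule wcone_penalty[OF wfanD(3)[OF \<Sigma>(1) *(2)] piecewise_linear_on_linear])
    have sub: "\<sigma> \<subseteq> X" using *(2) N1(3) X_def by blast
    show "piecewise_linear_on \<sigma> \<eta>" by (rule pl[OF \<eta>(1) sub])
    show "0 \<le> \<eta> x" if "x \<in> \<sigma>" for x using \<eta>(3) sub that by blast
    show "0 \<le> (- a) \<bullet> x" if "x \<in> \<sigma>" "\<eta> x = 0" for x
      using A2L[OF *(1)] \<eta>(4)[OF _ that(2)] sub that(1) by auto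
  qed
  then have "\<forall>\<^sub>F m in sequentially. \<forall>a\<in>A2. \<forall>\<sigma>\<in>\<Sigma>. \<forall>x\<in>\<sigma>. 0 \<le> (- a) \<bullet> x + real m * \<eta> x"
    using A2(1) wfanD(1)[OF \<Sigma>(1)] by (simp add: eventually_ball_finite)
  then obtain m where m: "\<And>a \<sigma> x. a \<in> A2 \<Longrightarrow> \<sigma> \<in> \<Sigma> \<Longrightarrow> x \<in> \<sigma> \<Longrightarrow> 0 \<le> (- a) \<bullet> x + real m * \<eta> x"
    using eventually_happens[of _ sequentially] by fastforce
  \<comment> \<open>\<open>g a\<close> vanishes on \<open>\<Sigma>\<close>, but where \<open>\<theta> = 0\<close> its linearity domains are the two sides of \<open>a\<close>.\<close>
  define g where "g a x = min 0 (real m * \<theta> x + (- a) \<bullet> x)" for a x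
  \<comment> \<open>Including \<open>min 0 (\<theta> x)\<close> prevents refined cells from crossing
    \<open>\<theta> = 0\<close>, so that \<open>P\<close> becomes a union of cells.\<close>
  let ?H = "insert (\<lambda>x. min 0 (\<theta> x)) (g ` A2)"
  have H: "\<forall>h\<in>?H. conewise_concave W N1 h"
  proof -
    have "conewise_concave W N1 (g a)" if "a \<in> A2" for a
    proof -
      have "- a \<in> W" using that A2(2) uminus_W by blast
      then show ?thesis unfolding g_def
        by (intro conewise_concave_min conewise_concave_zero conewise_concave_add conewise_concave_scale
            conewise_concave_linear \<theta>cc)
    qed
    moreover have "conewise_concave W N1 (\<lambda>x. min 0 (\<theta> x))"
      by (intro conewise_concave_min conewise_concave_zero \<theta>cc)
    ultimately show ?thesis by blast
  qed
  have "finite ?H" using A2(1) by simp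
  from linearity_refinement_finite[OF N1(1) this H] obtain N2 where N2: "wfan W N2" "refinement_of N2 N1" "\<forall>h\<in>?H. conewise_linear W N2 h"
    "\<forall>U \<kappa>. convex U \<longrightarrow> U \<noteq> {} \<longrightarrow> \<kappa> \<in> N1 \<longrightarrow> U \<subseteq> \<kappa> \<longrightarrow> (\<forall>h\<in>?H. \<exists>l. \<forall>x\<in>U. h x = l \<bullet> x) \<longrightarrow>
      (\<exists>\<kappa>'\<in>N2. U \<subseteq> \<kappa>')"
    by (elim exE conjE)
  have XN2: "\<Union>N2 = X" using refinement_of_Union[OF N2(2)] by (simp add: X_def)
  obtain B where B: "wfan W B" "\<Union>B = UNIV" "\<And>\<beta> a. \<beta> \<in> B \<Longrightarrow> a \<in> A2 \<Longrightarrow> one_signed a \<beta>"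
    "\<And>U. convex U \<Longrightarrow> U \<noteq> {} \<Longrightarrow> (\<And>a. a \<in> A2 \<Longrightarrow> one_signed a U) \<Longrightarrow> \<exists>\<beta>\<in>B. U \<subseteq> \<beta>"
    by (rule arrangement[OF A2]) blast
  define P where "P = {x \<in> X. 0 \<le> \<theta> x}"
  define C where "C = {c \<in> N2. c \<subseteq> P}"
  \<comment> \<open>Faces of cones that leave \<open>P\<close> are kept even when they lie inside
    \<open>P\<close>; along them the two halves meet.\<close>
  define E where "E = {F \<in> B. \<exists>\<beta>\<in>B. F \<subseteq> \<beta> \<and> \<not> \<beta> \<subseteq> P}"
  have cvxN2: "convex c" "convex_cone c" if "c \<in> N2" for c
    using wcone_convex wcone_convex_cone wfanD(3)[OF N2(1) that] by blast+
  have cvxB: "convex \<beta>" if "\<beta> \<in> B" for \<beta> by (rule wcone_convex[OF wfanD(3)[OF B(1) that]])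
  have B_in_\<nu>: "\<beta> \<subseteq> \<nu>" and B_\<theta>: "\<And>x. x \<in> \<beta> \<Longrightarrow> 0 \<le> \<theta> x"
    if *: "\<beta> \<in> B" "\<nu> \<in> N1" "y \<in> rel_interior \<beta>" "y \<in> \<nu>" "0 \<le> \<theta> y" for \<beta> \<nu> y
  proof -
    show 1: "\<beta> \<subseteq> \<nu>"
      by (rule in_\<nu>[OF cvxB[OF *(1)] *(2) _ *(3,4)]) (use B(3)[OF *(1)] *(2) in \<open>auto simp: A2_def A1_def\<close>)
    show "0 \<le> \<theta> x" if x: "x \<in> \<beta>" for x
    proof -
      obtain a where a: "a \<in> M \<nu>" "\<theta> x = a \<bullet> x" using M(4)[OF *(2)] 1 x by blast
      have "0 \<le> a \<bullet> y" using M(3)[OF *(2,4) a(1)] *(5) by simp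
      then have "0 \<le> a \<bullet> x"
        using one_signed_nonneg[OF cvxB[OF *(1)] B(3)[OF *(1)] *(3) _ x, of a] a(1) *(2) by (auto simp: A2_def)
      then show ?thesis using a(2) by simp
    qed
  qed
  have B_out: "z \<notin> P" if *: "\<beta> \<in> B" "\<not> \<beta> \<subseteq> P" "z \<in> rel_interior \<beta>" for \<beta> z
  proof
    assume z: "z \<in> P"
    then obtain \<nu> where \<nu>: "\<nu> \<in> N1" "z \<in> \<nu>" "0 \<le> \<theta> z" by (auto simp: P_def X_def)
    have "\<beta> \<subseteq> P" using B_in_\<nu>[OF *(1) \<nu>(1) *(3) \<nu>(2,3)] B_\<theta>[OF *(1) \<nu>(1) *(3) \<nu>(2,3)] \<nu>(1)
      unfolding P_def X_def by blast
    then show False using *(2) by blast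
  qed
  have mixed: "c = F" if *: "c \<in> C" "F \<in> E" "y \<in> rel_interior c" "y \<in> rel_interior F" for c F y
  proof -
    have c: "c \<in> N2" "c \<subseteq> P" using *(1) by (auto simp: C_def)
    obtain \<beta> where \<beta>: "F \<in> B" "\<beta> \<in> B" "F \<subseteq> \<beta>" "\<not> \<beta> \<subseteq> P" using *(2) by (auto simp: E_def)
    have y: "y \<in> c" "y \<in> F" using *(3,4) rel_interior_subset by blast+
    obtain \<nu> where \<nu>: "\<nu> \<in> N1" "c \<subseteq> \<nu>" using refinement_of_cell[OF N2(2) c(1)] by blast
    have y\<nu>: "y \<in> \<nu>" using y \<nu> by blast
    have yP: "y \<in> X" "0 \<le> \<theta> y" using y c(2) by (auto simp: P_def)
    \<comment> \<open>Where \<open>\<theta>\<close> is positive, \<open>P\<close> is a neighbourhood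
      of \<open>y\<close>, and the relative interior of \<open>\<beta>\<close> would meet
      it.\<close>
    have \<theta>y: "\<theta> y = 0"
    proof (rule ccontr)
      assume "\<theta> y \<noteq> 0"
      then have pos: "0 < \<theta> y" using yP(2) by simp
      then have yi: "y \<in> interior X" using interior[OF yP(1) _ yP(2)] \<theta>L[of y] by force
      have "continuous_on (interior X) \<theta>"
        by (rule piecewise_linear_on_continuous[OF pl[OF \<theta>cc interior_subset]])
      then have o: "open (interior X \<inter> \<theta> -` {0<..})"
        by (rule continuous_open_preimage[OF _ open_interior open_greaterThan])
      obtain z where "z \<in> interior X \<inter> \<theta> -` {0<..}" "z \<in> rel_interior \<beta>"
        using meets_relint[OF cvxB[OF \<beta>(2)] _ o] y(2) \<beta>(3) yi pos by blast
      moreover from this have "z \<in> P" using interior_subset by (auto simp: P_def)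
      ultimately show False using B_out[OF \<beta>(2,4)] by blast
    qed
    \<comment> \<open>\<open>a0\<close> bounds the nonnegative \<open>\<theta>\<close> from above,
      so its vanishing at a relative interior point forces \<open>\<theta> = 0\<close> on
      \<open>c\<close>, and later on \<open>F\<close>.\<close>
    obtain a0 where a0: "a0 \<in> M \<nu>" "a0 \<bullet> y = 0" using M(4)[OF \<nu>(1) y\<nu>] \<theta>y by auto
    have \<theta>c: "\<theta> x = 0" if x: "x \<in> c" for x
    proof -
      have nn: "0 \<le> \<theta> z" if "z \<in> c" for z using that c(2) by (auto simp: P_def)
      have le: "\<theta> z \<le> a0 \<bullet> z" if "z \<in> c" for z using M(3)[OF \<nu>(1) _ a0(1)] that \<nu>(2) by blast
      have "a0 \<bullet> x = 0"
        by (rule linear_zero_on_rel_interior[OF cvxN2(1)[OF c(1)] *(3) _ a0(2) x]) (use nn le in force)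
      then show ?thesis using nn[OF x] le[OF x] by simp
    qed
    \<comment> \<open>Where \<open>\<theta>\<close> vanishes, \<open>g a\<close> is the minimum of 0
      and \<open>- a\<close>. Its linearity on \<open>c\<close> puts \<open>c\<close> into an
      arrangement cone; conversely it is linear on \<open>F\<close>, which puts \<open>F\<close>
      into a cell of \<open>N2\<close>.\<close>
    have "one_signed a c" if a: "a \<in> A2" for a
    proof -
      have "conewise_linear W N2 (g a)" using N2(3) a by blast
      then obtain l where "\<forall>x\<in>c. g a x = l \<bullet> x" using c(1) unfolding conewise_linear_def by blast
      then have "one_signed (- a) c"
        by (intro one_signed_if_min_linear[OF cvxN2(2)[OF c(1)], of _ l]) (auto simp: g_def \<theta>c)
      then show ?thesis by (simp add: one_signed_uminus)
    qed
    then obtain \<beta>' where \<beta>': "\<beta>' \<in> B" "c \<subseteq> \<beta>'" using B(4)[OF cvxN2(1)[OF c(1)]] y by blast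
    have "F face_of \<beta>'" by (rule wfan_face_of[OF B(1) \<beta>(1) \<beta>'(1) *(4)]) (use y \<beta>' in blast)
    then have cF: "c \<subseteq> F" by (rule subset_of_face_of[OF _ \<beta>'(2)]) (use y *(3) in blast)
    have F\<nu>: "F \<subseteq> \<nu>" by (rule B_in_\<nu>[OF \<beta>(1) \<nu>(1) *(4) y\<nu> yP(2)])
    have \<theta>F: "\<theta> x = 0" if x: "x \<in> F" for x
    proof -
      have nn: "0 \<le> \<theta> z" if "z \<in> F" for z by (rule B_\<theta>[OF \<beta>(1) \<nu>(1) *(4) y\<nu> yP(2) that])
      have le: "\<theta> z \<le> a0 \<bullet> z" if "z \<in> F" for z using M(3)[OF \<nu>(1) _ a0(1)] that F\<nu> by blast
      have "a0 \<bullet> x = 0"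
        by (rule linear_zero_on_rel_interior[OF cvxB[OF \<beta>(1)] *(4) _ a0(2) x]) (use nn le in force)
      then show ?thesis using nn[OF x] le[OF x] by simp
    qed
    have "\<exists>l. \<forall>x\<in>F. h x = l \<bullet> x" if h: "h \<in> ?H" for h
    proof -
      consider "h = (\<lambda>x. min 0 (\<theta> x))" | a where "a \<in> A2" "h = g a" using h by blast
      then show ?thesis
      proof cases
        case 1
        then show ?thesis by (intro exI[of _ 0]) (simp add: \<theta>F)
      next
        case 2
        from B(3)[OF \<beta>(1) 2(1)] show ?thesis unfolding one_signed_def
        proof
          assume "\<forall>x\<in>F. 0 \<le> a \<bullet> x"
          then show ?thesis unfolding 2(2) by (intro exI[of _ "- a"]) (auto simp: g_def \<theta>F)
        next
          assume "\<forall>x\<in>F. a \<bullet> x \<le> 0"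
          then show ?thesis unfolding 2(2) by (intro exI[of _ 0]) (auto simp: g_def \<theta>F)
        qed
      qed
    qed
    then obtain c' where c': "c' \<in> N2" "F \<subseteq> c'" using N2(4) cvxB[OF \<beta>(1)] y(2) \<nu>(1) F\<nu> by blast
    have "c face_of c'" by (rule wfan_face_of[OF N2(1) c(1) c'(1) *(3)]) (use y c' in blast)
    then have "F \<subseteq> c" by (rule subset_of_face_of[OF _ c'(2)]) (use y *(4) in blast)
    then show ?thesis using cF by blast
  qed
  have \<Sigma>C: "\<sigma> \<in> C" if \<sigma>: "\<sigma> \<in> \<Sigma>" for \<sigma>
  proof -
    have \<sigma>N1: "\<sigma> \<in> N1" using \<sigma> N1(3) by blast
    have nn: "\<theta> x = \<eta> x" "0 \<le> \<eta> x" "x \<in> X" if "x \<in> \<sigma>" for x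
    proof -
      show "x \<in> X" using that \<sigma>N1 X_def by blast
      then show "0 \<le> \<eta> x" by (rule \<eta>(3))
      show "\<theta> x = \<eta> x" using \<theta>\<Sigma> that \<sigma> by blast
    qed
    \<comment> \<open>On \<open>\<sigma>\<close> the function \<open>\<theta>\<close> equals
      \<open>\<eta>\<close>, and \<open>m\<close> times \<open>\<eta>\<close> dominates
      \<open>a\<close>; so all functions used for refining vanish and \<open>\<sigma>\<close> is not
      cut.\<close>
    have "h x = 0 \<bullet> x" if "h \<in> ?H" "x \<in> \<sigma>" for h x
      using that nn m[OF _ \<sigma>] by (auto simp: g_def add.commute)
    then have "\<forall>h\<in>?H. \<exists>l. \<forall>x\<in>\<sigma>. h x = l \<bullet> x" by blast
    moreover have "convex \<sigma>" "\<sigma> \<noteq> {}" using wcone_convex wcone_0 wfanD(3)[OF \<Sigma>(1) \<sigma>] by blast+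
    ultimately obtain \<kappa> where "\<kappa> \<in> N2" "\<sigma> \<subseteq> \<kappa>" using N2(4) \<sigma>N1 by blast
    then have "\<sigma> \<in> N2" using refinement_of_keeps_cell[OF N1(1) N2(1,2) \<sigma>N1] by blast
    then show ?thesis using nn by (auto simp: C_def P_def)
  qed
  have "wfan W (C \<union> E)"
  proof (rule wfanI)
    show "finite (C \<union> E)" using wfanD(1)[OF N2(1)] wfanD(1)[OF B(1)] by (simp add: C_def E_def)
    show "C \<union> E \<noteq> {}" using \<Sigma>C L(1) by blast
    show "wcone W \<kappa>" if "\<kappa> \<in> C \<union> E" for \<kappa>
      using that wfanD(3)[OF N2(1)] wfanD(3)[OF B(1)] unfolding C_def E_def by blast
    show "F \<in> C \<union> E" if \<kappa>: "\<kappa> \<in> C \<union> E" "F face_of \<kappa>" "F \<noteq> {}" for \<kappa> F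
    proof (cases "\<kappa> \<in> C")
      case True
      then have "F \<in> N2" "F \<subseteq> P" using wfanD(4)[OF N2(1) _ \<kappa>(2,3)] face_of_imp_subset[OF \<kappa>(2)] by (auto simp: C_def)
      then show ?thesis by (simp add: C_def)
    next
      case False
      then have "\<kappa> \<in> E" using \<kappa>(1) by blast
      then have "F \<in> E" using wfanD(4)[OF B(1) _ \<kappa>(2,3)] face_of_imp_subset[OF \<kappa>(2)] unfolding E_def by blast
      then show ?thesis by blast
    qed
    show "\<kappa> = \<mu>" if "\<kappa> \<in> C \<union> E" "\<mu> \<in> C \<union> E" "x \<in> rel_interior \<kappa>" "x \<in> rel_interior \<mu>" for \<kappa> \<mu> x
    proof -
      have "\<kappa> = \<mu>" if "\<kappa> \<in> C" "\<mu> \<in> C"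
        by (rule wfan_relint_unique[OF N2(1) _ _ \<open>x \<in> rel_interior \<kappa>\<close> \<open>x \<in> rel_interior \<mu>\<close>])
          (use that in \<open>auto simp: C_def\<close>)
      moreover have "\<kappa> = \<mu>" if "\<kappa> \<in> E" "\<mu> \<in> E"
        by (rule wfan_relint_unique[OF B(1) _ _ \<open>x \<in> rel_interior \<kappa>\<close> \<open>x \<in> rel_interior \<mu>\<close>])
          (use that in \<open>auto simp: E_def\<close>)
      ultimately show ?thesis using that mixed by blast
    qed
  qed
  moreover have "\<Union>(C \<union> E) = UNIV"
  proof -
    have "z \<in> \<Union>(C \<union> E)" for z
    proof (cases "z \<in> P")
      case True
      then obtain c where c: "c \<in> N2" "z \<in> rel_interior c"
        using wfan_point[OF N2(1), of z] XN2 by (auto simp: P_def)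
      have "conewise_linear W N2 (\<lambda>x. min 0 (\<theta> x))" using N2(3) by blast
      then obtain l where l: "\<And>x. x \<in> c \<Longrightarrow> min 0 (\<theta> x) = l \<bullet> x" using c(1) unfolding conewise_linear_def by blast
      have zc: "z \<in> c" using c(2) rel_interior_subset by blast
      \<comment> \<open>On \<open>c\<close> the function \<open>min 0 (\<theta> x)\<close> is
        linear, nonpositive and zero at the relative interior point \<open>z\<close>, hence zero
        throughout.\<close>
      have "0 \<le> \<theta> x" if x: "x \<in> c" for x
      proof -
        have "(- l) \<bullet> x = 0"
        proof (rule linear_zero_on_rel_interior[OF cvxN2(1)[OF c(1)] c(2) _ _ x])
          show "0 \<le> (- l) \<bullet> y" if "y \<in> c" for y using l[OF that] by (simp add: min_def split: if_splits)
          show "(- l) \<bullet> z = 0" using l[OF zc] True by (simp add: P_def)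
        qed
        then show ?thesis using l[OF x] by (simp add: min_def split: if_splits)
      qed
      then have "c \<in> C" using c(1) XN2 by (auto simp: C_def P_def)
      then show ?thesis using zc by blast
    next
      case False
      obtain \<beta> where "\<beta> \<in> B" "z \<in> \<beta>" using B(2) by blast
      then show ?thesis using False unfolding E_def by blast
    qed
    then show ?thesis by blast
  qed
  ultimately show ?thesis using \<Sigma>C by blast
qed

end

section \<open>Completion\<close>

context functional_group
begin

text \<open>The smallest cone has no proper nonempty face, so the inequalities defining it vanish on
  it and it is symmetric.\<close>

lemma wfan_lineality:
  assumes K: "wfan W K"
  shows "\<Inter>K \<in> K" "subspace (\<Inter>K)"
proof -
  have "\<Inter>T \<in> K" if "finite T" "T \<noteq> {}" "T \<subseteq> K" for T
    using that by (induction T rule: finite_ne_induct) (auto intro: wfanD(7)[OF K])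
  then show LK: "\<Inter>K \<in> K" using wfanD(1,2)[OF K] by blast
  let ?L = "\<Inter>K"
  obtain A where A: "finite A" "A \<subseteq> W" "?L = hcone A" using wfanD(3)[OF K LK] by (auto simp: wcone_def)
  let ?F = "{x \<in> ?L. \<forall>a\<in>A. a \<bullet> x = 0}"
  have "?F face_of ?L"
    by (rule face_of_zeros) (use A(3) convex_hcone[of A] in \<open>auto simp: hcone_def\<close>)
  moreover have "?F \<noteq> {}" using wcone_0[OF wfanD(3)[OF K LK]] by auto
  ultimately have "?F \<in> K" by (rule wfanD(4)[OF K LK])
  then have "?L \<subseteq> ?F" by blast
  then have "- x \<in> ?L" if "x \<in> ?L" for x using that unfolding A(3) by (auto simp: hcone_def)
  then show "subspace ?L"
    using wcone_convex_cone[OF wfanD(3)[OF K LK]] by (simp only: subspace_convex_cone_symmetric) blast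
qed

text \<open>The measure drops since all cones of \<open>star N v\<close> contain \<open>L\<close>
  and \<open>- v\<close>, while \<open>- v\<close> is not in \<open>L\<close>. A fan consisting of
  \<open>L\<close> alone is covered without a base case: nothing has to be thickened before
  \<open>wfan_fill\<close> applies.\<close>

theorem wfan_completion:
  assumes "wfan W \<Sigma>"
  shows "\<exists>\<Delta>. wfan W \<Delta> \<and> \<Sigma> \<subseteq> \<Delta> \<and> \<Union>\<Delta> = UNIV"
  using assms
proof (induction "DIM('b) - dim (\<Inter>\<Sigma>)" arbitrary: \<Sigma> rule: less_induct)
  case less
  note \<Sigma> = less.prems
  define L where "L = \<Inter>\<Sigma>"
  have L: "L \<in> \<Sigma>" "subspace L" using wfan_lineality[OF \<Sigma>] by (simp_all add: L_def)
  \<comment> \<open>Each star is taken in the fan grown so far rather than in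
    \<open>\<Sigma>\<close>, which keeps successive thickenings compatible.\<close>
  have "\<exists>N. wfan W N \<and> \<Sigma> \<subseteq> N \<and> (\<forall>\<rho>\<in>R. rel_interior \<rho> \<subseteq> interior (\<Union>N))"
    if "finite R" "R \<subseteq> \<Sigma> - {L}" for R
    using that
  proof (induction R rule: finite_induct)
    case empty
    then show ?case using \<Sigma> by blast
  next
    case (insert \<rho> R)
    then obtain N where N: "wfan W N" "\<Sigma> \<subseteq> N" "\<forall>\<rho>\<in>R. rel_interior \<rho> \<subseteq> interior (\<Union>N)" by auto
    have \<rho>: "\<rho> \<in> N" "L \<in> N" "\<rho> \<noteq> L" "L \<subseteq> \<rho>" using insert.prems N(2) L(1) L_def by auto
    obtain v where v: "v \<in> rel_interior \<rho>" using wfan_relint_ne[OF N(1) \<rho>(1)] by blast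
    then have v\<rho>: "v \<in> \<rho>" using rel_interior_subset by blast
    have vL: "v \<notin> L"
    proof
      assume "v \<in> L"
      then have "\<rho> \<subseteq> L" using wfan_face_of[OF N(1) \<rho>(1,2) v] face_of_imp_subset by blast
      then show False using \<rho>(3,4) by blast
    qed
    \<comment> \<open>Otherwise \<open>v\<close> and \<open>- v\<close>, both in
      \<open>\<rho>\<close>, would sum to a point of its face \<open>L\<close>, so \<open>v\<close>
      would lie in \<open>L\<close>.\<close>
    have nv: "- v \<notin> \<rho>"
    proof
      assume "- v \<in> \<rho>"
      moreover have "v + - v \<in> L" using subspace_0[OF L(2)] by simp
      ultimately have "v \<in> L"
        using face_of_cone_summand[OF wcone_convex_cone[OF wfanD(3)[OF N(1) \<rho>(1)]]
            wfan_subset_face_of[OF N(1) \<rho>(2,1,4)] v\<rho>] by blast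
      then show False using vL by blast
    qed
    have star: "wfan W (star N v)" by (rule wfan_star[OF N(1)]) (use v\<rho> \<rho>(1) in blast)
    have "insert (- v) L \<subseteq> \<Inter>(star N v)"
    proof (rule Inter_greatest)
      fix \<kappa> assume "\<kappa> \<in> star N v"
      then obtain \<tau> where \<tau>: "\<tau> \<in> N" "v \<in> \<tau>" "\<kappa> = tangent v \<tau>" by (auto simp: star_def)
      have c: "convex_cone \<tau>" by (rule wcone_convex_cone[OF wfanD(3)[OF N(1) \<tau>(1)]])
      have "\<rho> \<subseteq> \<tau>" using wfan_face_of[OF N(1) \<rho>(1) \<tau>(1) v \<tau>(2)] face_of_imp_subset by blast
      then show "insert (- v) L \<subseteq> \<kappa>"
        using subset_tangent[OF c \<tau>(2)] uminus_in_tangent[OF c \<tau>(2)] \<rho>(4) \<tau>(3) by blast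
    qed
    then have "dim (insert (- v) L) \<le> dim (\<Inter>(star N v))" by (rule dim_subset)
    moreover have "- v \<notin> span L" using vL subspace_neg[OF L(2), of "- v"] by (auto simp: span_eq_iff[THEN iffD2, OF L(2)])
    ultimately have "dim L < dim (\<Inter>(star N v))" by (simp add: dim_insert)
    \<comment> \<open>The bound makes the truncated subtraction in the measure decrease
      strictly.\<close>
    moreover have "dim (\<Inter>(star N v)) \<le> DIM('b)" by (rule dim_subset_UNIV)
    ultimately have "DIM('b) - dim (\<Inter>(star N v)) < DIM('b) - dim (\<Inter>\<Sigma>)" by (simp add: L_def)
    from less.hyps[OF this star] obtain \<Delta>0 where "wfan W \<Delta>0" "star N v \<subseteq> \<Delta>0" "\<Union>\<Delta>0 = UNIV" by blast
    from wfan_thicken[OF N(1) \<rho>(1) v nv this] obtain N' where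
      N': "wfan W N'" "N \<subseteq> N'" "rel_interior \<rho> \<subseteq> interior (\<Union>N')" by blast
    have "interior (\<Union>N) \<subseteq> interior (\<Union>N')" by (intro interior_mono Union_mono N'(2))
    then have "\<forall>\<mu>\<in>insert \<rho> R. rel_interior \<mu> \<subseteq> interior (\<Union>N')" using N(3) N'(3) by blast
    then show ?case using N'(1,2) N(2) by blast
  qed
  from this[OF _ order_refl] obtain N where N: "wfan W N" "\<Sigma> \<subseteq> N"
    "\<forall>\<rho>\<in>\<Sigma> - {L}. rel_interior \<rho> \<subseteq> interior (\<Union>N)"
    using wfanD(1)[OF \<Sigma>] by auto
  have "\<Union>\<Sigma> - L \<subseteq> interior (\<Union>N)"
  proof
    fix x assume x: "x \<in> \<Union>\<Sigma> - L"
    then obtain \<rho> where \<rho>: "\<rho> \<in> \<Sigma>" "x \<in> rel_interior \<rho>" using wfan_point[OF \<Sigma>] by blast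
    then have "\<rho> \<noteq> L" using x rel_interior_subset by blast
    then show "x \<in> interior (\<Union>N)" using N(3) \<rho> by blast
  qed
  then show ?case by (rule wfan_fill[OF N(1) \<Sigma> N(2) L])
qed

end

section \<open>Translation between admissible cones and cones over a group of functionals\<close>

lemma admissible_functional_group:
  assumes "real_add_subgroup \<Gamma>"
  shows "functional_group {w :: 'a::euclidean_space \<times> real. (\<lambda>x. fst w \<bullet> x) \<in> dual_lattice N \<and> snd w \<in> \<Gamma>}"
proof -
  have lin: "linear (\<lambda>x. p \<bullet> x)" for p :: 'a by (simp add: bounded_linear.linear bounded_linear_inner_right)
  show ?thesis
    by unfold_locales (use assms lin in \<open>auto simp: dual_lattice_def real_add_subgroup_def inner_add_left Ints_add Ints_minus\<close>)
qed

text \<open>Nontriviality of \<open>\<Gamma>\<close> enters here: a positive \<open>g\<close> in it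
  expresses t \<ge> 0 by a functional of the group. Vectors orthogonal to \<open>span N\<close>
  induce the zero homomorphism on \<open>N\<close>, so they and their negatives belong to the group
  and cut out \<open>span N\<close>.\<close>

lemma wcone_half_space:
  fixes N :: "'a::euclidean_space set"
  assumes "real_add_subgroup \<Gamma>" "\<Gamma> \<noteq> {0}"
  shows "wcone {w. (\<lambda>x. fst w \<bullet> x) \<in> dual_lattice N \<and> snd w \<in> \<Gamma>} (half_space N)" (is "wcone ?W _")
proof -
  have "\<exists>g\<in>\<Gamma>. g > 0"
  proof -
    obtain g where "g \<in> \<Gamma>" "g \<noteq> 0" using assms unfolding real_add_subgroup_def by blast
    moreover from this have "- g \<in> \<Gamma>" using assms(1) by (simp add: real_add_subgroup_def)
    ultimately show ?thesis by (cases "g > 0") (auto intro: bexI[of _ "- g"])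
  qed
  then obtain g where g: "g \<in> \<Gamma>" "g > 0" by blast
  have \<Gamma>0: "0 \<in> \<Gamma>" using assms(1) by (simp add: real_add_subgroup_def)
  obtain C where C: "C \<subseteq> (span N)\<^sup>\<bottom>" "independent C" "(span N)\<^sup>\<bottom> \<subseteq> span C"
    using basis_exists[of "(span N)\<^sup>\<bottom>"] by metis
  have fC: "finite C" by (rule independent_imp_finite[OF C(2)])
  have CN: "c \<bullet> x = 0" if "c \<in> C" "x \<in> span N" for c x
    using that C(1) by (force simp: orthogonal_comp_def orthogonal_def inner_commute)
  have span_eq: "x \<in> span N \<longleftrightarrow> (\<forall>c\<in>C. c \<bullet> x = 0)" for x
  proof
    assume x: "\<forall>c\<in>C. c \<bullet> x = 0"
    have "orthogonal y x" if "y \<in> span C" for y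
      using that by (rule orthogonal_to_span[THEN orthogonal_commute[THEN iffD1]]) (use x in \<open>auto simp: orthogonal_def inner_commute\<close>)
    then have "x \<in> ((span N)\<^sup>\<bottom>)\<^sup>\<bottom>" using C(3) by (auto simp: orthogonal_comp_def)
    then show "x \<in> span N" using orthogonal_comp_self[OF subspace_span] by blast
  qed (use CN in blast)
  let ?A = "insert (0, g) ((\<lambda>c. (c, 0)) ` C \<union> (\<lambda>c. (- c, 0)) ` C)"
  have "half_space N = hcone ?A"
  proof (intro set_eqI)
    fix z :: "'a \<times> real"
    show "z \<in> half_space N \<longleftrightarrow> z \<in> hcone ?A"
      using g(2) by (cases z) (auto simp: half_space_def hcone_def span_eq zero_le_mult_iff ball_Un intro: antisym)
  qed
  moreover have "?A \<subseteq> ?W"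
    using g \<Gamma>0 CN[OF _ span_base]
    by (auto simp: dual_lattice_def bounded_linear.linear bounded_linear_inner_right linear_compose_neg)
  ultimately show ?thesis using fC unfolding wcone_def by (intro exI[of _ ?A]) auto
qed

lemma admissible_cone_imp_wcone:
  fixes N :: "'a::euclidean_space set"
  assumes "real_add_subgroup \<Gamma>" "\<Gamma> \<noteq> {0}" "admissible_cone \<Gamma> N \<sigma>"
  shows "wcone {w. (\<lambda>x. fst w \<bullet> x) \<in> dual_lattice N \<and> snd w \<in> \<Gamma>} \<sigma>" (is "wcone ?W _")
proof -
  obtain l u \<gamma> where u: "\<forall>i\<in>{1..l::nat}. u i \<in> dual_lattice N \<and> \<gamma> i \<in> \<Gamma>"
    and \<sigma>: "\<sigma> = {(w, t). (w, t) \<in> half_space N \<and> (\<forall>i\<in>{1..l}. u i w + \<gamma> i * t \<ge> 0)}"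
    using assms(3) unfolding admissible_cone_def by blast
  \<comment> \<open>\<open>adjoint (u i) 1\<close> is the vector that represents the functional
    \<open>u i\<close> through the inner product.\<close>
  let ?f = "\<lambda>i. (adjoint (u i) 1, \<gamma> i)"
  have adj: "adjoint (u i) 1 \<bullet> x = u i x" if "i \<in> {1..l}" for i x
  proof -
    have "linear (u i)" using u that by (simp add: dual_lattice_def)
    then show ?thesis using adjoint_works[of "u i" x 1] by (simp add: inner_commute)
  qed
  have eq: "\<sigma> = half_space N \<inter> hcone (?f ` {1..l})"
    unfolding \<sigma> by (auto simp: hcone_def adj)
  have "(\<lambda>x. adjoint (u i) 1 \<bullet> x) = u i" if "i \<in> {1..l}" for i using adj[OF that] by (rule ext)
  then have "?f ` {1..l} \<subseteq> ?W" using u by auto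
  then show ?thesis
    unfolding eq by (intro wcone_restrict[OF wcone_half_space[OF assms(1,2)]] finite_imageI finite_atLeastAtMost)
qed

lemma wcone_imp_admissible_cone:
  fixes N :: "'a::euclidean_space set"
  assumes "wcone {w. (\<lambda>x. fst w \<bullet> x) \<in> dual_lattice N \<and> snd w \<in> \<Gamma>} \<sigma>" "\<sigma> \<subseteq> half_space N" "strongly_convex \<sigma>"
  shows "admissible_cone \<Gamma> N \<sigma>"
proof -
  obtain A where A: "finite A" "A \<subseteq> {w. (\<lambda>x. fst w \<bullet> x) \<in> dual_lattice N \<and> snd w \<in> \<Gamma>}" "\<sigma> = hcone A"
    using assms(1) unfolding wcone_def by blast
  obtain h where h: "bij_betw h {1..card A} A" using ex_bij_betw_nat_finite_1[OF A(1)] by blast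
  then have im: "A = h ` {1..card A}" by (simp add: bij_betw_def)
  have "\<forall>i\<in>{1..card A}. (\<lambda>x. fst (h i) \<bullet> x) \<in> dual_lattice N \<and> snd (h i) \<in> \<Gamma>"
    using A(2) im by blast
  moreover have "\<sigma> = {(w, t). (w, t) \<in> half_space N \<and> (\<forall>i\<in>{1..card A}. fst (h i) \<bullet> w + snd (h i) * t \<ge> 0)}"
  proof -
    have "\<sigma> = half_space N \<inter> hcone (h ` {1..card A})" using assms(2) A(3) im by auto
    then show ?thesis by (auto simp: hcone_def inner_prod_def)
  qed
  ultimately show ?thesis using assms(3) unfolding admissible_cone_def
    by (intro conjI exI[of _ "card A"] exI[of _ "\<lambda>i x. fst (h i) \<bullet> x"] exI[of _ "\<lambda>i. snd (h i)"])
qed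

text \<open>\<open>{0}\<close> is a face of every cone of the fan; a line in \<open>\<kappa>\<close>
  with direction \<open>v\<close> puts \<open>v\<close> and \<open>- v\<close> into
  \<open>\<kappa>\<close>, and they sum to a point of that face.\<close>

lemma strongly_convex_member:
  assumes K: "wfan W K" and "{0} \<in> K" "\<kappa> \<in> K"
  shows "strongly_convex \<kappa>"
proof -
  obtain A where A: "\<kappa> = hcone A" using wfanD(3)[OF K assms(3)] by (auto simp: wcone_def)
  have c: "convex_cone \<kappa>" by (rule wcone_convex_cone[OF wfanD(3)[OF K assms(3)]])
  have "v = 0" if line: "\<forall>c. x + c *\<^sub>R v \<in> \<kappa>" for x v
  proof -
    have av: "a \<bullet> v = 0" if "a \<in> A" for a
    proof (rule ccontr)
      assume n: "a \<bullet> v \<noteq> 0"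
      \<comment> \<open>The step along \<open>v\<close> is chosen so that \<open>a\<close> takes the
        value -1.\<close>
      have "0 \<le> a \<bullet> (x + (- (a \<bullet> x + 1) / (a \<bullet> v)) *\<^sub>R v)" using line that A by (auto simp: hcone_def)
      then show False using n by (simp add: inner_simps)
    qed
    then have "v \<in> \<kappa>" "- v \<in> \<kappa>" by (auto simp: A hcone_def)
    moreover have "v + - v \<in> {0} \<inter> \<kappa>" using convex_cone_contains_0[OF c] by simp
    ultimately have "v \<in> {0} \<inter> \<kappa>" using face_of_cone_summand[OF c wfanD(6)[OF K assms(2,3)]] by blast
    then show ?thesis by simp
  qed
  then show ?thesis using c unfolding strongly_convex_def by blast
qed

theorem theorem1p2:
  fixes \<Gamma> :: "real set" and N :: "'a::euclidean_space set" and \<Sigma> :: "('a \<times> real) set set"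
  assumes "real_add_subgroup \<Gamma>" and "\<Gamma> \<noteq> {0}"
    and "is_lattice N"
    and "admissible_fan \<Gamma> N \<Sigma>"
  shows "\<exists>\<Sigma>'. complete_fan N \<Sigma>' \<and> admissible_fan \<Gamma> N \<Sigma>' \<and> subfan \<Sigma> \<Sigma>'"
proof -
  define W where "W = {w :: 'a \<times> real. (\<lambda>x. fst w \<bullet> x) \<in> dual_lattice N \<and> snd w \<in> \<Gamma>}"
  interpret functional_group W unfolding W_def by (rule admissible_functional_group[OF assms(1)])
  have fan\<Sigma>: "fan \<Sigma>" and sub: "\<And>\<sigma>. \<sigma> \<in> \<Sigma> \<Longrightarrow> \<sigma> \<subseteq> half_space N"
    and adm: "\<And>\<sigma>. \<sigma> \<in> \<Sigma> \<Longrightarrow> admissible_cone \<Gamma> N \<sigma>"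
    using assms(4) by (auto simp: admissible_fan_def fan_in_half_space_def)
  have "wcone W \<sigma>" if "\<sigma> \<in> \<Sigma>" for \<sigma>
    unfolding W_def by (rule admissible_cone_imp_wcone[OF assms(1,2) adm[OF that]])
  then have \<Sigma>: "wfan W \<Sigma>" using fan\<Sigma> by (simp add: wfan_def fan_def)
  have wH: "wcone W (half_space N)" unfolding W_def by (rule wcone_half_space[OF assms(1,2)])
  \<comment> \<open>The whole space is completed first; cutting with the half-space afterwards
    leaves the cones of \<open>\<Sigma>\<close> intact because they lie in it.\<close>
  obtain \<Delta> where \<Delta>: "wfan W \<Delta>" "\<Sigma> \<subseteq> \<Delta>" "\<Union>\<Delta> = UNIV" using wfan_completion[OF \<Sigma>] by blast
  define \<Sigma>' where "\<Sigma>' = {F. F \<noteq> {} \<and> (\<exists>\<delta>\<in>\<Delta>. F face_of \<delta> \<inter> half_space N)}"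
  have w: "wcone W (\<delta> \<inter> half_space N)" if "\<delta> \<in> \<Delta>" for \<delta> by (rule wcone_Int[OF wfanD(3)[OF \<Delta>(1) that] wH])
  have \<Sigma>'w: "wfan W \<Sigma>'" unfolding \<Sigma>'_def by (rule wfan_cut[OF \<Delta>(1) w])
  have in\<Sigma>': "\<delta> \<inter> half_space N \<in> \<Sigma>'" if "\<delta> \<in> \<Delta>" for \<delta>
    using face_of_refl[OF wcone_convex[OF w[OF that]]] wcone_0[OF w[OF that]] that unfolding \<Sigma>'_def by blast
  have \<Sigma>\<Sigma>': "\<Sigma> \<subseteq> \<Sigma>'"
  proof
    fix \<sigma> assume "\<sigma> \<in> \<Sigma>"
    then show "\<sigma> \<in> \<Sigma>'" using in\<Sigma>'[of \<sigma>] sub[of \<sigma>] \<Delta>(2) by (auto simp: Int_absorb2)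
  qed
  \<comment> \<open>The lineality space is trivial because it is itself a strongly convex cone of
    \<open>\<Sigma>\<close>. Membership of \<open>{0}\<close> then carries strong convexity over to
    the new cones.\<close>
  have "\<Inter>\<Sigma> = {0}"
  proof -
    have "strongly_convex (\<Inter>\<Sigma>)" using fan\<Sigma> wfan_lineality(1)[OF \<Sigma>] by (simp add: fan_def)
    then have "x = 0" if "x \<in> \<Inter>\<Sigma>" for x
      using subspace_scale[OF wfan_lineality(2)[OF \<Sigma>] that] unfolding strongly_convex_def by (metis add_0)
    then show ?thesis using subspace_0[OF wfan_lineality(2)[OF \<Sigma>]] by blast
  qed
  then have "{0} \<in> \<Sigma>'" using wfan_lineality(1)[OF \<Sigma>] \<Sigma>\<Sigma>' by auto
  then have sc: "strongly_convex \<kappa>" if "\<kappa> \<in> \<Sigma>'" for \<kappa>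
    using strongly_convex_member[OF \<Sigma>'w _ that] by blast
  have fan\<Sigma>': "fan \<Sigma>'" using \<Sigma>'w sc by (simp add: wfan_def fan_def)
  have sub': "\<kappa> \<subseteq> half_space N" if "\<kappa> \<in> \<Sigma>'" for \<kappa>
    using that face_of_imp_subset unfolding \<Sigma>'_def by blast
  have "\<Union>\<Sigma>' = half_space N"
  proof (intro subset_antisym subsetI)
    fix x assume x: "x \<in> half_space N"
    obtain \<delta> where "\<delta> \<in> \<Delta>" "x \<in> \<delta>" using \<Delta>(3) by blast
    then show "x \<in> \<Union>\<Sigma>'" using in\<Sigma>' x by blast
  qed (use sub' in blast)
  moreover have "admissible_cone \<Gamma> N \<kappa>" if "\<kappa> \<in> \<Sigma>'" for \<kappa>
    by (rule wcone_imp_admissible_cone[OF wfanD(3)[OF \<Sigma>'w that, unfolded W_def] sub'[OF that] sc[OF that]])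
  ultimately show ?thesis
    using fan\<Sigma> fan\<Sigma>' sub' \<Sigma>\<Sigma>'
    by (intro exI[of _ \<Sigma>']) (simp add: complete_fan_def admissible_fan_def fan_in_half_space_def subfan_def)
qed

end
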